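(* Let $0<p<\infty$, $k\in\mathbb{N}$ and $\omega\in\mathcal{B}_\infty(\widehat{\mathcal{D}})$. Then $$\int_{\mathbb{D}}|f^{(k)}(z)|^p(1-|z|)^{kp}\omega(z)\,dA(z)+\sum_{j=0}^{k-1}|f^{(j)}(0)|^p\lesssim\|f\|_{A^p_\omega}^p,\quad f\in\mathcal{H}(\mathbb{D}).$$
   Context: $\mathbb{D}$ is the open unit disc in $\mathbb{C}$, $\mathcal{H}(\mathbb{D})$ the space of analytic functions in $\mathbb{D}$, $dA=\frac{dx\,dy}{\pi}$, and $\mathbb{N}=\{1,2,\dots\}$. A weight is a nonnegative function on $\mathbb{D}$ integrable with respect to $dA$; it is radial if $\omega(z)=\omega(|z|)$ for all $z\in\mathbb{D}$ and $\int_0^1\omega(s)\,ds<\infty$. Write $\omega(E)=\int_E\omega\,dA$. For a weight $\omega$, $\|f\|_{A^p_\omega}^p=\int_{\mathbb{D}}|f|^p\omega\,dA$ and $A^p_\omega=\{f\in\mathcal{H}(\mathbb{D}):\|f\|_{A^p_\omega}<\infty\}$. For $a\in\mathbb{D}\setminus\{0\}$ let $I_a=\{e^{i\theta}:|\arg(ae^{-i\theta})|\le\frac{1-|a|}{2}\}$; the Carleson square induced by $a$ is $S(a)=\{re^{it}\in\mathbb{D}:r\ge|a|,\ e^{it}\in I_a\}$. All weights are assumed to satisfy $\omega(S(a))>0$ for all $a\in\mathbb{D}\setminus\{0\}$. For a radial weight $\nu$ put $\widehat{\nu}(r)=\int_r^1\nu(s)\,ds$. Then $\nu\in\widehat{\mathcal{D}}$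 if there is $C>1$ with $\widehat{\nu}(r)\le C\widehat{\nu}(\frac{1+r}{2})$ for all $0\le r<1$. For $1<q<\infty$, $q'=\frac{q}{q-1}$, and a weight $\nu$, a function $W\ge0$ with $W\nu$ integrable belongs to $B_q(\nu)$ if $$\sup_S\frac{\left(\int_S W\nu\,dA\right)^{1/q}\left(\int_S W^{-q'/q}\nu\,dA\right)^{1/q'}}{\int_S\nu\,dA}<\infty,$$ the supremum being over all Carleson squares $S$. Thus, for a weight $\omega$, $\frac{\omega}{\nu}\in B_q(\nu)$ means $\left(\int_S\omega\,dA\right)^{1/q}\left(\int_S(\nu\,\omega^{-1/q})^{q'}dA\right)^{1/q'}\le C\nu(S)$ for all $S$, where the integrand in the second integral is taken to be $0$ where $\nu=0$ and $+\infty$ where $\omega=0<\nu$. Set $\mathcal{B}_\infty(\nu)=\bigcup_{1<q<\infty}\{\omega:\frac{\omega}{\nu}\in B_q(\nu)\}$ and $\mathcal{B}_\infty(\widehat{\mathcal{D}})=\bigcup_{\nu\in\widehat{\mathcal{D}}}\mathcal{B}_\infty(\nu)$. $X\lesssim Y$ means $X\le CY$ with a constant $C>0$ independent of $f$ (depending only on $\omega,p,k$). *)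

theory Defs
  imports "HOL-Analysis.Analysis"
begin

abbreviation unit_disc :: "complex set" where
  "unit_disc \<equiv> ball 0 1"

text \<open>Normalised Lebesgue area measure \<open>dx dy / \<pi>\<close> on the disc. Its space is the disc, so all
  notions below depend only on the values of a function there.\<close>

definition area_measure :: "complex measure" where
  "area_measure = density (lebesgue_on unit_disc) (\<lambda>_. ennreal (1 / pi))"

definition carleson_arc :: "complex \<Rightarrow> complex set" where
  "carleson_arc a = {cis \<theta> | \<theta>. \<bar>Arg (a * cis (- \<theta>))\<bar> \<le> (1 - norm a) / 2}"

definition carleson_square :: "complex \<Rightarrow> complex set" where
  "carleson_square a =
     {of_real r * cis t | r t. norm a \<le> r \<and> cis t \<in> carleson_arc a} \<inter> unit_disc"

definition weighted_area :: "(complex \<Rightarrow> real) \<Rightarrow> complex set \<Rightarrow> ennreal" where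
  "weighted_area \<omega> E = (\<integral>\<^sup>+z\<in>E. ennreal (\<omega> z) \<partial>area_measure)"

text \<open>The positivity on Carleson squares is a standing assumption on all weights.\<close>

definition weight :: "(complex \<Rightarrow> real) \<Rightarrow> bool" where
  "weight \<omega> \<longleftrightarrow>
     (\<forall>z\<in>unit_disc. 0 \<le> \<omega> z) \<and> integrable area_measure \<omega> \<and>
     (\<forall>a\<in>unit_disc - {0}. 0 < weighted_area \<omega> (carleson_square a))"

definition radial_weight :: "(complex \<Rightarrow> real) \<Rightarrow> bool" where
  "radial_weight \<nu> \<longleftrightarrow>
     weight \<nu> \<and> (\<forall>z\<in>unit_disc. \<nu> z = \<nu> (of_real (norm z))) \<and>
     set_integrable lebesgue {0..<1} (\<lambda>s. \<nu> (of_real s))"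

definition tail_integral :: "(complex \<Rightarrow> real) \<Rightarrow> real \<Rightarrow> real" where
  "tail_integral \<nu> r = (LINT s:{r..<1}|lebesgue. \<nu> (of_real s))"

definition D_hat :: "(complex \<Rightarrow> real) set" where
  "D_hat = {\<nu>. radial_weight \<nu> \<and>
     (\<exists>C>1. \<forall>r. 0 \<le> r \<and> r < 1 \<longrightarrow> tail_integral \<nu> r \<le> C * tail_integral \<nu> ((1 + r) / 2))}"

text \<open>Real powers on \<open>[0,\<infinity>]\<close>, used for positive exponents only.\<close>

definition ennreal_rpow :: "ennreal \<Rightarrow> real \<Rightarrow> ennreal" where
  "ennreal_rpow x s = (if x = \<infinity> then \<infinity> else ennreal (enn2real x powr s))"

text \<open>\<open>(\<nu> \<omega>\<^bsup>-1/q\<^esup>)\<^bsup>q'\<^esup>\<close> with \<open>q' = q / (q - 1)\<close>, with its conventions for vanishing weights;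
  real-valued \<open>powr\<close> alone would give \<open>0\<close> where \<open>\<omega> = 0 < \<nu>\<close>.\<close>

definition dual_integrand ::
    "real \<Rightarrow> (complex \<Rightarrow> real) \<Rightarrow> (complex \<Rightarrow> real) \<Rightarrow> complex \<Rightarrow> ennreal" where
  "dual_integrand q \<nu> \<omega> z =
     (if \<nu> z = 0 then 0
      else if \<omega> z = 0 then \<infinity>
      else ennreal ((\<nu> z * \<omega> z powr (- 1 / q)) powr (q / (q - 1))))"

text \<open>\<open>quotient_in_B q \<nu> \<omega>\<close> expresses \<open>\<omega>/\<nu> \<in> B\<^sub>q(\<nu>)\<close>. It is written in terms of \<open>\<omega>\<close> itself, as the
  quotient is undefined where \<open>\<nu>\<close> vanishes. The exponent of the second factor is
  \<open>1/q' = (q - 1) / q\<close>.\<close>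

definition quotient_in_B :: "real \<Rightarrow> (complex \<Rightarrow> real) \<Rightarrow> (complex \<Rightarrow> real) \<Rightarrow> bool" where
  "quotient_in_B q \<nu> \<omega> \<longleftrightarrow>
     (\<exists>C>0. \<forall>a\<in>unit_disc - {0}.
        ennreal_rpow (weighted_area \<omega> (carleson_square a)) (1 / q) *
        ennreal_rpow (\<integral>\<^sup>+z\<in>carleson_square a. dual_integrand q \<nu> \<omega> z \<partial>area_measure) ((q - 1) / q)
        \<le> ennreal C * weighted_area \<nu> (carleson_square a))"

definition B_infinity :: "(complex \<Rightarrow> real) \<Rightarrow> (complex \<Rightarrow> real) set" where
  "B_infinity \<nu> = (\<Union>q\<in>{1<..}. {\<omega>. weight \<omega> \<and> quotient_in_B q \<nu> \<omega>})"

definition B_infinity_D_hat :: "(complex \<Rightarrow> real) set" where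
  "B_infinity_D_hat = (\<Union>\<nu>\<in>D_hat. B_infinity \<nu>)"

text \<open>The \<open>p\<close>-th power of the weighted Bergman norm; it is \<open>\<infinity>\<close> outside the Bergman space.\<close>

definition bergman_norm_p :: "real \<Rightarrow> (complex \<Rightarrow> real) \<Rightarrow> (complex \<Rightarrow> complex) \<Rightarrow> ennreal" where
  "bergman_norm_p p \<omega> f = (\<integral>\<^sup>+z. ennreal (norm (f z) powr p * \<omega> z) \<partial>area_measure)"

end

theory Submission
  imports Defs "HOL-Complex_Analysis.Complex_Analysis"
begin

text \<open>
Let \<open>\<nu>\<close> be a radial doubling weight and \<open>\<omega>/\<nu> \<in> B\<^sub>q(\<nu>)\<close>. Write \<open>\<alpha> = p/q\<close>, \<open>g = |f|\<^bsup>\<alpha>\<^esup>\<close>, and let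
\<open>\<sigma> = (\<nu> \<omega>\<^bsup>-1/q\<^esup>)\<^bsup>q'\<^esup>\<close> be the dual weight. The theorem follows from two facts: the quantity
\<open>(|f\<^bsup>(k)\<^esup>(z)| (1-|z|)\<^bsup>k\<^esup>)\<^bsup>\<alpha>\<^esup>\<close> is at most a rapidly convergent sum of \<open>\<nu>\<close>-averages of \<open>g\<close> over squares
around \<open>z\<close>, and such averages are bounded from \<open>L\<^sup>q(\<omega>)\<close> to \<open>L\<^sup>q(\<omega>)\<close>.

Pointwise domination. By Cauchy's estimate it is enough to bound \<open>g\<close> on a disc around \<open>z\<close> of
radius \<open>(1-|z|)/4\<close>. The weight \<open>\<nu>\<close> may vanish on that disc, so a local mean value is of no use.
Instead \<open>g\<close> is compared with its means over full circles between \<open>z\<close> and the boundary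
(\<open>holomorphic_powr_mean\<close>), and these are integrated against \<open>\<nu>\<close>, which has much mass there by
doubling (\<open>radial_mean_le\<close>). The circles reach far away from \<open>z\<close>; this is repaired by applying
the estimate to \<open>f(\<zeta>) ((1-|z|)/(1 - cnj z \<zeta>))\<^sup>n\<close>. For large \<open>n\<close> the factor decays faster than the
masses of the squares around \<open>z\<close> can grow (\<open>subharmonic_dyadic_bound\<close>).

Averages on \<open>L\<^sup>q(\<omega>)\<close>. Dyadic squares form a tree, and for a tree the Carleson embedding theorem
(\<open>carleson_embedding\<close>) holds for every finite measure. It is used twice
(\<open>weighted_carleson_embedding\<close>). The \<open>\<nu>\<close>-average of \<open>g\<close> over \<open>Q\<close> is \<open>\<sigma>(Q)/\<nu>(Q)\<close> times the
\<open>\<sigma>\<close>-average of \<open>g\<nu>/\<sigma>\<close>, and the \<open>L\<^sup>q(\<sigma>)\<close> norm of \<open>g\<nu>/\<sigma>\<close> is the \<open>L\<^sup>q(\<omega>)\<close> norm of \<open>g\<close>. The Carleson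
condition needed for \<open>\<sigma>\<close> follows from the embedding in \<open>L\<^bsup>q'\<^esup>(\<omega>)\<close> applied to \<open>\<nu>/\<omega>\<close>, because the
\<open>B\<^sub>q\<close> condition turns \<open>\<sigma>(Q)/\<nu>(Q)\<close> into a power of \<open>\<nu>(Q)/\<omega>(Q)\<close>. What remains is a Carleson condition
for \<open>\<omega>\<close>, a geometric sum combined with the doubling of \<open>\<omega>\<close> (\<open>block_doubling\<close>).

A Carleson square never contains the origin, so a single instance of the \<open>B\<^sub>q\<close> condition says nothing
about \<open>\<sigma>\<close> near it. For this reason all averages are taken over squares in \<open>|z| \<ge> 1/2\<close>; only the \<open>\<omega>\<close>-masses
involve the centre of the disc.
\<close>

section \<open>Powers of holomorphic functions and their circular means\<close>

text \<open>The bound for the mean of \<open>|F|\<^bsup>\<alpha>\<^esup>\<close> comes from a holomorphic \<open>H\<close> that replaces the non-holomorphic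
\<open>F\<^bsup>\<alpha>\<^esup>\<close>: equal to it in modulus on the circle and at least as large inside. The class of functions
having such a majorant is closed under products, which reduces polynomials to linear factors.\<close>
definition circle_majorant :: "real \<Rightarrow> (complex \<Rightarrow> real) \<Rightarrow> bool" where
  "circle_majorant r u \<longleftrightarrow>
     (\<exists>H. H holomorphic_on ball 0 r \<and> continuous_on (cball 0 r) H \<and>
          (\<forall>x\<in>sphere 0 r. norm (H x) = u x) \<and> (\<forall>x\<in>ball 0 r. u x \<le> norm (H x)))"

lemma circle_majorant_mult:
  assumes "circle_majorant r u" "circle_majorant r v"
    and "\<And>x. 0 \<le> u x" "\<And>x. 0 \<le> v x"
  shows "circle_majorant r (\<lambda>x. u x * v x)"
proof -
  from assms(1) obtain H where H: "H holomorphic_on ball 0 r" "continuous_on (cball 0 r) H"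
      "\<forall>x\<in>sphere 0 r. norm (H x) = u x" "\<forall>x\<in>ball 0 r. u x \<le> norm (H x)"
    unfolding circle_majorant_def by blast
  from assms(2) obtain G where G: "G holomorphic_on ball 0 r" "continuous_on (cball 0 r) G"
      "\<forall>x\<in>sphere 0 r. norm (G x) = v x" "\<forall>x\<in>ball 0 r. v x \<le> norm (G x)"
    unfolding circle_majorant_def by blast
  show ?thesis unfolding circle_majorant_def
    by (rule exI[of _ "\<lambda>x. H x * G x"])
       (use H G assms(3,4) in \<open>auto intro!: holomorphic_intros continuous_intros simp: norm_mult mult_mono\<close>)
qed

lemma circle_majorant_const:
  assumes "0 \<le> c" shows "circle_majorant r (\<lambda>_. c)"
  unfolding circle_majorant_def using assms
  by (intro exI[of _ "\<lambda>_. of_real c"]) auto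

text \<open>For \<open>|a| \<ge> r\<close> the function \<open>1 - x/a\<close> maps the disc of radius \<open>r\<close> into the right half-plane, where the
principal power is holomorphic. A zero on the circle costs only continuity at that point.\<close>
lemma half_plane_powr:
  fixes a :: complex
  assumes "0 < r" "r \<le> norm a" "0 < \<alpha>"
  shows "circle_majorant r (\<lambda>x. norm (1 - x / a) powr \<alpha>)"
proof -
  let ?H = "\<lambda>x. (1 - x / a) powr (of_real \<alpha>)"
  have a: "a \<noteq> 0" using assms by auto
  have le: "norm (x / a) \<le> 1" if "norm x \<le> r" for x
    using that assms a by (simp add: norm_divide divide_le_eq)
  have Re: "0 \<le> Re (1 - x / a)" if "norm x \<le> r" for x
    using le[OF that] complex_Re_le_cmod[of "x / a"] by simp
  have nz: "0 < Re (1 - x / a)" if "norm x < r" for x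
  proof -
    have "norm (x / a) < 1" using that assms a by (simp add: norm_divide divide_less_eq)
    then show ?thesis using complex_Re_le_cmod[of "x / a"] by simp
  qed
  have hol: "?H holomorphic_on ball 0 r"
    by (rule holomorphic_on_powr) (use a nz in \<open>force intro!: holomorphic_intros simp: complex_nonpos_Reals_iff\<close>)+
  have norm: "norm (?H x) = norm (1 - x / a) powr \<alpha>" for x
    by (simp add: norm_powr_real_powr')
  have cont: "continuous_on (cball 0 r) ?H"
    unfolding continuous_on_eq_continuous_within
  proof
    fix x :: complex assume x: "x \<in> cball 0 r"
    show "continuous (at x within cball 0 r) ?H"
    proof (cases "1 - x / a = 0")
      case True
      have "((\<lambda>y. norm (1 - y / a) powr \<alpha>) \<longlongrightarrow> norm (1 - x / a) powr \<alpha>) (at x within cball 0 r)"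
        using assms(3) a by (intro tendsto_powr' tendsto_intros) auto
      then have "((\<lambda>y. norm (?H y)) \<longlongrightarrow> 0) (at x within cball 0 r)"
        using True unfolding norm by simp
      then have "(?H \<longlongrightarrow> 0) (at x within cball 0 r)" by (rule tendsto_norm_zero_cancel)
      then show ?thesis using True by (simp add: continuous_within)
    next
      case False
      then have "1 - x / a \<notin> \<real>\<^sub>\<le>\<^sub>0"
        using Re[of x] x by (auto simp: complex_nonpos_Reals_iff complex_eq_iff)
      then show ?thesis
        using a unfolding continuous_within by (intro tendsto_powr_complex tendsto_intros) auto
    qed
  qed
  show ?thesis unfolding circle_majorant_def
    using hol cont norm by (intro exI[of _ ?H]) auto
qed

text \<open>A zero inside the circle is reflected to \<open>r\<^sup>2/cnj a\<close>. This is division by a Blaschke factor, which has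
modulus \<open>1\<close> on the circle and at most \<open>1\<close> inside.\<close>
lemma circle_majorant_linear:
  fixes a :: complex
  assumes r: "0 < r" and \<alpha>: "0 < \<alpha>"
  shows "circle_majorant r (\<lambda>x. norm (x - a) powr \<alpha>)"
proof (cases "norm a < r")
  case False
  then have a: "a \<noteq> 0" using r by auto
  have "norm (x - a) powr \<alpha> = norm a powr \<alpha> * norm (1 - x / a) powr \<alpha>" for x
  proof -
    have "norm (x - a) = norm (a * (1 - x / a))" using a by (simp add: algebra_simps norm_minus_commute)
    then show ?thesis by (simp add: norm_mult powr_mult)
  qed
  then show ?thesis
    using circle_majorant_mult[OF circle_majorant_const half_plane_powr, of "norm a powr \<alpha>" r a \<alpha>] False r \<alpha>
    by simp
next
  case True
  have key: "(norm (r\<^sup>2 - cnj a * x))\<^sup>2 - r\<^sup>2 * (norm (x - a))\<^sup>2 = (r\<^sup>2 - (norm a)\<^sup>2) * (r\<^sup>2 - (norm x)\<^sup>2)" for x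
    by (simp only: cmod_power2) (simp add: power2_eq_square algebra_simps)
  have le: "r * norm (x - a) \<le> norm (r\<^sup>2 - cnj a * x)" if "norm x \<le> r" for x
  proof (rule power2_le_imp_le)
    have "0 \<le> (r\<^sup>2 - (norm a)\<^sup>2) * (r\<^sup>2 - (norm x)\<^sup>2)"
      using that True r by (intro mult_nonneg_nonneg) (auto intro!: power_mono)
    then show "(r * norm (x - a))\<^sup>2 \<le> (norm (r\<^sup>2 - cnj a * x))\<^sup>2"
      using key[of x] by (simp add: power_mult_distrib)
  qed simp
  have eq: "norm (r\<^sup>2 - cnj a * x) = r * norm (x - a)" if "norm x = r" for x
  proof (rule power2_eq_imp_eq)
    show "(norm (r\<^sup>2 - cnj a * x))\<^sup>2 = (r * norm (x - a))\<^sup>2"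
      using key[of x] that by (simp only: power_mult_distrib) simp
  qed (use r in auto)
  have "circle_majorant r (\<lambda>x. norm (complex_of_real (r\<^sup>2) - cnj a * x) powr \<alpha>)"
  proof (cases "a = 0")
    case True
    then show ?thesis by (simp add: circle_majorant_const)
  next
    case False
    have "norm (complex_of_real (r\<^sup>2) - cnj a * x) powr \<alpha>
        = (r\<^sup>2) powr \<alpha> * norm (1 - x / (r\<^sup>2 / cnj a)) powr \<alpha>" for x
    proof -
      have "norm (complex_of_real (r\<^sup>2) - cnj a * x) = norm (complex_of_real (r\<^sup>2) * (1 - x / (r\<^sup>2 / cnj a)))"
        using False r by (simp add: algebra_simps)
      then show ?thesis by (simp add: norm_mult powr_mult norm_power)
    qed
    moreover have "r \<le> norm (r\<^sup>2 / cnj a)"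
      using True False r by (simp add: norm_divide norm_mult pos_le_divide_eq power2_eq_square)
    ultimately show ?thesis
      using circle_majorant_mult[OF circle_majorant_const half_plane_powr, of "(r\<^sup>2) powr \<alpha>" r "r\<^sup>2 / cnj a" \<alpha>] r \<alpha>
      by simp
  qed
  then have "circle_majorant r (\<lambda>x. (1 / r) powr \<alpha> * norm (complex_of_real (r\<^sup>2) - cnj a * x) powr \<alpha>)"
    by (intro circle_majorant_mult circle_majorant_const) auto
  then obtain H where H: "H holomorphic_on ball 0 r" "continuous_on (cball 0 r) H"
      "\<forall>x\<in>sphere 0 r. norm (H x) = (1 / r) powr \<alpha> * norm (complex_of_real (r\<^sup>2) - cnj a * x) powr \<alpha>"
      "\<forall>x\<in>ball 0 r. (1 / r) powr \<alpha> * norm (complex_of_real (r\<^sup>2) - cnj a * x) powr \<alpha> \<le> norm (H x)"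
    unfolding circle_majorant_def by blast
  have 1: "(1 / r) powr \<alpha> * norm (complex_of_real (r\<^sup>2) - cnj a * x) powr \<alpha> = norm (x - a) powr \<alpha>" if "norm x = r" for x
    using eq[OF that] r by (simp add: powr_mult[symmetric] )
  have 2: "norm (x - a) powr \<alpha> \<le> (1 / r) powr \<alpha> * norm (complex_of_real (r\<^sup>2) - cnj a * x) powr \<alpha>" if "norm x \<le> r" for x
  proof -
    have "norm (x - a) \<le> (1 / r) * norm (complex_of_real (r\<^sup>2) - cnj a * x)"
      using le[OF that] r by (simp add: field_simps)
    then have "norm (x - a) powr \<alpha> \<le> ((1 / r) * norm (complex_of_real (r\<^sup>2) - cnj a * x)) powr \<alpha>"
      using \<alpha> by (intro powr_mono2) auto
    then show ?thesis using r by (simp only: powr_mult) 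
  qed
  have 3: "norm (x - a) powr \<alpha> \<le> norm (H x)" if "x \<in> ball 0 r" for x
    by (rule order_trans[OF 2]) (use H(4) that in auto)
  show ?thesis unfolding circle_majorant_def
    using H(1,2,3) 1 3 by (intro exI[of _ H]) simp
qed

lemma circle_majorant_poly:
  assumes r: "0 < r" and \<alpha>: "0 < \<alpha>"
  shows "circle_majorant r (\<lambda>x. norm (poly P x) powr \<alpha>)"
proof (induction "degree P" arbitrary: P rule: less_induct)
  case less
  show ?case
  proof (cases "degree P = 0")
    case True
    then obtain c where "P = [:c:]" using degree_eq_zeroE by blast
    then show ?thesis by (simp add: circle_majorant_const)
  next
    case False
    then have "\<exists>i\<in>{1..degree P}. coeff P i \<noteq> 0"
      by (intro bexI[of _ "degree P"]) auto
    then obtain a where "(\<Sum>i\<le>degree P. coeff P i * a ^ i) = 0"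
      using fundamental_theorem_of_algebra by metis
    then have "poly P a = 0" by (simp add: poly_altdef)
    then obtain Q where Q: "P = [:- a, 1:] * Q" by (metis dvdE poly_eq_0_iff_dvd)
    with False have "Q \<noteq> 0" by auto
    with Q have "degree Q < degree P" by (simp add: degree_mult_eq del: mult_pCons_left)
    from circle_majorant_mult[OF circle_majorant_linear[OF r \<alpha>, of a] less[OF this]]
    have "circle_majorant r (\<lambda>x. norm (x - a) powr \<alpha> * norm (poly Q x) powr \<alpha>)" by simp
    moreover have "norm (x - a) powr \<alpha> * norm (poly Q x) powr \<alpha> = norm (poly P x) powr \<alpha>" for x
    proof -
      have "poly P x = (x - a) * poly Q x" by (simp add: Q algebra_simps)
      then show ?thesis by (simp add: norm_mult powr_mult)
    qed
    ultimately show ?thesis by simp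
  qed
qed

text \<open>The Cauchy formula for \<open>H\<close>. The Cauchy kernel replaces the Poisson kernel; the factor lost by this
is harmless, since the point will stay away from the circle on its own scale.\<close>
lemma circle_majorant_mean:
  assumes u: "circle_majorant r u" and r: "0 < r" and w: "norm w < r"
    and cu: "continuous_on (sphere 0 r) u"
  shows "u w \<le> r / (r - norm w) * integral {0..1} (\<lambda>t. u (r * cis (2 * pi * t)))"
proof -
  obtain H where H: "H holomorphic_on ball 0 r" "continuous_on (cball 0 r) H"
      "\<forall>x\<in>sphere 0 r. norm (H x) = u x" "\<forall>x\<in>ball 0 r. u x \<le> norm (H x)"
    using u unfolding circle_majorant_def by blast
  have ci: "((\<lambda>z. H z / (z - w)) has_contour_integral (2 * of_real pi * \<i> * H w)) (circlepath 0 r)"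
    by (rule Cauchy_integral_circlepath) (use H w in auto)
  let ?f = "\<lambda>t. H (r * cis (2*pi*t)) / (r * cis (2*pi*t) - w) * (2 * pi * \<i> * r * cis (2*pi*t))"
  let ?g = "\<lambda>t. 2 * pi * r / (r - norm w) * u (r * cis (2 * pi * t))"
  have "((\<lambda>t. H (circlepath 0 r t) / (circlepath 0 r t - w) * vector_derivative (circlepath 0 r) (at t within {0..1}))
      has_integral (2 * of_real pi * \<i> * H w)) {0..1}"
    using ci by (simp only: has_contour_integral_def)
  then have f: "(?f has_integral (2 * of_real pi * \<i> * H w)) {0..1}"
  proof (rule has_integral_eq[rotated])
    fix t :: real assume "t \<in> {0..1}"
    then have "vector_derivative (circlepath 0 r) (at t within {0..1}) = 2 * pi * \<i> * r * cis (2*pi*t)"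
      by (simp add: vector_derivative_circlepath01 cis_conv_exp mult_ac)
    moreover have "circlepath 0 r t = r * cis (2*pi*t)"
      by (simp add: circlepath cis_conv_exp mult_ac)
    ultimately show "H (circlepath 0 r t) / (circlepath 0 r t - w) * vector_derivative (circlepath 0 r) (at t within {0..1}) = ?f t"
      by simp
  qed
  have cg: "continuous_on {0..1} ?g"
    by (intro continuous_intros continuous_on_compose2[OF cu]) (use r in \<open>auto simp: norm_mult\<close>)
  have "norm (2 * of_real pi * \<i> * H w) \<le> integral {0..1} ?g"
  proof -
    have "norm (integral {0..1} ?f) \<le> integral {0..1} ?g"
    proof (rule integral_norm_bound_integral)
      show "?f integrable_on {0..1}" using f by blast
      show "?g integrable_on {0..1}" by (rule integrable_continuous_interval[OF cg])
      fix t :: real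
      let ?x = "r * cis (2*pi*t)"
      have x: "norm ?x = r" using r by (simp add: norm_mult)
      have hu: "norm (H ?x) = u ?x" using H(3) x by simp
      then have "0 \<le> u ?x" by (metis norm_ge_zero)
      have "r - norm w \<le> norm (?x - w)" using norm_triangle_ineq2[of ?x w] x by simp
      with \<open>0 \<le> u ?x\<close> have "u ?x / norm (?x - w) \<le> u ?x / (r - norm w)"
        using w \<open>0 \<le> u ?x\<close> by (intro divide_left_mono mult_pos_pos) auto
      then have "2 * pi * r * (u ?x / norm (?x - w)) \<le> 2 * pi * r * (u ?x / (r - norm w))"
        using r by (intro mult_left_mono) auto
      then show "norm (?f t) \<le> ?g t"
        using hu x r by (simp add: norm_mult norm_divide mult_ac)
    qed
    then show ?thesis using f by (simp add: integral_unique)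
  qed
  then have "2 * pi * norm (H w) \<le> 2 * pi * (r / (r - norm w) * integral {0..1} (\<lambda>t. u (r * cis (2 * pi * t))))"
    by (simp add: norm_mult mult_ac)
  then have "norm (H w) \<le> r / (r - norm w) * integral {0..1} (\<lambda>t. u (r * cis (2 * pi * t)))"
    by (rule mult_left_le_imp_le) simp
  with H(4) w show ?thesis by force
qed

lemma continuous_on_norm_powr:
  assumes "continuous_on S f" "0 < \<alpha>"
  shows "continuous_on S (\<lambda>x. norm (f x) powr \<alpha>)"
  by (rule continuous_on_powr') (use assms in \<open>auto intro: continuous_intros\<close>)

text \<open>Taylor polynomials are uniformly bounded on the circle, so the estimate for polynomials passes to the
limit by dominated convergence. Every exponent \<open>\<alpha> > 0\<close> is needed, as \<open>\<alpha> = p/q\<close> may be small.\<close>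
lemma holomorphic_powr_mean:
  assumes F: "F holomorphic_on ball 0 R" and r: "0 < r" "r < R" and w: "norm w < r" and \<alpha>: "0 < \<alpha>"
  shows "norm (F w) powr \<alpha> \<le> r / (r - norm w) * integral {0..1} (\<lambda>t. norm (F (r * cis (2 * pi * t))) powr \<alpha>)"
proof -
  define c where "c n = (deriv ^^ n) F 0 / fact n" for n
  define P where "P n = (\<Sum>i<n. monom (c i) i)" for n
  have P: "poly (P n) x = (\<Sum>i<n. c i * x ^ i)" for n x
    by (simp add: P_def poly_sum poly_monom)
  have sums: "(\<lambda>n. c n * x ^ n) sums F x" if "norm x < R" for x
    using holomorphic_power_series[OF F, of x] that by (simp add: c_def)
  then have lim: "(\<lambda>n. poly (P n) x) \<longlonglongrightarrow> F x" if "norm x < R" for x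
    using that by (simp add: P sums_def)
  obtain s where s: "r < s" "s < R" using r dense by blast
  have "summable (\<lambda>n. c n * of_real s ^ n)"
    using sums[of "of_real s"] s r by (simp add: sums_iff)
  then have summ: "summable (\<lambda>n. norm (c n * of_real r ^ n))"
    by (rule powser_insidea) (use s r in auto)
  define B where "B = (\<Sum>n. norm (c n * of_real r ^ n))"
  have B: "norm (poly (P n) x) \<le> B" if "norm x = r" for n x
  proof -
    have "norm (poly (P n) x) \<le> (\<Sum>i<n. norm (c i * x ^ i))" unfolding P by (rule norm_sum)
    also have "\<dots> = (\<Sum>i<n. norm (c i * of_real r ^ i))" using that r by (simp add: norm_mult norm_power)
    also have "\<dots> \<le> B" unfolding B_def by (rule sum_le_suminf[OF summ]) auto
    finally show ?thesis .
  qed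
  let ?u = "\<lambda>n t. norm (poly (P n) (r * cis (2 * pi * t))) powr \<alpha>"
  have "(\<lambda>n. integral {0..1} (?u n)) \<longlonglongrightarrow> integral {0..1} (\<lambda>t. norm (F (r * cis (2 * pi * t))) powr \<alpha>)"
  proof (rule dominated_convergence(2))
    show "?u n integrable_on {0..1}" for n
      by (intro integrable_continuous_interval continuous_on_norm_powr[OF _ \<alpha>] continuous_intros)
    show "(\<lambda>_. B powr \<alpha>) integrable_on {0..1::real}"
      by (intro integrable_continuous_interval continuous_intros)
    show "norm (?u n t) \<le> B powr \<alpha>" for n t
      using \<alpha> B[of "r * cis (2*pi*t)" n] r by (auto simp: norm_mult intro!: powr_mono2)
    show "(\<lambda>n. ?u n t) \<longlonglongrightarrow> norm (F (r * cis (2 * pi * t))) powr \<alpha>" for t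
      using \<alpha> r by (intro tendsto_powr' tendsto_intros lim) (auto simp: norm_mult)
  qed
  then have 1: "(\<lambda>n. r / (r - norm w) * integral {0..1} (?u n)) \<longlonglongrightarrow>
      r / (r - norm w) * integral {0..1} (\<lambda>t. norm (F (r * cis (2 * pi * t))) powr \<alpha>)"
    by (intro tendsto_intros)
  have 2: "(\<lambda>n. norm (poly (P n) w) powr \<alpha>) \<longlonglongrightarrow> norm (F w) powr \<alpha>"
    using \<alpha> r w by (intro tendsto_powr' tendsto_intros lim) auto
  have "norm (poly (P n) w) powr \<alpha> \<le> r / (r - norm w) * integral {0..1} (?u n)" for n
    by (rule circle_majorant_mean[OF circle_majorant_poly[OF r(1) \<alpha>] r(1) w])
       (intro continuous_on_norm_powr[OF _ \<alpha>] continuous_intros)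
  then show ?thesis by (intro LIMSEQ_le[OF 2 1]) auto
qed

section \<open>Rotation invariance and radial integration\<close>
text \<open>The plane is identified with \<open>real ^ 2\<close>, where orthogonal maps preserve Lebesgue measure.\<close>
definition vec_of_complex :: "complex \<Rightarrow> real^2" where
  "vec_of_complex z = vector [Re z, Im z]"

definition complex_of_vec :: "real^2 \<Rightarrow> complex" where
  "complex_of_vec v = Complex (vec_nth v 1) (vec_nth v 2)"

lemma vec_of_complex_inv: "vec_of_complex (complex_of_vec v) = v"
  by (simp add: vec_of_complex_def complex_of_vec_def vec_eq_iff forall_2)

lemma complex_of_vec_inv: "complex_of_vec (vec_of_complex z) = z"
  by (simp add: vec_of_complex_def complex_of_vec_def)

lemma measurable_complex_of_vec: "complex_of_vec \<in> borel_measurable borel"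
  unfolding complex_of_vec_def
  by (intro borel_measurable_continuous_onI) (auto intro!: continuous_intros simp: Complex_eq)

lemma vec_of_complex_inner: "vec_of_complex z \<bullet> vec_of_complex w = z \<bullet> w"
  by (simp add: vec_of_complex_def inner_vec_def sum_2 inner_complex_def)

lemma linear_vec_of_complex: "linear vec_of_complex"
  by (rule linearI) (auto simp: vec_of_complex_def vec_eq_iff forall_2)

lemma lborel_vec: "distr lborel borel complex_of_vec = lborel"
proof (rule lborel_eqI[symmetric])
  note m = measurable_complex_of_vec
  fix l u :: complex assume le: "\<And>b. b \<in> Basis \<Longrightarrow> l \<bullet> b \<le> u \<bullet> b"
  have B: "complex_of_vec -` box l u = box (vec_of_complex l) (vec_of_complex u)"
    by (auto simp: mem_box_cart forall_2 vec_of_complex_def complex_of_vec_def in_box_complex_iff)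
  show "emeasure (distr lborel borel complex_of_vec) (box l u) = (\<Prod>b\<in>Basis. (u - l) \<bullet> b)"
    using le[of 1] le[of \<i>] m by (subst emeasure_distr) (auto simp: B emeasure_lborel_box_eq Basis_vec_def Basis_complex_def vec_of_complex_def axis_eq_axis prod.UNION_disjoint UNIV_2 inner_axis inner_complex_def)
qed simp

lemma emeasure_vec_image:
  assumes "S \<in> sets borel"
  shows "emeasure lborel S = emeasure lebesgue (vec_of_complex ` S)"
proof -
  let ?g = complex_of_vec
  note m = measurable_complex_of_vec
  have im: "vec_of_complex ` S = ?g -` S"
  proof (intro set_eqI iffI)
    fix v assume "v \<in> ?g -` S" then show "v \<in> vec_of_complex ` S"
      by (metis vec_of_complex_inv image_eqI vimageD)
  qed (auto simp: complex_of_vec_inv)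
  have "emeasure lborel S = emeasure (distr lborel borel ?g) S" by (simp add: lborel_vec)
  also have "\<dots> = emeasure lborel (?g -` S)" using assms m by (simp add: emeasure_distr)
  finally show ?thesis using im measurable_sets[OF m assms] by simp
qed

lemma lborel_rotation: "distr lborel borel (\<lambda>z::complex. cis t * z) = lborel"
proof (rule lborel_eqI[symmetric])
  let ?T = "\<lambda>z::complex. cis t * z"
  let ?g = complex_of_vec
  let ?R = "\<lambda>v. vec_of_complex (cis t * ?g v)"
  have m: "?T \<in> borel_measurable borel"
    by (intro borel_measurable_continuous_onI continuous_intros)
  fix l u :: complex assume le: "\<And>b. b \<in> Basis \<Longrightarrow> l \<bullet> b \<le> u \<bullet> b"
  let ?S = "?T -` box l u"
  have S: "?S \<in> sets borel" using measurable_sets[OF m, of "box l u"] by simp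
  have lin: "orthogonal_transformation ?R"
  proof -
    have "linear ?R"
      by (rule linearI) (auto simp: vec_of_complex_def complex_of_vec_def vec_eq_iff forall_2 algebra_simps)
    moreover have "?R v \<bullet> ?R w = v \<bullet> w" for v w
    proof -
      have "?R v \<bullet> ?R w = (cis t * ?g v) \<bullet> (cis t * ?g w)" by (rule vec_of_complex_inner)
      also have "\<dots> = ?g v \<bullet> ?g w"
      proof -
        have "(cos t * a - sin t * b) * (cos t * c - sin t * d) + (cos t * b + sin t * a) * (cos t * d + sin t * c)
             = (a*c+b*d) * ((sin t)\<^sup>2 + (cos t)\<^sup>2)" for a b c d
          by algebra
        then show ?thesis by (simp add: inner_complex_def complex_of_vec_def)
      qed
      also have "\<dots> = v \<bullet> w" by (metis vec_of_complex_inner vec_of_complex_inv)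
      finally show ?thesis .
    qed
    ultimately show ?thesis by (simp add: orthogonal_transformation_def)
  qed
  have bS: "bounded ?S"
  proof -
    obtain B where "\<And>x. x \<in> box l u \<Longrightarrow> norm x \<le> B" using bounded_box[of l u] unfolding bounded_iff by blast
    then have "norm (cis t * x) \<le> B" if "x \<in> ?S" for x using that by auto
    then show ?thesis by (intro boundedI[of _ B]) (auto simp: norm_mult)
  qed
  let ?V = "vec_of_complex ` ?S"
  have eqV: "?V = ?g -` ?S"
  proof (intro set_eqI iffI)
    fix v assume "v \<in> ?g -` ?S" then show "v \<in> ?V"
      by (metis vec_of_complex_inv image_eqI vimageD)
  qed (auto simp: complex_of_vec_inv)
  note mg = measurable_complex_of_vec
  have "bounded ?V" using bS linear_vec_of_complex bounded_linear_image linear_conv_bounded_linear by blast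
  moreover have "?V \<in> sets lebesgue" unfolding eqV using measurable_sets[OF mg S] by simp
  ultimately have V: "?V \<in> lmeasurable" using bounded_set_imp_lmeasurable by blast
  have im: "?R ` ?V = vec_of_complex ` box l u"
  proof -
    have "?R ` ?V = vec_of_complex ` (?T ` ?S)"
      by (simp only: image_image complex_of_vec_inv)
    also have "?T ` ?S = box l u"
    proof (intro set_eqI iffI)
      fix x assume x: "x \<in> box l u"
      have "x = ?T (cis (-t) * x)" by (simp add: mult.assoc[symmetric] cis_mult)
      with x show "x \<in> ?T ` ?S" by (metis (no_types, lifting) image_eqI vimageI)
    qed auto
    finally show ?thesis .
  qed
  have "emeasure (distr lborel borel ?T) (box l u) = emeasure lborel ?S"
    using m by (simp add: emeasure_distr)
  also have "\<dots> = emeasure lebesgue ?V" by (rule emeasure_vec_image[OF S])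
  also have "\<dots> = ennreal (measure lebesgue ?V)" using V by (simp add: emeasure_eq_measure2)
  also have "measure lebesgue ?V = measure lebesgue (?R ` ?V)" 
    using measure_orthogonal_image[OF lin V] by simp
  also have "ennreal \<dots> = emeasure lebesgue (?R ` ?V)" 
    using measurable_orthogonal_image[OF lin V] by (simp add: emeasure_eq_measure2)
  also have "\<dots> = emeasure lborel (box l u)" unfolding im by (rule emeasure_vec_image[symmetric]) auto
  also have "\<dots> = (\<Prod>b\<in>Basis. (u - l) \<bullet> b)" using le by (simp add: emeasure_lborel_box)
  finally show "emeasure (distr lborel borel ?T) (box l u) = (\<Prod>b\<in>Basis. (u - l) \<bullet> b)" .
qed simp

text \<open>Weights are only Lebesgue measurable, so the invariance has to pass from Borel sets to the completion.\<close>
lemma lebesgue_rotation: "distr lebesgue lebesgue (\<lambda>z::complex. cis t * z) = lebesgue"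
proof -
  let ?T = "\<lambda>z::complex. cis t * z"
  have m: "?T \<in> borel_measurable borel"
    by (intro borel_measurable_continuous_onI continuous_intros)
  have d: "distr lebesgue lborel ?T = lborel"
    using lborel_rotation[of t] m by (subst distr_completion) (auto cong: distr_cong)
  have "?T \<in> lebesgue \<rightarrow>\<^sub>M lborel" using m by (simp add: measurable_completion)
  from completion.completion_distr_eq[OF this] d show ?thesis by simp
qed

lemma measurable_lebesgue_rotation: "(\<lambda>z::complex. cis t * z) \<in> lebesgue \<rightarrow>\<^sub>M lebesgue"
proof -
  let ?T = "\<lambda>z::complex. cis t * z"
  have m: "?T \<in> borel_measurable borel"
    by (intro borel_measurable_continuous_onI continuous_intros)
  have d: "distr lebesgue lborel ?T = lborel"
    using lborel_rotation[of t] m by (subst distr_completion) (auto cong: distr_cong)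
  have "?T \<in> lebesgue \<rightarrow>\<^sub>M lborel" using m by (simp add: measurable_completion)
  then show ?thesis by (rule completion.measurable_completion2) (simp add: d)
qed

lemma space_area_measure [simp]: "space area_measure = unit_disc"
  by (simp add: area_measure_def space_restrict_space)

lemma sets_area_measure: "sets area_measure = sets (lebesgue_on unit_disc)"
  by (simp add: area_measure_def)

lemma nn_integral_area_measure_lebesgue:
  assumes "f \<in> borel_measurable area_measure"
  shows "(\<integral>\<^sup>+z. f z \<partial>area_measure) = (\<integral>\<^sup>+z. ennreal (1/pi) * f z * indicator unit_disc z \<partial>lebesgue)"
proof -
  have f: "f \<in> borel_measurable (lebesgue_on unit_disc)" using assms by (simp add: area_measure_def)
  have "(\<integral>\<^sup>+z. f z \<partial>area_measure) = (\<integral>\<^sup>+z. ennreal (1/pi) * f z \<partial>lebesgue_on unit_disc)"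
    unfolding area_measure_def by (subst nn_integral_density) (use f in auto)
  also have "\<dots> = (\<integral>\<^sup>+z. ennreal (1/pi) * f z * indicator unit_disc z \<partial>lebesgue)"
    by (subst nn_integral_restrict_space) auto
  finally show ?thesis .
qed

lemma measurable_area_rotation: "(\<lambda>z. cis t * z) \<in> area_measure \<rightarrow>\<^sub>M area_measure"
proof -
  have "(\<lambda>z. cis t * z) \<in> lebesgue_on unit_disc \<rightarrow>\<^sub>M lebesgue_on unit_disc"
    by (rule measurable_restrict_space3[OF measurable_lebesgue_rotation]) (auto simp: norm_mult)
  then show ?thesis by (simp add: area_measure_def)
qed

lemma nn_integral_area_rotation:
  assumes f: "f \<in> borel_measurable area_measure"
  shows "(\<integral>\<^sup>+z. f (cis t * z) \<partial>area_measure) = (\<integral>\<^sup>+z. f z \<partial>area_measure)"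
proof -
  let ?G = "\<lambda>z. ennreal (1/pi) * f z * indicator unit_disc z"
  have f': "f \<in> borel_measurable (lebesgue_on unit_disc)" using f by (simp add: area_measure_def)
  have f'': "(\<lambda>z. f z * indicator unit_disc z) \<in> borel_measurable lebesgue"
    using f' by (subst (asm) borel_measurable_restrict_space_iff_ennreal) (simp_all add: lmeasurable_ball)
  then have G: "?G \<in> borel_measurable lebesgue"
    unfolding mult.assoc by (rule borel_measurable_times_ennreal[OF borel_measurable_const])
  have "(\<integral>\<^sup>+z. f z \<partial>area_measure) = (\<integral>\<^sup>+z. ?G z \<partial>distr lebesgue lebesgue (\<lambda>z. cis t * z))"
    by (simp only: nn_integral_area_measure_lebesgue[OF f] lebesgue_rotation)
  also have "\<dots> = (\<integral>\<^sup>+z. ?G (cis t * z) \<partial>lebesgue)"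
    by (rule nn_integral_distr) (use measurable_lebesgue_rotation G in simp_all)
  also have "\<dots> = (\<integral>\<^sup>+z. ennreal (1/pi) * f (cis t * z) * indicator unit_disc z \<partial>lebesgue)"
    by (intro nn_integral_cong) (simp add: indicator_def norm_mult)
  also have "\<dots> = (\<integral>\<^sup>+z. f (cis t * z) \<partial>area_measure)"
    by (rule nn_integral_area_measure_lebesgue[symmetric])
       (rule measurable_compose[OF measurable_area_rotation f])
  finally show ?thesis by simp
qed


text \<open>This replaces polar coordinates: only radial functions will be integrated in this way, so the image of
the area under the modulus suffices. Both measures are finite and agree on half-lines.\<close>
lemma distr_norm_disc:
  "distr (density lborel (indicator unit_disc)) borel (norm :: complex \<Rightarrow> real) =
   density lborel (\<lambda>s. ennreal (2 * pi * s) * indicator {0..<1} s)" (is "?M = ?N")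
proof (rule measure_eqI_lessThan)
  fix x :: real
  have N: "emeasure ?N {x<..} = (\<integral>\<^sup>+s. ennreal (2 * pi * s) * indicator {max 0 x<..<1} s \<partial>lborel)"
  proof -
    have "emeasure ?N {x<..} = (\<integral>\<^sup>+s. ennreal (2 * pi * s) * indicator {0..<1} s * indicator {x<..} s \<partial>lborel)"
      by (subst emeasure_density) auto
    also have "\<dots> = (\<integral>\<^sup>+s. ennreal (2 * pi * s) * indicator {max 0 x<..<1} s \<partial>lborel)"
      by (intro nn_integral_cong) (auto simp: indicator_def max_def)
    finally show ?thesis .
  qed
  have M: "emeasure ?M {x<..} = emeasure lborel ({z. x < norm z} \<inter> unit_disc)"
  proof -
    have "emeasure ?M {x<..} = emeasure (density lborel (indicator unit_disc)) {z::complex. x < norm z}"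
      by (subst emeasure_distr) (auto simp: vimage_def)
    also have "\<dots> = (\<integral>\<^sup>+z. indicator unit_disc z * indicator {z. x < norm z} z \<partial>lborel)"
      by (subst emeasure_density) (auto intro!: borel_measurable_indicator)
    also have "\<dots> = (\<integral>\<^sup>+z. indicator ({z. x < norm z} \<inter> unit_disc) z \<partial>lborel)"
      by (intro nn_integral_cong) (auto simp: indicator_def)
    finally show ?thesis by (simp add: nn_integral_indicator)
  qed
  have bl: "emeasure lborel (ball 0 1 :: complex set) = ennreal pi"
    by (simp add: emeasure_ball unit_ball_vol_numeral)
  show "emeasure ?M {x<..} < \<infinity>"
  proof -
    have "emeasure ?M {x<..} \<le> emeasure lborel (ball 0 1 :: complex set)"
      unfolding M by (intro emeasure_mono) auto
    also have "\<dots> < \<infinity>" by (simp add: bl)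
    finally show ?thesis .
  qed
  show "emeasure ?M {x<..} = emeasure ?N {x<..}"
  proof (cases "x < 1")
    case True
    define y where "y = max 0 x"
    have y: "0 \<le> y" "y < 1" using True by (auto simp: y_def)
    have "(\<integral>\<^sup>+s. ennreal (2 * pi * s) * indicator {max 0 x<..<1} s \<partial>lborel)
        = (\<integral>\<^sup>+s. ennreal (2 * pi * s) * indicator {y..1} s \<partial>lborel)"
      by (intro nn_integral_cong_AE, rule AE_mp[OF AE_lborel_singleton[of y] AE_mp[OF AE_lborel_singleton[of 1]]])
         (auto simp: indicator_def y_def)
    also have "\<dots> = ennreal (pi * 1^2 - pi * y^2)"
      using y by (intro nn_integral_FTC_Icc) (auto intro!: derivative_eq_intros)
    also have "\<dots> = emeasure lborel ({z::complex. x < norm z} \<inter> unit_disc)"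
    proof (cases "x < 0")
      case True
      then have "{z::complex. x < norm z} \<inter> unit_disc = unit_disc"
        by (auto intro: less_le_trans)
      with True bl show ?thesis by (simp add: y_def)
    next
      case False
      then have e: "{z::complex. x < norm z} \<inter> unit_disc = unit_disc - cball 0 x" by auto
      have "emeasure lborel (unit_disc - cball 0 x :: complex set)
          = emeasure lborel (unit_disc :: complex set) - emeasure lborel (cball 0 x :: complex set)"
        using False True by (intro emeasure_Diff) (auto simp: emeasure_cball)
      also have "\<dots> = ennreal pi - ennreal (pi * x^2)"
        using False by (simp add: bl emeasure_cball unit_ball_vol_numeral)
      also have "\<dots> = ennreal (pi - pi * x^2)" using False by (simp add: ennreal_minus)
      finally show ?thesis using False e by (simp add: y_def max_def)
    qed
    finally show ?thesis by (simp only: M N)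
  next
    case False
    then have "{z::complex. x < norm z} \<inter> unit_disc = {}" "{max 0 x<..<1} = {}" by auto
    then show ?thesis by (simp add: M N)
  qed
qed simp_all

text \<open>A Lebesgue measurable \<open>\<phi>\<close> differs from a Borel function on a null set, whose preimage under the modulus
is null by \<open>distr_norm_disc\<close>.\<close>
lemma nn_integral_area_radial:
  fixes \<phi> :: "real \<Rightarrow> ennreal"
  assumes \<phi>: "\<phi> \<in> borel_measurable lebesgue"
  shows "(\<integral>\<^sup>+z. \<phi> (norm z) \<partial>area_measure) = (\<integral>\<^sup>+s. \<phi> s * ennreal (2 * s) * indicator {0..<1} s \<partial>lebesgue)"
proof -
  let ?D = "density lborel (indicator unit_disc) :: complex measure"
  obtain \<psi> where \<psi>: "\<psi> \<in> borel_measurable lborel" and ae: "AE s in lborel. \<phi> s = \<psi> s"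
    using completion_ex_borel_measurable[OF \<phi>] by blast
  obtain N where N: "N \<in> null_sets lborel" "{s. \<phi> s \<noteq> \<psi> s} \<subseteq> N"
    using ae unfolding eventually_ae_filter by auto
  have [measurable]: "N \<in> sets borel" "\<psi> \<in> borel_measurable borel" using N(1) \<psi> by auto
  have "emeasure ?D {z. norm z \<in> N} = emeasure (distr ?D borel norm) N"
    by (subst emeasure_distr) (auto simp: vimage_def)
  also have "\<dots> = (\<integral>\<^sup>+s. ennreal (2 * pi * s) * indicator {0..<1} s * indicator N s \<partial>lborel)"
    unfolding distr_norm_disc by (subst emeasure_density) auto
  also have "\<dots> = 0"
    using AE_not_in[OF N(1)] by (subst nn_integral_0_iff_AE) (auto elim: eventually_mono)
  finally have "AE z in ?D. norm z \<notin> N"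
    by (intro AE_I'[where N="{z. norm z \<in> N}"]) (auto simp: null_sets_def)
  then have "AE z in lborel. z \<in> unit_disc \<longrightarrow> norm (z::complex) \<notin> N"
    by (subst (asm) AE_density)
       (auto simp: indicator_def elim: eventually_mono split: if_splits intro!: borel_measurable_indicator)
  then have ae2: "AE z in lborel. z \<in> unit_disc \<longrightarrow> \<phi> (norm (z::complex)) = \<psi> (norm z)"
    using N(2) by (auto elim!: eventually_mono)
  have "(\<integral>\<^sup>+z. \<phi> (norm z) \<partial>area_measure) = (\<integral>\<^sup>+z. \<psi> (norm z) \<partial>area_measure)"
  proof (rule nn_integral_cong_AE)
    have "AE z in lebesgue. z \<in> unit_disc \<longrightarrow> \<phi> (norm (z::complex)) = \<psi> (norm z)"
      using ae2 by (rule AE_completion)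
    then have "AE z in lebesgue_on unit_disc. \<phi> (norm (z::complex)) = \<psi> (norm z)"
      by (subst AE_restrict_space_iff) auto
    then show "AE z in area_measure. \<phi> (norm z) = \<psi> (norm z)"
      unfolding area_measure_def by (subst AE_density) (auto elim: eventually_mono)
  qed
  also have "\<dots> = (\<integral>\<^sup>+z. ennreal (1/pi) * \<psi> (norm z) * indicator unit_disc z \<partial>lebesgue)"
    by (rule nn_integral_area_measure_lebesgue)
       (simp add: area_measure_def, intro measurable_restrict_space1 measurable_completion, measurable)
  also have "\<dots> = (\<integral>\<^sup>+z. ennreal (1/pi) * \<psi> (norm z) * indicator unit_disc z \<partial>(lborel :: complex measure))"
    by (rule nn_integral_completion)
  also have "\<dots> = (\<integral>\<^sup>+z. ennreal (1/pi) * \<psi> (norm z) \<partial>?D)"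
    by (subst nn_integral_density) (auto simp: mult_ac intro!: borel_measurable_indicator)
  also have "\<dots> = (\<integral>\<^sup>+s. ennreal (1/pi) * \<psi> s \<partial>distr ?D borel norm)"
    by (subst nn_integral_distr) auto
  also have "\<dots> = (\<integral>\<^sup>+s. ennreal (2 * pi * s) * indicator {0..<1} s * (ennreal (1/pi) * \<psi> s) \<partial>lborel)"
    unfolding distr_norm_disc by (subst nn_integral_density) auto
  also have "\<dots> = (\<integral>\<^sup>+s. ennreal (2 * pi * s) * indicator {0..<1} s * (ennreal (1/pi) * \<phi> s) \<partial>lebesgue)"
    unfolding nn_integral_completion using ae by (intro nn_integral_cong_AE) (auto elim: eventually_mono)
  also have "\<dots> = (\<integral>\<^sup>+s. \<phi> s * ennreal (2 * s) * indicator {0..<1} s \<partial>lebesgue)"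
  proof (intro nn_integral_cong)
    fix s :: real
    have "ennreal (2 * pi * s) * ennreal (1/pi) = ennreal (2 * s)" if "0 \<le> s"
      using that by (simp flip: ennreal_mult)
    then show "ennreal (2 * pi * s) * indicator {0..<1} s * (ennreal (1/pi) * \<phi> s)
        = \<phi> s * ennreal (2 * s) * indicator {0..<1} s"
      by (auto simp: indicator_def) (metis mult.assoc mult.commute)
  qed
  finally show ?thesis .
qed

section \<open>Radial means of powers of holomorphic functions\<close>
lemma borel_measurable_area_measure:
  "f \<in> borel_measurable borel \<Longrightarrow> f \<in> borel_measurable area_measure"
  unfolding area_measure_def
  by (simp, intro measurable_restrict_space1 measurable_completion) simp

lemma finite_area_measure: "finite_measure area_measure"
proof (rule finite_measureI)
  have "emeasure area_measure (space area_measure) = (\<integral>\<^sup>+z. 1 \<partial>area_measure)"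
    by simp
  also have "\<dots> = (\<integral>\<^sup>+z. ennreal (1/pi) * indicator unit_disc z \<partial>lebesgue)"
    by (subst nn_integral_area_measure_lebesgue) auto
  also have "\<dots> = ennreal (1/pi) * emeasure lebesgue (unit_disc :: complex set)"
    by (subst nn_integral_cmult_indicator) auto
  also have "\<dots> < \<infinity>"
    by (simp add: emeasure_ball unit_ball_vol_numeral ennreal_mult_less_top)
  finally show "emeasure area_measure (space area_measure) \<noteq> \<infinity>" by simp
qed

text \<open>The circle through \<open>z\<close> is parametrised from the point \<open>z\<close> itself, in the form in which rotations of \<open>z\<close>
are averaged.\<close>
lemma circle_mean_nn:
  assumes F: "F holomorphic_on unit_disc" and \<alpha>: "0 < \<alpha>" and z: "norm w < norm z" "norm z < 1"
  shows "ennreal ((norm z - norm w) * norm (F w) powr \<alpha>)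
     \<le> (\<integral>\<^sup>+t. indicator {0..1} t * ennreal (norm (F (cis (2 * pi * t) * z)) powr \<alpha>) \<partial>lborel)"
proof -
  define s where "s = Arg z"
  have zs: "z = norm z * cis s" unfolding s_def by (metis rcis_cmod_Arg rcis_def)
  let ?F = "\<lambda>x. F (cis s * x)"
  have hol: "?F holomorphic_on ball 0 1"
    by (intro holomorphic_on_compose_gen[OF _ F, unfolded o_def] holomorphic_intros) (auto simp: norm_mult)
  let ?u = "\<lambda>t. norm (?F (norm z * cis (2 * pi * t))) powr \<alpha>"
  have z0: "0 < norm z" using z(1) norm_ge_zero[of w] by linarith
  have "norm (?F (cis (-s) * w)) powr \<alpha> \<le> norm z / (norm z - norm (cis (-s) * w)) * integral {0..1} ?u"
    by (rule holomorphic_powr_mean[OF hol z0 z(2) _ \<alpha>]) (use z in \<open>auto simp: norm_mult\<close>)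
  also have "cis s * (cis (-s) * w) = w" by (simp add: mult.assoc[symmetric] cis_mult)
  finally have le: "norm (F w) powr \<alpha> \<le> norm z / (norm z - norm w) * integral {0..1} ?u"
    by (simp add: norm_mult)
  have cont: "continuous_on {0..1} ?u"
    by (rule continuous_on_norm_powr[OF _ \<alpha>],
        rule continuous_on_compose2[OF holomorphic_on_imp_continuous_on[OF hol]])
       (use z in \<open>auto intro!: continuous_intros simp: norm_mult\<close>)
  then have int: "?u integrable_on {0..1}" by (rule integrable_continuous_interval)
  have I0: "0 \<le> integral {0..1} ?u" by (rule integral_nonneg[OF int]) auto
  have "(norm z - norm w) * norm (F w) powr \<alpha> \<le> norm z * integral {0..1} ?u"
    using le z by (simp add: field_simps)
  also have "\<dots> \<le> 1 * integral {0..1} ?u" using z I0 by (intro mult_right_mono) auto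
  finally have "ennreal ((norm z - norm w) * norm (F w) powr \<alpha>) \<le> ennreal (integral {0..1} ?u)"
    by (intro ennreal_leI) simp
  also have "\<dots> = (\<integral>\<^sup>+t. indicator {0..1} t * ennreal (?u t) \<partial>lborel)"
    using nn_integral_has_integral_lebesgue[OF _ integrable_integral[OF int]] by (simp add: ennreal_mult' ennreal_indicator)
  also have "?u = (\<lambda>t. norm (F (cis (2 * pi * t) * z)) powr \<alpha>)"
  proof
    fix t :: real
    have "cis s * (norm z * cis (2 * pi * t)) = cis (2 * pi * t) * (norm z * cis s)"
      by (simp only: mult_ac)
    also have "\<dots> = cis (2 * pi * t) * z" by (simp only: zs[symmetric])
    finally show "?u t = norm (F (cis (2 * pi * t) * z)) powr \<alpha>" by (simp only:)
  qed
  finally show ?thesis .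
qed

text \<open>Extension by zero makes \<open>|f|\<^bsup>\<alpha>\<^esup>\<close> Borel on the whole plane, as needed for joint measurability with a
rotation angle.\<close>
definition disc_powr :: "(complex \<Rightarrow> complex) \<Rightarrow> real \<Rightarrow> complex \<Rightarrow> real" where
  "disc_powr f \<alpha> x = (if x \<in> unit_disc then norm (f x) powr \<alpha> else 0)"

lemma measurable_disc_powr:
  assumes f: "f holomorphic_on unit_disc" and \<alpha>: "0 < \<alpha>"
  shows "disc_powr f \<alpha> \<in> borel_measurable borel"
  unfolding disc_powr_def
  by (rule borel_measurable_continuous_on_if)
     (auto intro!: continuous_on_norm_powr[OF _ \<alpha>] holomorphic_on_imp_continuous_on[OF f])

lemma measurable_norm_powr_area:
  assumes f: "f holomorphic_on unit_disc" and \<alpha>: "0 < \<alpha>"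
  shows "(\<lambda>x. norm (f x) powr \<alpha>) \<in> borel_measurable area_measure"
proof -
  have "disc_powr f \<alpha> \<in> borel_measurable area_measure"
    by (intro borel_measurable_area_measure measurable_disc_powr assms)
  then show ?thesis by (rule measurable_cong[THEN iffD1, rotated]) (simp add: disc_powr_def)
qed

text \<open>By rotation invariance the right-hand integral equals the average over \<open>t\<close> of the integrals of
\<open>|F(e\<^bsup>it\<^esup> z)|\<^bsup>\<alpha>\<^esup> \<nu>(z)\<close>. After exchanging the order of integration, each \<open>z\<close> contributes a circular mean.\<close>
lemma radial_mean_le:
  fixes \<nu> :: "complex \<Rightarrow> real"
  assumes F: "F holomorphic_on unit_disc" and \<alpha>: "0 < \<alpha>"
    and \<nu>: "\<nu> \<in> borel_measurable area_measure" "\<And>z t. norm z < 1 \<Longrightarrow> \<nu> (cis t * z) = \<nu> z"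
    and w: "norm w < \<rho>"
  shows "ennreal ((\<rho> - norm w) * norm (F w) powr \<alpha>) * weighted_area \<nu> {z. \<rho> \<le> norm z}
    \<le> weighted_area (\<lambda>z. norm (F z) powr \<alpha> * \<nu> z) {z. \<rho> \<le> norm z}"
proof -
  let ?E = "{z::complex. \<rho> \<le> norm z}"
  let ?G = "disc_powr F \<alpha>"
  note [measurable] = measurable_disc_powr[OF F \<alpha>]
  have [measurable]: "\<nu> \<in> borel_measurable area_measure" by fact
  have [measurable]: "(\<lambda>z. z) \<in> borel_measurable area_measure"
    by (rule borel_measurable_area_measure) simp
  interpret A: finite_measure area_measure by (rule finite_area_measure)
  interpret P: pair_sigma_finite lborel area_measure ..
  let ?h = "\<lambda>z. ennreal (\<nu> z) * indicator ?E z"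
  have rot: "(\<integral>\<^sup>+z. ennreal (?G (cis (2*pi*t) * z)) * ?h z \<partial>area_measure) = (\<integral>\<^sup>+z. ennreal (?G z) * ?h z \<partial>area_measure)" for t
  proof -
    have "(\<integral>\<^sup>+z. ennreal (?G (cis (2*pi*t) * z)) * ?h z \<partial>area_measure)
        = (\<integral>\<^sup>+z. ennreal (?G (cis (2*pi*t) * z)) * ?h (cis (2*pi*t) * z) \<partial>area_measure)"
      by (intro nn_integral_cong) (simp add: \<nu>(2) indicator_def norm_mult)
    also have "\<dots> = (\<integral>\<^sup>+z. ennreal (?G z) * ?h z \<partial>area_measure)"
      by (rule nn_integral_area_rotation) measurable
    finally show ?thesis .
  qed
  have cm: "(\<lambda>t. cis (2 * pi * t)) \<in> borel_measurable borel"
    by (intro borel_measurable_continuous_onI continuous_intros)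
  have "ennreal ((\<rho> - norm w) * norm (F w) powr \<alpha>) * weighted_area \<nu> ?E
      = (\<integral>\<^sup>+z. ennreal ((\<rho> - norm w) * norm (F w) powr \<alpha>) * ?h z \<partial>area_measure)"
    unfolding weighted_area_def by (rule nn_integral_cmult[symmetric]) measurable
  also have "\<dots> \<le> (\<integral>\<^sup>+z. (\<integral>\<^sup>+t. indicator {0..1} t * ennreal (?G (cis (2 * pi * t) * z)) \<partial>lborel) * ?h z \<partial>area_measure)"
  proof (intro nn_integral_mono)
    fix z assume "z \<in> space area_measure"
    then have z: "norm z < 1" by simp
    show "ennreal ((\<rho> - norm w) * norm (F w) powr \<alpha>) * ?h z
        \<le> (\<integral>\<^sup>+t. indicator {0..1} t * ennreal (?G (cis (2 * pi * t) * z)) \<partial>lborel) * ?h z"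
    proof (cases "z \<in> ?E")
      case True
      have "ennreal ((\<rho> - norm w) * norm (F w) powr \<alpha>) \<le> ennreal ((norm z - norm w) * norm (F w) powr \<alpha>)"
        using True by (intro ennreal_leI mult_right_mono) auto
      also have "\<dots> \<le> (\<integral>\<^sup>+t. indicator {0..1} t * ennreal (norm (F (cis (2 * pi * t) * z)) powr \<alpha>) \<partial>lborel)"
        by (rule circle_mean_nn[OF F \<alpha> _ z]) (use True w in auto)
      also have "\<dots> = (\<integral>\<^sup>+t. indicator {0..1} t * ennreal (?G (cis (2 * pi * t) * z)) \<partial>lborel)"
        using z by (simp add: disc_powr_def norm_mult)
      finally show ?thesis by (rule mult_right_mono) simp
    qed simp
  qed
  also have "\<dots> = (\<integral>\<^sup>+z. (\<integral>\<^sup>+t. indicator {0..1} t * ennreal (?G (cis (2 * pi * t) * z)) * ?h z \<partial>lborel) \<partial>area_measure)"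
  proof (intro nn_integral_cong nn_integral_multc[symmetric])
    fix z :: complex
    have [measurable]: "(\<lambda>t. cis (2 * pi * t) * z) \<in> borel_measurable borel"
      by (intro borel_measurable_continuous_onI continuous_intros)
    show "(\<lambda>t. indicator {0..1} t * ennreal (?G (cis (2 * pi * t) * z))) \<in> borel_measurable lborel"
      by measurable
  qed
  also have "\<dots> = (\<integral>\<^sup>+t. (\<integral>\<^sup>+z. indicator {0..1} t * ennreal (?G (cis (2 * pi * t) * z)) * ?h z \<partial>area_measure) \<partial>lborel)"
  proof (intro P.Fubini')
    have m1: "snd \<in> borel_measurable (lborel \<Otimes>\<^sub>M area_measure)"
      by (rule measurable_compose[OF measurable_snd, of "\<lambda>z. z"]) measurable
    have m2: "(\<lambda>x. cis (2 * pi * fst x)) \<in> borel_measurable (lborel \<Otimes>\<^sub>M area_measure)"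
      by (rule measurable_compose[OF measurable_fst, of "\<lambda>t. cis (2 * pi * t)"]) (use cm in simp)
    have "?h \<in> borel_measurable area_measure" by measurable
    from measurable_compose[OF measurable_snd this]
    have [measurable]: "(\<lambda>x. ?h (snd x)) \<in> borel_measurable (lborel \<Otimes>\<^sub>M area_measure)" .
    have [measurable]: "(\<lambda>x. ennreal (?G (cis (2 * pi * fst x) * snd x))) \<in> borel_measurable (lborel \<Otimes>\<^sub>M area_measure)"
      by (rule measurable_compose[OF borel_measurable_times[OF m2 m1]]) measurable
    have "(\<lambda>x. indicator {0..1} (fst x) * ennreal (?G (cis (2 * pi * fst x) * snd x)) * ?h (snd x))
        \<in> borel_measurable (lborel \<Otimes>\<^sub>M area_measure)"
      by (intro borel_measurable_times_ennreal) measurable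
    then show "(\<lambda>(t, z). indicator {0..1} t * ennreal (?G (cis (2 * pi * t) * z)) * ?h z)
        \<in> borel_measurable (lborel \<Otimes>\<^sub>M area_measure)"
      by (simp add: case_prod_beta)
  qed
  also have "\<dots> = (\<integral>\<^sup>+t. indicator {0..1::real} t * (\<integral>\<^sup>+z. ennreal (?G z) * ?h z \<partial>area_measure) \<partial>lborel)"
  proof (intro nn_integral_cong)
    fix t :: real
    have "(\<integral>\<^sup>+z. indicator {0..1} t * ennreal (?G (cis (2 * pi * t) * z)) * ?h z \<partial>area_measure)
       = (\<integral>\<^sup>+z. indicator {0..1} t * (ennreal (?G (cis (2 * pi * t) * z)) * ?h z) \<partial>area_measure)"
      by (simp add: mult.assoc)
    also have "\<dots> = indicator {0..1} t * (\<integral>\<^sup>+z. ennreal (?G (cis (2 * pi * t) * z)) * ?h z \<partial>area_measure)"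
      by (rule nn_integral_cmult) measurable
    finally show "(\<integral>\<^sup>+z. indicator {0..1} t * ennreal (?G (cis (2 * pi * t) * z)) * ?h z \<partial>area_measure)
       = indicator {0..1} t * (\<integral>\<^sup>+z. ennreal (?G z) * ?h z \<partial>area_measure)"
      by (simp add: rot)
  qed
  also have "\<dots> = (\<integral>\<^sup>+z. ennreal (?G z) * ?h z \<partial>area_measure)"
    by (subst nn_integral_multc) auto
  also have "\<dots> = weighted_area (\<lambda>z. norm (F z) powr \<alpha> * \<nu> z) ?E"
    unfolding weighted_area_def
    by (intro nn_integral_cong) (simp add: disc_powr_def ennreal_mult' mult.assoc)
  finally show ?thesis .
qed

section \<open>The Carleson embedding theorem on a tree\<close>
lemma nn_integral_powr_layer:
  fixes x s :: real
  assumes "0 \<le> x" "0 < s"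
  shows "(\<integral>\<^sup>+l. ennreal (s * l powr (s - 1)) * indicator {0<..<x} l \<partial>lborel) = ennreal (x powr s)"
proof -
  have "((\<lambda>l. s * l powr (s - 1)) has_integral s * (x powr (s - 1 + 1) / (s - 1 + 1))) {0..x}"
    using assms by (intro has_integral_mult_right has_integral_powr_from_0) auto
  then have "((\<lambda>l. s * l powr (s - 1)) has_integral x powr s) {0<..<x}"
    using assms by (simp add: has_integral_Icc_iff_Ioo)
  then show ?thesis
    by (intro nn_integral_has_integral_lebesgue') (use assms in auto)
qed

text \<open>The maximal sets among those with \<open>x Q > l\<close> are disjoint and cover all the others, so the Carleson
condition bounds the sum by their total measure, and the averages bound that measure. Truncating \<open>h\<close> at
\<open>l/2\<close> makes this weak type bound strong enough to be integrated in \<open>l\<close>.\<close>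
lemma carleson_level_set:
  fixes M :: "'i measure" and B :: "'k \<Rightarrow> 'i set"
  assumes fin: "finite_measure M" and K: "finite K" and B: "\<And>Q. Q \<in> K \<Longrightarrow> B Q \<in> sets M"
    and lam: "\<And>Q R. Q \<in> K \<Longrightarrow> R \<in> K \<Longrightarrow> B Q \<subseteq> B R \<or> B R \<subseteq> B Q \<or> B Q \<inter> B R = {}"
    and a: "\<And>Q. Q \<in> K \<Longrightarrow> 0 \<le> a Q"
    and A: "0 \<le> A" "\<And>R. R \<in> K \<Longrightarrow> (\<Sum>Q\<in>{Q\<in>K. B Q \<subseteq> B R}. a Q) \<le> A * measure M (B R)"
    and h [measurable]: "h \<in> borel_measurable M"
    and x: "\<And>Q. Q \<in> K \<Longrightarrow> ennreal (x Q) * emeasure M (B Q) \<le> (\<integral>\<^sup>+z. ennreal (h z) * indicator (B Q) z \<partial>M)"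
    and l: "0 < l"
  shows "ennreal (\<Sum>Q\<in>{Q\<in>K. l < x Q}. a Q)
    \<le> ennreal (2 * A / l) * (\<integral>\<^sup>+z. ennreal (h z) * indicator {z. l < 2 * h z} z \<partial>M)"
proof -
  interpret finite_measure M by fact
  define K' where "K' = {Q\<in>K. l < x Q}"
  define H where "H z = ennreal (h z) * indicator {z. l < 2 * h z} z" for z
  have H [measurable]: "H \<in> borel_measurable M" unfolding H_def by measurable
  define Mx where "Mx = {S\<in>B ` K'. \<forall>T\<in>B ` K'. S \<subseteq> T \<longrightarrow> S = T}"
  have fK: "finite K'" "K' \<subseteq> K" using K by (auto simp: K'_def)
  have fM: "finite Mx" using fK by (auto simp: Mx_def)
  have "\<exists>S\<in>Mx. B Q \<subseteq> S" if "Q \<in> K'" for Q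
    using finite_has_maximal2[of "B ` K'" "B Q"] that fK unfolding Mx_def by blast
  then obtain m where m: "\<And>Q. Q \<in> K' \<Longrightarrow> m Q \<in> Mx \<and> B Q \<subseteq> m Q" by metis
  have "(\<Sum>Q\<in>K'. a Q) = (\<Sum>S\<in>Mx. \<Sum>Q\<in>{Q\<in>K'. m Q = S}. a Q)"
    using m by (intro sum.group[symmetric] fK fM) auto
  also have "\<dots> \<le> (\<Sum>S\<in>Mx. A * measure M S)"
  proof (rule sum_mono)
    fix S assume "S \<in> Mx"
    then obtain R where R: "R \<in> K" "S = B R" using fK by (auto simp: Mx_def)
    have "{Q\<in>K'. m Q = S} \<subseteq> {Q\<in>K. B Q \<subseteq> B R}"
    proof
      fix Q assume "Q \<in> {Q\<in>K'. m Q = S}"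
      with m[of Q] R fK show "Q \<in> {Q\<in>K. B Q \<subseteq> B R}" by auto
    qed
    then have "(\<Sum>Q\<in>{Q\<in>K'. m Q = S}. a Q) \<le> (\<Sum>Q\<in>{Q\<in>K. B Q \<subseteq> B R}. a Q)"
      using K a by (intro sum_mono2) auto
    with A(2)[OF R(1)] R show "(\<Sum>Q\<in>{Q\<in>K'. m Q = S}. a Q) \<le> A * measure M S" by simp
  qed
  finally have "ennreal (\<Sum>Q\<in>K'. a Q) \<le> ennreal (\<Sum>S\<in>Mx. A * measure M S)" by (rule ennreal_leI)
  also have "\<dots> = (\<Sum>S\<in>Mx. ennreal (A * measure M S))"
    using A(1) by (intro sum_ennreal[symmetric]) simp
  also have "\<dots> = (\<Sum>S\<in>Mx. ennreal A * emeasure M S)"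
    using A(1) by (intro sum.cong refl) (simp add: ennreal_mult emeasure_eq_measure)
  also have "\<dots> \<le> (\<Sum>S\<in>Mx. ennreal A * (ennreal (2 / l) * (\<integral>\<^sup>+z. H z * indicator S z \<partial>M)))"
  proof (intro sum_mono mult_left_mono)
    fix S assume "S \<in> Mx"
    then obtain R where R: "R \<in> K" "l < x R" "S = B R" by (auto simp: Mx_def K'_def)
    have [measurable]: "S \<in> sets M" using B R by auto
    let ?I = "\<integral>\<^sup>+z. H z * indicator S z \<partial>M"
    \<comment> \<open>The part of \<open>h\<close> below \<open>l/2\<close> contributes at most half of \<open>l \<mu>(S)\<close>, which is absorbed.\<close>
    have "ennreal l * emeasure M S \<le> ennreal (x R) * emeasure M S"
      using R by (intro mult_right_mono ennreal_leI) auto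
    also have "\<dots> \<le> (\<integral>\<^sup>+z. ennreal (h z) * indicator S z \<partial>M)" using x[OF R(1)] R by simp
    also have "\<dots> \<le> (\<integral>\<^sup>+z. H z * indicator S z + ennreal (l / 2) * indicator S z \<partial>M)"
      by (intro nn_integral_mono) (auto simp: H_def indicator_def intro!: ennreal_leI)
    also have "\<dots> = ?I + ennreal (l / 2) * emeasure M S"
      by (subst nn_integral_add) (auto simp: nn_integral_cmult_indicator)
    finally have le: "ennreal l * emeasure M S \<le> ?I + ennreal (l / 2) * emeasure M S" .
    show "emeasure M S \<le> ennreal (2 / l) * ?I"
    proof (cases "?I = \<infinity>")
      case True
      then show ?thesis using l by (simp add: ennreal_mult_top)
    next
      case False
      then obtain i where i: "?I = ennreal i" "0 \<le> i" by (cases ?I) auto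
      have "l * measure M S \<le> i + l / 2 * measure M S"
        using le l i(2) unfolding emeasure_eq_measure i(1)
        by (simp add: ennreal_mult[symmetric] ennreal_plus[symmetric] del: ennreal_plus)
      then have "measure M S \<le> 2 / l * i" using l by (simp add: field_simps)
      then show ?thesis using l i
        by (simp add: emeasure_eq_measure ennreal_mult[symmetric] ennreal_leI)
    qed
  qed simp
  also have "\<dots> = ennreal (2 * A / l) * (\<Sum>S\<in>Mx. \<integral>\<^sup>+z. H z * indicator S z \<partial>M)"
    using A(1) l by (simp add: sum_distrib_left mult.assoc[symmetric] ennreal_mult[symmetric] mult_ac)
  also have "(\<Sum>S\<in>Mx. \<integral>\<^sup>+z. H z * indicator S z \<partial>M) = (\<integral>\<^sup>+z. (\<Sum>S\<in>Mx. H z * indicator S z) \<partial>M)"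
    using B fK by (intro nn_integral_sum[symmetric]) (auto simp: Mx_def)
  also have "\<dots> \<le> (\<integral>\<^sup>+z. H z \<partial>M)"
  proof (intro nn_integral_mono)
    fix z
    have dis: "S \<inter> T = {}" if "S \<in> Mx" "T \<in> Mx" "S \<noteq> T" for S T
    proof -
      have "S \<in> B ` K'" "T \<in> B ` K'" using that by (auto simp: Mx_def)
      then obtain Q R where QR: "Q \<in> K'" "S = B Q" "R \<in> K'" "T = B R" by blast
      have "\<not> S \<subseteq> T" "\<not> T \<subseteq> S" using that \<open>S \<in> B ` K'\<close> \<open>T \<in> B ` K'\<close> by (auto simp: Mx_def)
      moreover have "Q \<in> K" "R \<in> K" using QR fK(2) by auto
      ultimately show ?thesis using lam[of Q R] QR(2,4) by metis
    qed
    have "(\<Sum>S\<in>Mx. indicator S z) = (indicator (\<Union>S\<in>Mx. S) z :: ennreal)"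
      by (rule indicator_UN_disjoint[symmetric]) (use fM dis in \<open>auto simp: disjoint_family_on_def\<close>)
    also have "\<dots> \<le> 1" by (simp add: indicator_def)
    finally have "H z * (\<Sum>S\<in>Mx. indicator S z) \<le> H z * 1" by (intro mult_left_mono) auto
    then show "(\<Sum>S\<in>Mx. H z * indicator S z) \<le> H z" by (simp add: sum_distrib_left)
  qed
  finally show ?thesis unfolding K'_def H_def by (simp add: mult_left_mono)
qed

text \<open>The level set bound, integrated against \<open>s l\<^bsup>s-1\<^esup>\<close>. The numbers \<open>x Q\<close> stand for averages of \<open>h\<close>; asking
only for an upper bound on \<open>x Q\<close> avoids dividing by null sets and infinite integrals.\<close>
theorem carleson_embedding:
  fixes M :: "'i measure" and B :: "'k \<Rightarrow> 'i set"
  assumes fin: "finite_measure M" and K: "finite K" and B: "\<And>Q. Q \<in> K \<Longrightarrow> B Q \<in> sets M"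
    and lam: "\<And>Q R. Q \<in> K \<Longrightarrow> R \<in> K \<Longrightarrow> B Q \<subseteq> B R \<or> B R \<subseteq> B Q \<or> B Q \<inter> B R = {}"
    and a: "\<And>Q. Q \<in> K \<Longrightarrow> 0 \<le> a Q"
    and A: "0 \<le> A" "\<And>R. R \<in> K \<Longrightarrow> (\<Sum>Q\<in>{Q\<in>K. B Q \<subseteq> B R}. a Q) \<le> A * measure M (B R)"
    and h [measurable]: "h \<in> borel_measurable M" and h0: "\<And>z. z \<in> space M \<Longrightarrow> 0 \<le> h z"
    and x0: "\<And>Q. Q \<in> K \<Longrightarrow> 0 \<le> x Q"
    and x: "\<And>Q. Q \<in> K \<Longrightarrow> ennreal (x Q) * emeasure M (B Q) \<le> (\<integral>\<^sup>+z. ennreal (h z) * indicator (B Q) z \<partial>M)"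
    and s: "1 < s"
  shows "ennreal (\<Sum>Q\<in>K. a Q * x Q powr s)
    \<le> ennreal (A * (s / (s - 1)) * 2 powr s) * (\<integral>\<^sup>+z. ennreal (h z powr s) \<partial>M)"
proof -
  interpret finite_measure M by fact
  interpret P: pair_sigma_finite M "lborel :: real measure" ..
  let ?w = "\<lambda>l. ennreal (s * l powr (s - 1))"
  have "ennreal (\<Sum>Q\<in>K. a Q * x Q powr s) = (\<Sum>Q\<in>K. ennreal (a Q) * ennreal (x Q powr s))"
    using a by (subst sum_ennreal[symmetric]) (auto simp: ennreal_mult)
  also have "\<dots> = (\<Sum>Q\<in>K. ennreal (a Q) * (\<integral>\<^sup>+l. ?w l * indicator {0<..<x Q} l \<partial>lborel))"
    using x0 s by (intro sum.cong refl) (subst nn_integral_powr_layer; auto)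
  also have "\<dots> = (\<Sum>Q\<in>K. (\<integral>\<^sup>+l. ennreal (a Q) * (?w l * indicator {0<..<x Q} l) \<partial>lborel))"
    by (intro sum.cong refl nn_integral_cmult[symmetric]) simp
  also have "\<dots> = (\<integral>\<^sup>+l. (\<Sum>Q\<in>K. ennreal (a Q) * (?w l * indicator {0<..<x Q} l)) \<partial>lborel)"
    by (intro nn_integral_sum[symmetric]) simp
  also have "\<dots> \<le> (\<integral>\<^sup>+l. (\<integral>\<^sup>+z. ennreal (2 * A * s * l powr (s - 2)) * indicator {0<..} l * (ennreal (h z) * indicator {z. l < 2 * h z} z) \<partial>M) \<partial>lborel)"
  proof (intro nn_integral_mono)
    fix l :: real
    let ?I = "\<integral>\<^sup>+z. ennreal (h z) * indicator {z. l < 2 * h z} z \<partial>M"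
    have I: "(\<integral>\<^sup>+z. ennreal (2 * A * s * l powr (s - 2)) * indicator {0<..} l * (ennreal (h z) * indicator {z. l < 2 * h z} z) \<partial>M)
        = ennreal (2 * A * s * l powr (s - 2)) * indicator {0<..} l * ?I"
      by (intro nn_integral_cmult) measurable
    show "(\<Sum>Q\<in>K. ennreal (a Q) * (?w l * indicator {0<..<x Q} l))
      \<le> (\<integral>\<^sup>+z. ennreal (2 * A * s * l powr (s - 2)) * indicator {0<..} l * (ennreal (h z) * indicator {z. l < 2 * h z} z) \<partial>M)"
    proof (cases "0 < l")
      case True
      have "(\<Sum>Q\<in>K. ennreal (a Q) * (?w l * indicator {0<..<x Q} l)) = (\<Sum>Q\<in>{Q\<in>K. l < x Q}. ?w l * ennreal (a Q))"
        using True K by (intro sum.mono_neutral_cong_right) (auto simp: mult_ac)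
      also have "\<dots> = ?w l * ennreal (\<Sum>Q\<in>{Q\<in>K. l < x Q}. a Q)"
        using a by (subst sum_distrib_left[symmetric], subst sum_ennreal) auto
      also have "\<dots> \<le> ?w l * (ennreal (2 * A / l) * ?I)"
        by (intro mult_left_mono carleson_level_set[OF fin K B lam a A h x True]) auto
      also have "\<dots> = ennreal (2 * A * s * l powr (s - 2)) * ?I"
      proof -
        have "l powr (s - 1) = l powr (s - 2) * l"
          using True powr_add[of l "s - 2" 1] by simp
        then have "s * l powr (s - 1) * (2 * A / l) = 2 * A * s * l powr (s - 2)" using True by simp
        then show ?thesis using A(1) s True by (simp add: mult.assoc[symmetric] ennreal_mult[symmetric])
      qed
      finally show ?thesis using True unfolding I by simp
    qed (simp add: I)
  qed
  also have "\<dots> = (\<integral>\<^sup>+z. (\<integral>\<^sup>+l. ennreal (2 * A * s * l powr (s - 2)) * indicator {0<..} l * (ennreal (h z) * indicator {z. l < 2 * h z} z) \<partial>lborel) \<partial>M)"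
    by (rule P.Fubini') measurable
  also have "\<dots> = (\<integral>\<^sup>+z. ennreal (A * (s / (s - 1)) * 2 powr s) * ennreal (h z powr s) \<partial>M)"
  proof (intro nn_integral_cong)
    fix z assume "z \<in> space M"
    then have h0: "0 \<le> h z" by (rule h0)
    let ?c = "ennreal (2 * A * s / (s - 1) * h z)"
    have "(\<integral>\<^sup>+l. ennreal (2 * A * s * l powr (s - 2)) * indicator {0<..} l * (ennreal (h z) * indicator {z. l < 2 * h z} z) \<partial>lborel)
       = (\<integral>\<^sup>+l. ?c * (ennreal ((s - 1) * l powr ((s - 1) - 1)) * indicator {0<..<2 * h z} l) \<partial>lborel)"
    proof (intro nn_integral_cong)
      fix l :: real
      show "ennreal (2 * A * s * l powr (s - 2)) * indicator {0<..} l * (ennreal (h z) * indicator {z. l < 2 * h z} z)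
        = ?c * (ennreal ((s - 1) * l powr ((s - 1) - 1)) * indicator {0<..<2 * h z} l)"
      proof (cases "0 < l \<and> l < 2 * h z")
        case True
        have "ennreal (2 * A * s * l powr (s - 2)) * ennreal (h z) = ennreal (2 * A * s * l powr (s - 2) * h z)"
          using A(1) s h0 by (intro ennreal_mult[symmetric]) auto
        also have "2 * A * s * l powr (s - 2) * h z = 2 * A * s / (s - 1) * h z * ((s - 1) * l powr (s - 2))"
          using s by simp
        also have "ennreal \<dots> = ?c * ennreal ((s - 1) * l powr (s - 2))"
          using A(1) s h0 by (intro ennreal_mult) auto
        finally show ?thesis using True by simp
      qed auto
    qed
    also have "\<dots> = ?c * ennreal ((2 * h z) powr (s - 1))"
      using s h0 by (subst nn_integral_cmult, simp, subst nn_integral_powr_layer) auto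
    also have "\<dots> = ennreal (A * (s / (s - 1)) * 2 powr s * h z powr s)"
    proof -
      have e: "t powr s = t powr (s - 1) * t" if "0 \<le> t" for t :: real
        using that powr_add[of t "s - 1" 1] by (cases "t = 0") auto
      have "2 * A * s / (s - 1) * h z * (2 * h z) powr (s - 1) = A * (s / (s - 1)) * 2 powr s * h z powr s"
        using h0 by (simp add: powr_mult e[of 2] e[of "h z"])
      then show ?thesis using A(1) s h0 by (simp add: ennreal_mult[symmetric])
    qed
    also have "\<dots> = ennreal (A * (s / (s - 1)) * 2 powr s) * ennreal (h z powr s)"
      using A(1) s by (intro ennreal_mult) auto
    finally show "(\<integral>\<^sup>+l. ennreal (2 * A * s * l powr (s - 2)) * indicator {0<..} l * (ennreal (h z) * indicator {z. l < 2 * h z} z) \<partial>lborel)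
      = ennreal (A * (s / (s - 1)) * 2 powr s) * ennreal (h z powr s)" .
  qed
  also have "\<dots> = ennreal (A * (s / (s - 1)) * 2 powr s) * (\<integral>\<^sup>+z. ennreal (h z powr s) \<partial>M)"
    by (intro nn_integral_cmult) measurable
  finally show ?thesis .
qed

section \<open>The two-weight embedding\<close>
definition dual_weight :: "real \<Rightarrow> ('i \<Rightarrow> real) \<Rightarrow> ('i \<Rightarrow> real) \<Rightarrow> 'i \<Rightarrow> real" where
  "dual_weight q \<nu> \<omega> z = (\<nu> z * \<omega> z powr (- 1 / q)) powr (q / (q - 1))"

lemma measurable_dual_weight [measurable]:
  assumes [measurable]: "\<nu> \<in> borel_measurable M" "\<omega> \<in> borel_measurable M"
  shows "dual_weight q \<nu> \<omega> \<in> borel_measurable M"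
  unfolding dual_weight_def by measurable

lemma dual_weight_nonneg [simp]: "0 \<le> dual_weight q \<nu> \<omega> z"
  by (simp add: dual_weight_def)

text \<open>The \<open>L\<^bsup>q'\<^esup>(\<omega>)\<close> norm of \<open>\<nu>/\<omega>\<close> is the mass of the dual weight. If \<open>\<omega>\<close> vanishes, both sides are \<open>0\<close>, by
the conventions for division and \<open>powr\<close>.\<close>
lemma dual_weight_quotient:
  assumes "1 < q" "0 \<le> \<nu> z" "0 \<le> \<omega> z"
  shows "(\<nu> z / \<omega> z) powr (q / (q - 1)) * \<omega> z = dual_weight q \<nu> \<omega> z"
proof (cases "\<omega> z = 0 \<or> \<nu> z = 0")
  case True then show ?thesis using assms by (auto simp: dual_weight_def)
next
  case False
  with assms have pos: "0 < \<omega> z" "0 < \<nu> z" by auto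
  have e: "1 - q / (q - 1) = - 1 / q * (q / (q - 1))" using assms(1) by (simp add: field_simps)
  have "(\<nu> z / \<omega> z) powr (q / (q - 1)) * \<omega> z = \<nu> z powr (q / (q - 1)) * (\<omega> z powr 1 / \<omega> z powr (q / (q - 1)))"
    using pos by (simp add: powr_divide)
  also have "\<omega> z powr 1 / \<omega> z powr (q / (q - 1)) = \<omega> z powr (- 1 / q * (q / (q - 1)))"
    by (simp only: powr_diff[symmetric] e)
  finally show ?thesis using pos by (simp add: dual_weight_def powr_mult powr_powr)
qed

text \<open>This identity makes the \<open>L\<^sup>q(\<sigma>)\<close> norm of \<open>g\<nu>/\<sigma>\<close> equal to the \<open>L\<^sup>q(\<omega>)\<close> norm of \<open>g\<close>.\<close>
lemma dual_weight_power:
  assumes "1 < q" "0 < \<nu> z" "0 < \<omega> z"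
  shows "\<nu> z powr q * dual_weight q \<nu> \<omega> z powr (1 - q) = \<omega> z"
proof -
  have "q / (q - 1) * (1 - q) = - q" using assms(1) by (simp add: field_simps)
  then have "dual_weight q \<nu> \<omega> z powr (1 - q) = (\<nu> z * \<omega> z powr (- 1 / q)) powr (- q)"
    by (simp only: dual_weight_def powr_powr)
  also have "\<dots> = \<nu> z powr (- q) * \<omega> z"
    using assms by (simp add: powr_mult powr_powr)
  finally show ?thesis using assms by (simp add: powr_minus)
qed

lemma indicator_subset_mult:
  "A \<subseteq> X \<Longrightarrow> indicator X z * indicator A z = (indicator A z :: ennreal)"
  by (auto simp: indicator_def)

lemma emeasure_restricted_density:
  fixes \<omega> :: "'i \<Rightarrow> real"
  assumes [measurable]: "\<omega> \<in> borel_measurable M" "X \<in> sets M" "A \<in> sets M" and "A \<subseteq> X"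
  shows "emeasure (density M (\<lambda>z. ennreal (\<omega> z) * indicator X z)) A = (\<integral>\<^sup>+z. ennreal (\<omega> z) * indicator A z \<partial>M)"
  using assms(4) by (subst emeasure_density) (auto simp: mult.assoc indicator_subset_mult)

lemma finite_restricted_density:
  fixes \<omega> :: "'i \<Rightarrow> real"
  assumes [measurable]: "\<omega> \<in> borel_measurable M" "X \<in> sets M"
    and fin: "(\<integral>\<^sup>+z. ennreal (\<omega> z) * indicator X z \<partial>M) < \<infinity>"
  shows "finite_measure (density M (\<lambda>z. ennreal (\<omega> z) * indicator X z))"
proof (rule finite_measureI)
  have "emeasure (density M (\<lambda>z. ennreal (\<omega> z) * indicator X z)) (space M) = (\<integral>\<^sup>+z. ennreal (\<omega> z) * indicator X z \<partial>M)"
    by (subst emeasure_density) (auto intro!: nn_integral_cong)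
  with fin show "emeasure (density M (\<lambda>z. ennreal (\<omega> z) * indicator X z)) (space (density M (\<lambda>z. ennreal (\<omega> z) * indicator X z))) \<noteq> \<infinity>"
    by simp
qed

text \<open>A finite tree of sets on which the \<open>B\<^sub>q\<close> condition holds. The numbers \<open>V Q\<close>, \<open>W Q\<close>, \<open>S Q\<close> are the masses of
\<open>B Q\<close> under \<open>\<nu>\<close>, \<open>\<omega>\<close> and the dual weight, and \<open>X\<close> is a region containing the tree on which both
\<open>\<omega>\<close> and the dual weight are integrable.\<close>
locale bekolle_tree =
  fixes M :: "'i measure" and X :: "'i set" and q :: real and \<nu> \<omega> :: "'i \<Rightarrow> real"
    and K :: "'k set" and B :: "'k \<Rightarrow> 'i set" and V W S :: "'k \<Rightarrow> real" and C :: real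
  assumes q: "1 < q" and X [measurable]: "X \<in> sets M"
    and \<nu> [measurable]: "\<nu> \<in> borel_measurable M" and \<nu>0: "\<And>z. z \<in> space M \<Longrightarrow> 0 \<le> \<nu> z"
    and \<omega> [measurable]: "\<omega> \<in> borel_measurable M" and \<omega>0: "\<And>z. z \<in> space M \<Longrightarrow> 0 \<le> \<omega> z"
    and ae: "AE z in M. z \<in> X \<longrightarrow> \<omega> z = 0 \<longrightarrow> \<nu> z = 0"
    and \<omega>fin: "(\<integral>\<^sup>+z. ennreal (\<omega> z) * indicator X z \<partial>M) < \<infinity>"
    and \<sigma>fin: "(\<integral>\<^sup>+z. ennreal (dual_weight q \<nu> \<omega> z) * indicator X z \<partial>M) < \<infinity>"
    and K: "finite K" and B: "\<And>Q. Q \<in> K \<Longrightarrow> B Q \<in> sets M" "\<And>Q. Q \<in> K \<Longrightarrow> B Q \<subseteq> X"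
    and lam: "\<And>Q R. Q \<in> K \<Longrightarrow> R \<in> K \<Longrightarrow> B Q \<subseteq> B R \<or> B R \<subseteq> B Q \<or> B Q \<inter> B R = {}"
    and V: "\<And>Q. Q \<in> K \<Longrightarrow> ennreal (V Q) = (\<integral>\<^sup>+z. ennreal (\<nu> z) * indicator (B Q) z \<partial>M)" "\<And>Q. Q \<in> K \<Longrightarrow> 0 < V Q"
    and W: "\<And>Q. Q \<in> K \<Longrightarrow> ennreal (W Q) = (\<integral>\<^sup>+z. ennreal (\<omega> z) * indicator (B Q) z \<partial>M)" "\<And>Q. Q \<in> K \<Longrightarrow> 0 < W Q"
    and S: "\<And>Q. Q \<in> K \<Longrightarrow> ennreal (S Q) = (\<integral>\<^sup>+z. ennreal (dual_weight q \<nu> \<omega> z) * indicator (B Q) z \<partial>M)" "\<And>Q. Q \<in> K \<Longrightarrow> 0 < S Q"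
    and C: "0 < C" "\<And>Q. Q \<in> K \<Longrightarrow> W Q * S Q powr (q - 1) \<le> C * V Q powr q"
begin

text \<open>The first use of the embedding theorem: in \<open>L\<^bsup>q'\<^esup>(\<omega>)\<close>, applied to \<open>\<nu>/\<omega>\<close> restricted to \<open>B R\<close>. The
\<open>\<omega>\<close>-average of \<open>\<nu>/\<omega>\<close> over \<open>B Q\<close> is \<open>V Q / W Q\<close>.\<close>
lemma sum_quotient_le_dual:
  fixes a :: "'k \<Rightarrow> real" and A :: real
  defines "s \<equiv> q / (q - 1)"
  assumes a: "\<And>Q. Q \<in> K \<Longrightarrow> 0 \<le> a Q" and A: "0 \<le> A"
    and car: "\<And>R. R \<in> K \<Longrightarrow> (\<Sum>Q\<in>{Q\<in>K. B Q \<subseteq> B R}. a Q) \<le> A * W R"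
    and R: "R \<in> K"
  shows "(\<Sum>Q\<in>{Q\<in>K. B Q \<subseteq> B R}. a Q * (V Q / W Q) powr s) \<le> A * (s / (s - 1)) * 2 powr s * S R"
proof -
  let ?M = "density M (\<lambda>z. ennreal (\<omega> z) * indicator X z)"
  let ?h = "\<lambda>z. \<nu> z / \<omega> z * indicator (B R) z"
  let ?K = "{Q\<in>K. B Q \<subseteq> B R}"
  have s: "1 < s" using q by (simp add: s_def field_simps)
  have BR [measurable]: "B R \<in> sets M" using B R by auto
  have em: "emeasure ?M (B Q) = ennreal (W Q)" if "Q \<in> K" for Q
    using that B W(1)[OF that] by (subst emeasure_restricted_density) auto
  have me: "measure ?M (B Q) = W Q" if "Q \<in> K" for Q
    using em[OF that] W(2)[OF that] by (simp add: measure_def)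
  have "ennreal (\<Sum>Q\<in>?K. a Q * (V Q / W Q) powr s)
      \<le> ennreal (A * (s / (s - 1)) * 2 powr s) * (\<integral>\<^sup>+z. ennreal (?h z powr s) \<partial>?M)"
  proof (rule carleson_embedding[where B=B])
    show "finite_measure ?M" by (rule finite_restricted_density[OF \<omega> X \<omega>fin])
    show "finite ?K" using K by simp
    show "?h \<in> borel_measurable ?M" by simp
    show "0 \<le> ?h z" if "z \<in> space ?M" for z using \<nu>0[of z] \<omega>0[of z] that by simp
    show "1 < s" "0 \<le> A" by fact+
    fix Q assume "Q \<in> ?K"
    then have Q: "Q \<in> K" "B Q \<subseteq> B R" by auto
    show "B Q \<in> sets ?M" "0 \<le> a Q" "0 \<le> V Q / W Q"
      using B a V(2)[OF Q(1)] W(2)[OF Q(1)] Q by auto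
    have "ennreal (V Q / W Q) * emeasure ?M (B Q) = ennreal (V Q)"
      using V(2)[OF Q(1)] W(2)[OF Q(1)] by (simp add: em Q ennreal_mult[symmetric])
    also have "\<dots> = (\<integral>\<^sup>+z. ennreal (\<nu> z) * indicator (B Q) z \<partial>M)" by (rule V(1)[OF Q(1)])
    also have "\<dots> = (\<integral>\<^sup>+z. ennreal (\<omega> z) * indicator X z * (ennreal (?h z) * indicator (B Q) z) \<partial>M)"
    proof (rule nn_integral_cong_AE)
      show "AE z in M. ennreal (\<nu> z) * indicator (B Q) z = ennreal (\<omega> z) * indicator X z * (ennreal (?h z) * indicator (B Q) z)"
        using ae AE_space
      proof eventually_elim
        case (elim z)
        note nonneg = \<nu>0[OF elim(2)] \<omega>0[OF elim(2)]
        show ?case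
        proof (cases "z \<in> B Q")
          case True
          then have z: "z \<in> B R" "z \<in> X" using Q B R by auto
          then have "\<nu> z = \<omega> z * (\<nu> z / \<omega> z)" using elim by auto
          then have "ennreal (\<nu> z) = ennreal (\<omega> z) * ennreal (\<nu> z / \<omega> z)"
            using nonneg by (simp add: ennreal_mult[symmetric])
          then show ?thesis using True z by simp
        qed simp
      qed
    qed
    also have "\<dots> = (\<integral>\<^sup>+z. ennreal (?h z) * indicator (B Q) z \<partial>?M)"
      using B Q by (intro nn_integral_density[symmetric]) auto
    finally show "ennreal (V Q / W Q) * emeasure ?M (B Q) \<le> (\<integral>\<^sup>+z. ennreal (?h z) * indicator (B Q) z \<partial>?M)"
      by simp
  next
    fix Q P assume "Q \<in> ?K" "P \<in> ?K"
    then show "B Q \<subseteq> B P \<or> B P \<subseteq> B Q \<or> B Q \<inter> B P = {}" using lam by blast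
  next
    fix P assume P: "P \<in> ?K"
    then have "{Q \<in> ?K. B Q \<subseteq> B P} = {Q \<in> K. B Q \<subseteq> B P}" by auto
    then show "(\<Sum>Q\<in>{Q \<in> ?K. B Q \<subseteq> B P}. a Q) \<le> A * measure ?M (B P)"
      using car[of P] P by (simp add: me)
  qed
  also have "(\<integral>\<^sup>+z. ennreal (?h z powr s) \<partial>?M) = (\<integral>\<^sup>+z. ennreal (\<omega> z) * indicator X z * ennreal (?h z powr s) \<partial>M)"
    by (intro nn_integral_density) auto
  also have "\<dots> = (\<integral>\<^sup>+z. ennreal (dual_weight q \<nu> \<omega> z) * indicator (B R) z \<partial>M)"
  proof (intro nn_integral_cong)
    fix z assume z: "z \<in> space M"
    show "ennreal (\<omega> z) * indicator X z * ennreal (?h z powr s) = ennreal (dual_weight q \<nu> \<omega> z) * indicator (B R) z"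
    proof (cases "z \<in> B R")
      case True
      have "ennreal (\<omega> z) * ennreal ((\<nu> z / \<omega> z) powr s) = ennreal (dual_weight q \<nu> \<omega> z)"
        using dual_weight_quotient[where \<nu>=\<nu> and \<omega>=\<omega> and z=z, OF q \<nu>0[OF z] \<omega>0[OF z]] \<omega>0[OF z] by (simp add: s_def ennreal_mult[symmetric] mult.commute)
      moreover have "z \<in> X" using True B(2)[OF R] by auto
      ultimately show ?thesis using True by simp
    qed (use s in simp)
  qed
  also have "\<dots> = ennreal (S R)" using S R by simp
  also have "ennreal (A * (s / (s - 1)) * 2 powr s) * \<dots> = ennreal (A * (s / (s - 1)) * 2 powr s * S R)"
    using A s S(2)[OF R] by (intro ennreal_mult[symmetric]) auto
  finally show ?thesis using A s S(2)[OF R] by (subst (asm) ennreal_le_iff) auto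
qed

lemma dual_quotient_le:
  assumes "Q \<in> K"
  shows "(S Q / V Q) powr q \<le> C powr (q / (q - 1)) * (V Q / W Q) powr (q / (q - 1))"
proof -
  have pos: "0 < S Q" "0 < V Q" "0 < W Q" using S V W assms by auto
  have e: "V Q powr q = V Q powr (q - 1) * V Q" using pos powr_add[of "V Q" "q - 1" 1] by simp
  have "(S Q / V Q) powr (q - 1) \<le> C * (V Q / W Q)"
    using C(2)[OF assms] pos by (simp add: powr_divide e field_simps)
  then have "((S Q / V Q) powr (q - 1)) powr (q / (q - 1)) \<le> (C * (V Q / W Q)) powr (q / (q - 1))"
    using q by (intro powr_mono2) auto
  moreover have "((S Q / V Q) powr (q - 1)) powr (q / (q - 1)) = (S Q / V Q) powr q"
    using q by (simp add: powr_powr)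
  ultimately show ?thesis using C(1) pos by (simp only: powr_mult)
qed

text \<open>The second use: in \<open>L\<^sup>q(\<sigma>)\<close>, applied to \<open>g\<nu>/\<sigma>\<close>, with coefficients \<open>a Q (S Q / V Q)\<^sup>q\<close>. Their Carleson
condition is \<open>sum_quotient_le_dual\<close> after \<open>dual_quotient_le\<close>.\<close>
theorem weighted_carleson_embedding:
  fixes a :: "'k \<Rightarrow> real" and A :: real
  defines "s \<equiv> q / (q - 1)"
  assumes a: "\<And>Q. Q \<in> K \<Longrightarrow> 0 \<le> a Q" and A: "0 \<le> A"
    and car: "\<And>R. R \<in> K \<Longrightarrow> (\<Sum>Q\<in>{Q\<in>K. B Q \<subseteq> B R}. a Q) \<le> A * W R"
    and g [measurable]: "g \<in> borel_measurable M" and g0: "\<And>z. z \<in> space M \<Longrightarrow> 0 \<le> g z"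
    and y: "\<And>Q. Q \<in> K \<Longrightarrow> 0 \<le> y Q"
      "\<And>Q. Q \<in> K \<Longrightarrow> ennreal (y Q * V Q) \<le> (\<integral>\<^sup>+z. ennreal (g z * \<nu> z) * indicator (B Q) z \<partial>M)"
  shows "ennreal (\<Sum>Q\<in>K. a Q * y Q powr q)
    \<le> ennreal (C powr s * (A * (s / (s - 1)) * 2 powr s) * (q / (q - 1)) * 2 powr q)
      * (\<integral>\<^sup>+z. ennreal (g z powr q * \<omega> z) * indicator X z \<partial>M)"
proof -
  let ?\<sigma> = "dual_weight q \<nu> \<omega>"
  let ?M = "density M (\<lambda>z. ennreal (?\<sigma> z) * indicator X z)"
  let ?h = "\<lambda>z. g z * \<nu> z / ?\<sigma> z"
  let ?A = "C powr s * (A * (s / (s - 1)) * 2 powr s)"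
  have s: "1 < s" using q by (simp add: s_def field_simps)
  have em: "emeasure ?M (B Q) = ennreal (S Q)" if "Q \<in> K" for Q
    using that B S(1)[OF that] by (subst emeasure_restricted_density) auto
  have me: "measure ?M (B Q) = S Q" if "Q \<in> K" for Q
    using em[OF that] S(2)[OF that] by (simp add: measure_def)
  have "(\<Sum>Q\<in>K. a Q * y Q powr q) = (\<Sum>Q\<in>K. a Q * (S Q / V Q) powr q * (y Q * V Q / S Q) powr q)"
  proof (intro sum.cong refl)
    fix Q assume Q: "Q \<in> K"
    have pos: "0 < S Q" "0 < V Q" using S V Q by auto
    have "(S Q / V Q) powr q * (y Q * V Q / S Q) powr q = (S Q / V Q * (y Q * V Q / S Q)) powr q"
      using pos y(1)[OF Q] by (simp only: powr_mult)
    also have "S Q / V Q * (y Q * V Q / S Q) = y Q" using pos by simp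
    finally show "a Q * y Q powr q = a Q * (S Q / V Q) powr q * (y Q * V Q / S Q) powr q" by (simp add: mult.assoc)
  qed
  also have "ennreal \<dots> \<le> ennreal (?A * (q / (q - 1)) * 2 powr q) * (\<integral>\<^sup>+z. ennreal (?h z powr q) \<partial>?M)"
  proof (rule carleson_embedding[where B=B])
    show "finite_measure ?M" by (rule finite_restricted_density[OF _ X \<sigma>fin]) measurable
    show "finite K" by (rule K)
    show "1 < q" by (rule q)
    show "0 \<le> ?A" using A s by simp
    show "?h \<in> borel_measurable ?M" by simp
    show "0 \<le> ?h z" if "z \<in> space ?M" for z using \<nu>0[of z] g0[of z] that by simp
    fix Q assume Q: "Q \<in> K"
    have pos: "0 < S Q" "0 < V Q" using S V Q by auto
    show "B Q \<in> sets ?M" "0 \<le> a Q * (S Q / V Q) powr q" "0 \<le> y Q * V Q / S Q"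
      using B a[OF Q] y(1)[OF Q] pos Q by auto
    have "ennreal (y Q * V Q / S Q) * emeasure ?M (B Q) = ennreal (y Q * V Q)"
      using pos y(1)[OF Q] by (simp add: em Q ennreal_mult[symmetric])
    also have "\<dots> \<le> (\<integral>\<^sup>+z. ennreal (g z * \<nu> z) * indicator (B Q) z \<partial>M)" by (rule y(2)[OF Q])
    also have "\<dots> = (\<integral>\<^sup>+z. ennreal (?\<sigma> z) * indicator X z * (ennreal (?h z) * indicator (B Q) z) \<partial>M)"
    proof (rule nn_integral_cong_AE)
      show "AE z in M. ennreal (g z * \<nu> z) * indicator (B Q) z = ennreal (?\<sigma> z) * indicator X z * (ennreal (?h z) * indicator (B Q) z)"
        using ae AE_space
      proof eventually_elim
        case (elim z)
        note nonneg = \<nu>0[OF elim(2)] g0[OF elim(2)]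
        show ?case
        proof (cases "z \<in> B Q")
          case True
          then have z: "z \<in> X" using Q B by auto
          then have "g z * \<nu> z = ?\<sigma> z * ?h z" using elim by (auto simp: dual_weight_def)
          then have "ennreal (g z * \<nu> z) = ennreal (?\<sigma> z) * ennreal (?h z)"
            using nonneg by (simp add: ennreal_mult[symmetric])
          then show ?thesis using True z by simp
        qed simp
      qed
    qed
    also have "\<dots> = (\<integral>\<^sup>+z. ennreal (?h z) * indicator (B Q) z \<partial>?M)"
      using B Q by (intro nn_integral_density[symmetric]) auto
    finally show "ennreal (y Q * V Q / S Q) * emeasure ?M (B Q) \<le> (\<integral>\<^sup>+z. ennreal (?h z) * indicator (B Q) z \<partial>?M)" .
  next
    fix Q P assume "Q \<in> K" "P \<in> K"
    then show "B Q \<subseteq> B P \<or> B P \<subseteq> B Q \<or> B Q \<inter> B P = {}" by (rule lam)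
  next
    fix R assume R: "R \<in> K"
    have "(\<Sum>Q\<in>{Q\<in>K. B Q \<subseteq> B R}. a Q * (S Q / V Q) powr q)
        \<le> (\<Sum>Q\<in>{Q\<in>K. B Q \<subseteq> B R}. C powr s * (a Q * (V Q / W Q) powr s))"
    proof (rule sum_mono)
      fix Q assume "Q \<in> {Q\<in>K. B Q \<subseteq> B R}"
      then have Q: "Q \<in> K" by simp
      show "a Q * (S Q / V Q) powr q \<le> C powr s * (a Q * (V Q / W Q) powr s)"
        using mult_left_mono[OF dual_quotient_le[OF Q] a[OF Q]] by (simp add: s_def mult_ac)
    qed
    also have "\<dots> = C powr s * (\<Sum>Q\<in>{Q\<in>K. B Q \<subseteq> B R}. a Q * (V Q / W Q) powr s)"
      by (rule sum_distrib_left[symmetric])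
    also have "\<dots> \<le> C powr s * (A * (s / (s - 1)) * 2 powr s * S R)"
      using sum_quotient_le_dual[OF a A car R] unfolding s_def by (intro mult_left_mono) auto
    finally show "(\<Sum>Q\<in>{Q\<in>K. B Q \<subseteq> B R}. a Q * (S Q / V Q) powr q) \<le> ?A * measure ?M (B R)"
      by (simp add: me R mult.assoc)
  qed
  also have "(\<integral>\<^sup>+z. ennreal (?h z powr q) \<partial>?M) = (\<integral>\<^sup>+z. ennreal (?\<sigma> z) * indicator X z * ennreal (?h z powr q) \<partial>M)"
    by (intro nn_integral_density) auto
  finally have "ennreal (\<Sum>Q\<in>K. a Q * y Q powr q) \<le> ennreal (?A * (q / (q - 1)) * 2 powr q)
      * (\<integral>\<^sup>+z. ennreal (?\<sigma> z) * indicator X z * ennreal (?h z powr q) \<partial>M)" .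
  moreover have "(\<integral>\<^sup>+z. ennreal (?\<sigma> z) * indicator X z * ennreal (?h z powr q) \<partial>M)
      \<le> (\<integral>\<^sup>+z. ennreal (g z powr q * \<omega> z) * indicator X z \<partial>M)"
  proof (intro nn_integral_mono)
    fix z assume z: "z \<in> space M"
    have "?\<sigma> z * ?h z powr q \<le> g z powr q * \<omega> z"
    proof (cases "\<nu> z = 0 \<or> \<omega> z = 0")
      case True then show ?thesis using \<omega>0[OF z] by (auto simp: dual_weight_def)
    next
      case False
      then have pos: "0 < \<nu> z" "0 < \<omega> z" using \<nu>0[OF z] \<omega>0[OF z] by auto
      then have sp: "0 < ?\<sigma> z" by (simp add: dual_weight_def)
      have "?\<sigma> z * ?h z powr q = g z powr q * (\<nu> z powr q * (?\<sigma> z powr 1 / ?\<sigma> z powr q))"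
        using g0[OF z] pos sp by (simp add: powr_mult powr_divide)
      also have "?\<sigma> z powr 1 / ?\<sigma> z powr q = ?\<sigma> z powr (1 - q)" by (simp only: powr_diff)
      also have "\<nu> z powr q * ?\<sigma> z powr (1 - q) = \<omega> z" by (rule dual_weight_power[where \<nu>=\<nu> and \<omega>=\<omega> and z=z, OF q pos])
      finally show ?thesis by simp
    qed
    then have "ennreal (?\<sigma> z * ?h z powr q) \<le> ennreal (g z powr q * \<omega> z)" by (rule ennreal_leI)
    then show "ennreal (?\<sigma> z) * indicator X z * ennreal (?h z powr q) \<le> ennreal (g z powr q * \<omega> z) * indicator X z"
      by (simp add: ennreal_mult' indicator_def)
  qed
  ultimately show ?thesis by (rule order_trans[OF _ mult_left_mono]) simp
qed

end

section \<open>Dyadic squares\<close>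
definition angle :: "complex \<Rightarrow> real" where
  "angle z = Arg2pi z / (2 * pi)"

definition cell :: "nat \<Rightarrow> complex \<Rightarrow> int" where
  "cell m z = \<lfloor>2 ^ m * angle z\<rfloor>"

text \<open>Cells are arranged on a circle, so the first and the last cell are neighbours; the integer \<open>k\<close> counts
turns.\<close>
definition adjacent :: "nat \<Rightarrow> int \<Rightarrow> int \<Rightarrow> bool" where
  "adjacent m i j \<longleftrightarrow> (\<exists>k::int. \<bar>i - j - k * 2 ^ m\<bar> \<le> 1)"

text \<open>The exponent is \<open>Suc m\<close>, so that even the largest annulus and the largest dyadic square stay in
\<open>|z| \<ge> 1/2\<close>.\<close>
definition annulus :: "nat \<Rightarrow> complex set" where
  "annulus m = {z \<in> unit_disc. 1 - norm z \<le> (1 / 2) ^ Suc m}"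

definition dyadic_square :: "nat \<Rightarrow> int \<Rightarrow> complex set" where
  "dyadic_square m i = {z \<in> annulus m. cell m z = i}"

text \<open>The set of all \<open>z\<close> whose estimate involves the square \<open>dyadic_square m i\<close>. It is three cells wide, and
twice as high as the square, so that the block of generation \<open>0\<close> is the whole disc.\<close>
definition dyadic_block :: "nat \<Rightarrow> int \<Rightarrow> complex set" where
  "dyadic_block m i = {z \<in> unit_disc. 1 - norm z \<le> (1 / 2) ^ m \<and> adjacent m i (cell m z)}"

lemma angle_range: "0 \<le> angle z" "angle z < 1"
  using Arg2pi[of z] by (auto simp: angle_def)

lemma angle_polar: "z = of_real (norm z) * cis (2 * pi * angle z)"
  using Arg2pi[of z] by (simp add: angle_def is_Arg_def cis_conv_exp mult_ac)

lemma angle_unique: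
  assumes "z = of_real r * cis (2 * pi * s)" "0 < r" "0 \<le> s" "s < 1"
  shows "angle z = s"
proof -
  have "Arg2pi z = 2 * pi * s"
    by (rule Arg2pi_unique[of r]) (use assms in \<open>auto simp: cis_conv_exp mult_ac\<close>)
  then show ?thesis by (simp add: angle_def)
qed

lemma measurable_angle [measurable]: "angle \<in> borel_measurable borel"
proof -
  have "Arg2pi \<in> borel_measurable borel"
    by (rule borel_measurable_iff_greater[THEN iffD2]) (auto intro!: borel_open open_Arg2pi2pi_gt)
  then show ?thesis unfolding angle_def by measurable
qed

lemma measurable_cell: "{z. cell m z = i} \<in> sets borel"
  unfolding cell_def by measurable

lemma cell_range: "0 \<le> cell m z" "cell m z < 2 ^ m"
proof -
  show "0 \<le> cell m z" using angle_range(1)[of z] by (simp add: cell_def)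
  have "2 ^ m * angle z < 2 ^ m * 1" using angle_range(2)[of z] by (intro mult_strict_left_mono) auto
  then show "cell m z < 2 ^ m" by (simp add: cell_def floor_less_iff)
qed

lemma cell_0 [simp]: "cell 0 z = 0"
  using cell_range[of 0 z] by simp

lemma cell_div:
  assumes "m \<le> n" shows "cell m z = cell n z div 2 ^ (n - m)"
proof -
  have "2 ^ m * angle z = 2 ^ n * angle z / real_of_int (2 ^ (n - m))"
    using assms by (simp add: power_add[symmetric] field_simps)
  then show ?thesis
    by (simp only: cell_def) (rule floor_divide_real_eq_div, simp)
qed

lemma adjacent_refl [simp]: "adjacent m i i"
  by (auto simp: adjacent_def intro: exI[of _ 0])

lemma adjacent_0 [simp]: "adjacent 0 i j"
  by (auto simp: adjacent_def intro: exI[of _ "i - j"])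

lemma adjacent_div:
  assumes "adjacent n i j" "m \<le> n"
  shows "adjacent m (i div 2 ^ (n - m)) (j div 2 ^ (n - m))"
proof -
  define d :: int where "d = 2 ^ (n - m)"
  have d: "1 \<le> d" by (simp add: d_def)
  obtain k where k: "\<bar>i - j - k * 2 ^ n\<bar> \<le> 1" using assms(1) by (auto simp: adjacent_def)
  have pn: "(2::int) ^ n = 2 ^ m * d" using assms(2) by (simp add: d_def power_add[symmetric])
  define i' where "i' = i - k * 2 ^ m * d"
  have i': "\<bar>i' - j\<bar> \<le> 1" using k by (simp add: i'_def pn algebra_simps)
  have dv: "i' div d = i div d - k * 2 ^ m"
    using d div_mult_self1[of d i "- (k * 2 ^ m)"] by (simp add: i'_def)
  have "j div d \<le> (i' + 1 * d) div d" using i' d by (intro zdiv_mono1) auto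
  moreover have "i' div d \<le> (j + 1 * d) div d" using i' d by (intro zdiv_mono1) auto
  ultimately have "\<bar>i' div d - j div d\<bar> \<le> 1" using d by simp
  then show ?thesis unfolding adjacent_def d_def[symmetric]
    by (intro exI[of _ k]) (simp add: dv algebra_simps)
qed

lemma card_adjacent: "card {i \<in> {0..<2 ^ m}. adjacent m i j} \<le> 3"
proof -
  have "{i \<in> {0..<2 ^ m}. adjacent m i j} \<subseteq> (\<lambda>i. i mod 2 ^ m) ` {j - 1, j, j + 1}"
  proof
    fix i assume i: "i \<in> {i \<in> {0..<2 ^ m}. adjacent m i j}"
    then obtain k where k: "\<bar>i - j - k * 2 ^ m\<bar> \<le> 1" by (auto simp: adjacent_def)
    have "(i - k * 2 ^ m) mod 2 ^ m = i mod 2 ^ m" 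
      using mod_mult_self1[of i "-k" "2 ^ m"] by simp
    also have "\<dots> = i" using i by simp
    finally have "i = (i - k * 2 ^ m) mod 2 ^ m" by simp
    moreover have "i - k * 2 ^ m \<in> {j - 1, j, j + 1}" using k by auto
    ultimately show "i \<in> (\<lambda>i. i mod 2 ^ m) ` {j - 1, j, j + 1}" by blast
  qed
  then have "card {i \<in> {0..<2 ^ m}. adjacent m i j} \<le> card ((\<lambda>i. i mod 2 ^ m) ` {j - 1, j, j + 1})"
    by (intro card_mono) auto
  also have "\<dots> \<le> card {j - 1, j, j + 1}" by (rule card_image_le) simp
  also have "\<dots> \<le> 3" by (simp add: card_insert_if)
  finally show ?thesis .
qed

text \<open>In contrapositive form: points in cells that are not adjacent are separated by a full cell.\<close>
lemma adjacent_of_close: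
  assumes "\<bar>angle z - angle w - of_int k\<bar> < (1 / 2) ^ m"
  shows "adjacent m (cell m z) (cell m w)"
proof -
  have "\<bar>2 ^ m * (angle z - angle w - of_int k)\<bar> < 2 ^ m * (1 / 2) ^ m"
    using assms by (simp add: abs_mult)
  then have c: "\<bar>2 ^ m * angle z - 2 ^ m * angle w - of_int (k * 2 ^ m)\<bar> < 1"
    by (simp add: algebra_simps power_mult_distrib[symmetric])
  have "\<bar>cell m z - cell m w - k * 2 ^ m\<bar> \<le> 1" unfolding cell_def using c by linarith
  then show ?thesis by (auto simp: adjacent_def)
qed

lemma sin_ge_third:
  fixes t :: real
  assumes t: "0 \<le> t" "t \<le> 2"
  shows "t / 3 \<le> sin t"
proof -
  have "\<bar>sin t - t\<bar> \<le> t ^ 3 / 6"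
  proof -
    have "(\<Sum>m<3. sin_coeff m * t ^ m) = t"
      by (simp add: eval_nat_numeral sin_coeff_def)
    moreover have "inverse (fact 3) * \<bar>t\<bar> ^ 3 = t ^ 3 / 6" using t by (simp add: fact_numeral)
    ultimately show ?thesis using Maclaurin_sin_bound[of t 3] by (simp only:)
  qed
  moreover have "t ^ 3 / 6 \<le> 2 / 3 * t"
  proof -
    have "t * (t * t) \<le> t * (2 * 2)" using t by (intro mult_left_mono mult_mono) auto
    then show ?thesis by (simp add: power3_eq_cube)
  qed
  ultimately show ?thesis by linarith
qed

text \<open>The angle is reduced modulo a full turn to \<open>|\<psi>| \<le> 1/2\<close>. For \<open>x \<le> 1/2\<close> the modulus is at least \<open>1/2\<close>; for
larger \<open>x\<close> the real part helps when \<open>|\<psi>| \<ge> 1/4\<close> and the imaginary part otherwise.\<close>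
lemma norm_one_minus_cis_ge:
  assumes x: "0 \<le> x" "x \<le> 1" and d: "\<And>k::int. d \<le> \<bar>\<phi> - of_int k\<bar>"
  shows "d \<le> norm (1 - of_real x * cis (2 * pi * \<phi>))"
proof -
  define \<psi> where "\<psi> = \<phi> - of_int (round \<phi>)"
  have \<psi>: "\<bar>\<psi>\<bar> \<le> 1 / 2" using of_int_round_abs_le[of \<phi>] by (simp add: \<psi>_def abs_minus_commute)
  have cis: "cis (2 * pi * \<phi>) = cis (2 * pi * \<psi>)"
  proof -
    have "2 * pi * \<phi> = 2 * pi * \<psi> + 2 * pi * of_int (round \<phi>)" by (simp add: \<psi>_def algebra_simps)
    then have "cis (2 * pi * \<phi>) = cis (2 * pi * \<psi>) * cis (2 * pi * of_int (round \<phi>))"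
      by (simp only: cis_mult)
    then show ?thesis by (simp add: cis_multiple_2pi)
  qed
  let ?e = "1 - of_real x * cis (2 * pi * \<psi>)"
  have "\<bar>\<psi>\<bar> \<le> norm ?e"
  proof -
    consider "x \<le> 1 / 2" | "1 / 2 < x" "1 / 4 \<le> \<bar>\<psi>\<bar>" | "1 / 2 < x" "\<bar>\<psi>\<bar> < 1 / 4" by linarith
    then show ?thesis
    proof cases
      case 1
      have "1 - x \<le> norm ?e" using norm_triangle_ineq2[of 1 "of_real x * cis (2 * pi * \<psi>)"] x
        by (simp add: norm_mult)
      with 1 \<psi> show ?thesis by linarith
    next
      case 2
      have "cos (2 * pi * \<psi>) = - cos (pi - \<bar>2 * pi * \<psi>\<bar>)" by simp
      also have "\<dots> \<le> 0"
        using 2 \<psi> by (intro neg_le_0_iff_le[THEN iffD2] cos_ge_zero) (auto simp: abs_mult field_simps)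
      finally have "x * cos (2 * pi * \<psi>) \<le> 0" using x by (simp add: mult_nonneg_nonpos)
      then have "1 \<le> Re ?e" by simp
      then show ?thesis using complex_Re_le_cmod[of ?e] \<psi> by linarith
    next
      case 3
      define t where "t = 2 * pi * \<bar>\<psi>\<bar>"
      have "pi * \<bar>\<psi>\<bar> \<le> 4 * (1 / 4)" using 3 pi_less_4 by (intro mult_mono) auto
      then have t: "0 \<le> t" "t \<le> 2" by (auto simp: t_def)
      have "t / 3 \<le> sin t" using t by (rule sin_ge_third)
      moreover have "2 * \<bar>\<psi>\<bar> \<le> t / 3" using mult_right_mono[of 3 pi "\<bar>\<psi>\<bar>"] pi_gt3 by (simp add: t_def)
      ultimately have "2 * \<bar>\<psi>\<bar> \<le> sin t" by linarith
      also have "sin t \<le> \<bar>sin (2 * pi * \<psi>)\<bar>"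
        by (cases "0 \<le> \<psi>") (auto simp: t_def)
      finally have "x * (2 * \<bar>\<psi>\<bar>) \<le> x * \<bar>sin (2 * pi * \<psi>)\<bar>" using x by (intro mult_left_mono)
      moreover have "1 / 2 * (2 * \<bar>\<psi>\<bar>) \<le> x * (2 * \<bar>\<psi>\<bar>)" using 3 by (intro mult_right_mono) auto
      ultimately have "\<bar>\<psi>\<bar> \<le> \<bar>Im ?e\<bar>" using x by (simp add: abs_mult)
      then show ?thesis using abs_Im_le_cmod[of ?e] by linarith
    qed
  qed
  then show ?thesis using d[of "round \<phi>"] by (simp add: cis \<psi>_def)
qed

lemma kernel_ge_of_not_adjacent:
  assumes "\<not> adjacent m (cell m w) (cell m z)" "norm z < 1" "norm w < 1"
  shows "(1 / 2) ^ m \<le> norm (1 - cnj z * w)"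
proof -
  have "cnj z * w = of_real (norm z * norm w) * cis (2 * pi * (angle w - angle z))"
  proof -
    have "cnj z = of_real (norm z) * cis (- (2 * pi * angle z))"
      by (subst angle_polar) (simp add: cis_cnj)
    then have "cnj z * w = (of_real (norm z) * cis (- (2 * pi * angle z))) * (of_real (norm w) * cis (2 * pi * angle w))"
      using angle_polar[of w] by metis
    also have "\<dots> = of_real (norm z * norm w) * (cis (- (2 * pi * angle z)) * cis (2 * pi * angle w))"
      by simp
    also have "cis (- (2 * pi * angle z)) * cis (2 * pi * angle w) = cis (2 * pi * (angle w - angle z))"
      by (simp add: cis_mult algebra_simps)
    finally show ?thesis .
  qed
  moreover have "(1 / 2) ^ m \<le> norm (1 - of_real (norm z * norm w) * cis (2 * pi * (angle w - angle z)))"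
  proof (rule norm_one_minus_cis_ge)
    show "norm z * norm w \<le> 1" using assms by (intro mult_le_one) auto
    show "(1 / 2) ^ m \<le> \<bar>angle w - angle z - of_int k\<bar>" for k
      using adjacent_of_close[of w z k m] assms(1) by force
  qed auto
  ultimately show ?thesis by simp
qed

lemma annulus_measurable [measurable]: "annulus m \<in> sets borel"
  unfolding annulus_def by measurable

lemma dyadic_square_measurable [measurable]: "dyadic_square m i \<in> sets borel"
proof -
  have "dyadic_square m i = annulus m \<inter> {z. cell m z = i}" by (auto simp: dyadic_square_def)
  then show ?thesis using measurable_cell annulus_measurable by auto
qed

lemma dyadic_block_measurable [measurable]: "dyadic_block m i \<in> sets borel"
proof -
  have "dyadic_block m i = {z \<in> unit_disc. 1 - norm z \<le> (1 / 2) ^ m} \<inter> (\<Union>j\<in>{j. adjacent m i j}. {z. cell m z = j})"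
    by (auto simp: dyadic_block_def)
  moreover have "{z \<in> unit_disc. 1 - norm z \<le> (1 / 2) ^ m} \<in> sets (borel :: complex measure)" by measurable
  ultimately show ?thesis using measurable_cell by (auto intro!: sets.Int sets.countable_UN'')
qed

lemma sets_area_measureI:
  assumes "A \<in> sets borel" "A \<subseteq> unit_disc" shows "A \<in> sets area_measure"
proof -
  have "A \<in> sets lebesgue" using assms(1) by simp
  then show ?thesis unfolding sets_area_measure using assms(2)
    by (subst sets_restrict_space_iff) auto
qed

lemma annulus_subset: "annulus m \<subseteq> unit_disc"
  and dyadic_square_subset: "dyadic_square m i \<subseteq> annulus m"
  and dyadic_block_subset: "dyadic_block m i \<subseteq> unit_disc"
  by (auto simp: annulus_def dyadic_square_def dyadic_block_def)

lemma dyadic_square_subset_block: "dyadic_square m i \<subseteq> dyadic_block m i"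
proof
  fix z assume z: "z \<in> dyadic_square m i"
  then have "1 - norm z \<le> (1/2) ^ Suc m" by (simp add: dyadic_square_def annulus_def)
  also have "\<dots> \<le> (1/2::real) ^ m" by (rule power_decreasing) auto
  finally show "z \<in> dyadic_block m i" using z by (auto simp: dyadic_square_def dyadic_block_def annulus_def)
qed

lemma annulus_norm: "z \<in> annulus m \<Longrightarrow> 1 / 2 \<le> norm z"
  using power_decreasing[of 1 "Suc m" "1/2::real"] by (simp add: annulus_def)

lemma annulus_antimono: "m \<le> n \<Longrightarrow> annulus n \<subseteq> annulus m"
  unfolding annulus_def
  by (auto simp del: power_Suc intro: order_trans[OF _ power_decreasing])

lemma dyadic_squares_laminar:
  assumes "m \<le> n"
  shows "dyadic_square n j \<subseteq> dyadic_square m i \<or> dyadic_square n j \<inter> dyadic_square m i = {}"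
proof (cases "j div 2 ^ (n - m) = i")
  case True
  then show ?thesis using annulus_antimono[OF assms] cell_div[OF assms] by (auto simp: dyadic_square_def)
next
  case False
  then show ?thesis using cell_div[OF assms] by (auto simp: dyadic_square_def)
qed

text \<open>A square contains points on its inner edge, hence inclusion of squares forces the order of the
generations.\<close>
lemma dyadic_square_subset_cases:
  assumes "dyadic_square n j \<subseteq> dyadic_square m i" "0 \<le> j" "j < 2 ^ n"
  shows "m \<le> n" "i = j div 2 ^ (n - m)"
proof -
  define z where "z = of_real (1 - (1/2) ^ Suc n) * cis (2 * pi * (of_int j / 2 ^ n))"
  have p: "(1/2::real) ^ Suc n \<le> 1/2" "0 < (1/2::real) ^ Suc n"
    using power_decreasing[of 1 "Suc n" "1/2::real"] by auto
  have nz: "norm z = 1 - (1/2) ^ Suc n" 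
    unfolding z_def norm_mult norm_cis norm_of_real using p by (simp only: mult_1_right abs_of_nonneg)
  have j: "real_of_int j < 2 ^ n" using assms(3) by (metis of_int_less_iff of_int_numeral of_int_power)
  have "angle z = of_int j / 2 ^ n"
    by (rule angle_unique[of _ "1 - (1/2) ^ Suc n"]) (use p assms(2) j in \<open>auto simp: z_def\<close>)
  then have "cell n z = j" by (simp add: cell_def)
  then have z: "z \<in> dyadic_square n j" using p nz by (auto simp: dyadic_square_def annulus_def)
  with assms(1) have z': "z \<in> dyadic_square m i" by auto
  then have "(1/2::real) ^ Suc n \<le> (1/2) ^ Suc m" using nz by (simp add: dyadic_square_def annulus_def)
  then show "m \<le> n" by simp
  then show "i = j div 2 ^ (n - m)" using z' \<open>cell n z = j\<close> cell_div[of m n z] by (simp add: dyadic_square_def)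
qed

section \<open>Masses of dyadic squares for radial doubling weights\<close>
lemma weighted_area_mono: "E \<subseteq> F \<Longrightarrow> weighted_area \<nu> E \<le> weighted_area \<nu> F"
  unfolding weighted_area_def by (intro nn_integral_mono mult_left_mono) (auto simp: indicator_def)

lemma weight_measurable: "weight \<nu> \<Longrightarrow> \<nu> \<in> borel_measurable area_measure"
  by (auto simp: weight_def)

lemma weight_nonneg: "weight \<nu> \<Longrightarrow> norm z < 1 \<Longrightarrow> 0 \<le> \<nu> z"
  by (auto simp: weight_def)

lemma radial_weight_weight: "radial_weight \<nu> \<Longrightarrow> weight \<nu>"
  by (simp add: radial_weight_def)

lemma radial_weight_norm: "radial_weight \<nu> \<Longrightarrow> norm z < 1 \<Longrightarrow> \<nu> z = \<nu> (of_real (norm z))"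
  unfolding radial_weight_def by (metis mem_ball_0)

lemma weighted_area_finite:
  assumes "weight \<nu>" shows "weighted_area \<nu> E < \<infinity>"
proof -
  have "weighted_area \<nu> E \<le> (\<integral>\<^sup>+z. ennreal (norm (\<nu> z)) \<partial>area_measure)"
    unfolding weighted_area_def by (intro nn_integral_mono) (auto simp: indicator_def intro!: ennreal_leI)
  also have "\<dots> < \<infinity>" using assms by (simp add: weight_def integrable_iff_bounded)
  finally show ?thesis .
qed

lemma weighted_area_Union_le:
  assumes "finite I" "\<And>i. i \<in> I \<Longrightarrow> A i \<in> sets area_measure" "\<nu> \<in> borel_measurable area_measure"
    and "E \<subseteq> (\<Union>i\<in>I. A i)"
  shows "weighted_area \<nu> E \<le> (\<Sum>i\<in>I. weighted_area \<nu> (A i))"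
proof -
  have "weighted_area \<nu> E \<le> (\<integral>\<^sup>+z. (\<Sum>i\<in>I. ennreal (\<nu> z) * indicator (A i) z) \<partial>area_measure)"
    unfolding weighted_area_def
  proof (intro nn_integral_mono)
    fix z
    show "ennreal (\<nu> z) * indicator E z \<le> (\<Sum>i\<in>I. ennreal (\<nu> z) * indicator (A i) z)"
    proof (cases "z \<in> E")
      case True
      then obtain i where i: "i \<in> I" "z \<in> A i" using assms(4) by blast
      then have "ennreal (\<nu> z) * indicator E z = ennreal (\<nu> z) * indicator (A i) z" using True by simp
      also have "\<dots> \<le> (\<Sum>i\<in>I. ennreal (\<nu> z) * indicator (A i) z)"
        by (rule member_le_sum) (use i assms in auto)
      finally show ?thesis .
    qed simp
  qed
  also have "\<dots> = (\<Sum>i\<in>I. weighted_area \<nu> (A i))"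
    unfolding weighted_area_def using assms by (intro nn_integral_sum) auto
  finally show ?thesis .
qed

lemma radial_weight_rotate:
  "radial_weight \<nu> \<Longrightarrow> norm z < 1 \<Longrightarrow> \<nu> (cis t * z) = \<nu> z"
  unfolding radial_weight_def by (metis mem_ball_0 mult_1 norm_cis norm_mult)

lemma weighted_area_rotate:
  assumes "radial_weight \<nu>" "E \<in> sets area_measure"
    and "\<And>z. norm z < 1 \<Longrightarrow> cis t * z \<in> E \<longleftrightarrow> z \<in> F"
  shows "weighted_area \<nu> E = weighted_area \<nu> F"
proof -
  have [measurable]: "\<nu> \<in> borel_measurable area_measure" "E \<in> sets area_measure"
    using assms weight_measurable[OF radial_weight_weight] by auto
  have "weighted_area \<nu> E = (\<integral>\<^sup>+z. ennreal (\<nu> (cis t * z)) * indicator E (cis t * z) \<partial>area_measure)"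
    unfolding weighted_area_def by (rule nn_integral_area_rotation[symmetric]) measurable
  also have "\<dots> = weighted_area \<nu> F"
    unfolding weighted_area_def using assms
    by (intro nn_integral_cong) (simp add: radial_weight_rotate indicator_def)
  finally show ?thesis .
qed

text \<open>Rotations by multiples of \<open>2\<^bsup>-m\<^esup>\<close> turns permute the squares of generation \<open>m\<close>, so a radial weight gives
them equal masses.\<close>
lemma rotate_dyadic_square:
  assumes "0 \<le> i" "i < 2 ^ m" "norm z < 1"
  shows "cis (2 * pi * (of_int i / 2 ^ m)) * z \<in> dyadic_square m i \<longleftrightarrow> z \<in> dyadic_square m 0"
proof -
  define s where "s = real_of_int i / 2 ^ m"
  let ?w = "cis (2 * pi * s) * z"
  have "real_of_int i + 1 \<le> real_of_int (2 ^ m)" using assms(2) by linarith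
  then have s: "0 \<le> s" "s + 1 / 2 ^ m \<le> 1" "2 ^ m * s = of_int i"
    using assms(1) by (auto simp: s_def field_simps)
  have eq: "(?w \<in> annulus m) = (z \<in> annulus m)" by (simp add: annulus_def norm_mult)
  have "cell m ?w = i \<longleftrightarrow> cell m z = 0" if "z \<in> annulus m"
  proof -
    have nz: "0 < norm z" using annulus_norm[OF that] by linarith
    have p: "0 < (2::real) ^ m" by simp
    have swap: "cis a * (of_real x * cis b) = of_real x * (cis a * cis b)" for a b x by (simp add: mult_ac)
    show ?thesis
    proof
      assume "cell m z = 0"
      then have "2 ^ m * angle z < 1" by (simp add: cell_def floor_eq_iff)
      then have lt: "angle z < 1 / 2 ^ m" using p by (simp add: field_simps)
      have "angle ?w = s + angle z"
      proof (rule angle_unique[of _ "norm z"])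
        have "?w = cis (2 * pi * s) * (norm z * cis (2 * pi * angle z))" using angle_polar[of z] by metis
        also have "\<dots> = norm z * (cis (2 * pi * s) * cis (2 * pi * angle z))" by (rule swap)
        also have "\<dots> = norm z * cis (2 * pi * (s + angle z))" by (simp add: cis_mult distrib_left)
        finally show "?w = norm z * cis (2 * pi * (s + angle z))" .
      qed (use nz s lt angle_range[of z] in auto)
      then have "cell m ?w = \<lfloor>of_int i + 2 ^ m * angle z\<rfloor>" by (simp add: cell_def distrib_left s)
      then show "cell m ?w = i" using \<open>cell m z = 0\<close> by (simp add: cell_def)
    next
      assume i: "cell m ?w = i"
      then have "of_int i \<le> 2 ^ m * angle ?w" "2 ^ m * angle ?w < of_int i + 1" by (auto simp: cell_def floor_eq_iff)
      then have r: "s \<le> angle ?w" "angle ?w - s < 1 / 2 ^ m"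
        using p by (auto simp: s_def pos_divide_le_eq pos_less_divide_eq add_divide_distrib[symmetric]
            diff_less_eq add.commute mult.commute)
      have nw: "norm ?w = norm z" by (simp add: norm_mult)
      have "angle z = angle ?w - s"
      proof (rule angle_unique[of _ "norm z"])
        have "z = cis (- (2 * pi * s)) * ?w" by (simp add: mult.assoc[symmetric] cis_mult)
        also have "\<dots> = cis (- (2 * pi * s)) * (norm ?w * cis (2 * pi * angle ?w))" using angle_polar[of ?w] by metis
        also have "\<dots> = norm z * (cis (- (2 * pi * s)) * cis (2 * pi * angle ?w))" by (simp only: nw swap)
        also have "cis (- (2 * pi * s)) * cis (2 * pi * angle ?w) = cis (2 * pi * (angle ?w - s))"
          by (simp add: cis_mult right_diff_distrib)
        finally show "z = norm z * cis (2 * pi * (angle ?w - s))" .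
      qed (use nz s r in auto)
      then have "cell m z = \<lfloor>2 ^ m * angle ?w - of_int i\<rfloor>" by (simp add: cell_def right_diff_distrib s)
      then show "cell m z = 0" using i by (simp add: cell_def)
    qed
  qed
  with eq show ?thesis unfolding dyadic_square_def s_def by auto
qed

lemma dyadic_square_sets [measurable]: "dyadic_square m i \<in> sets area_measure"
  using dyadic_square_subset annulus_subset by (intro sets_area_measureI dyadic_square_measurable) blast

lemma annulus_sets [measurable]: "annulus m \<in> sets area_measure"
  using annulus_subset by (intro sets_area_measureI annulus_measurable)

lemma weighted_area_annulus_sum:
  assumes "\<nu> \<in> borel_measurable area_measure"
  shows "weighted_area \<nu> (annulus m) = (\<Sum>i\<in>{0..<2 ^ m}. weighted_area \<nu> (dyadic_square m i))"
proof (rule antisym)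
  show "weighted_area \<nu> (annulus m) \<le> (\<Sum>i\<in>{0..<2 ^ m}. weighted_area \<nu> (dyadic_square m i))"
  proof (rule weighted_area_Union_le)
    show "annulus m \<subseteq> (\<Union>i\<in>{0..<2 ^ m}. dyadic_square m i)"
      using cell_range[of m] by (auto simp: dyadic_square_def)
  qed (use assms dyadic_square_sets in auto)
  have "(\<Sum>i\<in>{0..<2 ^ m}. weighted_area \<nu> (dyadic_square m i))
      = (\<integral>\<^sup>+z. (\<Sum>i\<in>{0..<2 ^ m}. ennreal (\<nu> z) * indicator (dyadic_square m i) z) \<partial>area_measure)"
    unfolding weighted_area_def using assms by (intro nn_integral_sum[symmetric]) auto
  also have "\<dots> \<le> weighted_area \<nu> (annulus m)"
    unfolding weighted_area_def
  proof (intro nn_integral_mono)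
    fix z
    have "(\<Sum>i\<in>{0..<2 ^ m}. ennreal (\<nu> z) * indicator (dyadic_square m i) z)
        = (\<Sum>i\<in>{0..<2 ^ m}. if i = cell m z then ennreal (\<nu> z) * indicator (annulus m) z else 0)"
      by (intro sum.cong refl) (auto simp: dyadic_square_def indicator_def)
    also have "\<dots> \<le> ennreal (\<nu> z) * indicator (annulus m) z" by (simp add: sum.delta)
    finally show "(\<Sum>i\<in>{0..<2 ^ m}. ennreal (\<nu> z) * indicator (dyadic_square m i) z) \<le> ennreal (\<nu> z) * indicator (annulus m) z" .
  qed
  finally show "(\<Sum>i\<in>{0..<2 ^ m}. weighted_area \<nu> (dyadic_square m i)) \<le> weighted_area \<nu> (annulus m)" .
qed

lemma weighted_area_dyadic_square:
  assumes \<nu>: "radial_weight \<nu>" and i: "0 \<le> i" "i < 2 ^ m"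
  shows "weighted_area \<nu> (annulus m) = 2 ^ m * weighted_area \<nu> (dyadic_square m i)"
proof -
  have eq: "weighted_area \<nu> (dyadic_square m j) = weighted_area \<nu> (dyadic_square m 0)" if "0 \<le> j" "j < 2 ^ m" for j
    by (rule weighted_area_rotate[OF \<nu> dyadic_square_sets rotate_dyadic_square[OF that]])
  have "\<nu> \<in> borel_measurable area_measure" using weight_measurable[OF radial_weight_weight[OF \<nu>]] .
  then have "weighted_area \<nu> (annulus m) = (\<Sum>j\<in>{0..<2 ^ m}. weighted_area \<nu> (dyadic_square m j))"
    by (rule weighted_area_annulus_sum)
  also have "\<dots> = (\<Sum>j\<in>{0..<(2::int) ^ m}. weighted_area \<nu> (dyadic_square m i))"
    by (rule sum.cong) (auto intro: trans[OF eq eq[OF i, symmetric]])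
  also have "\<dots> = 2 ^ m * weighted_area \<nu> (dyadic_square m i)" by (simp add: nat_power_eq)
  finally show ?thesis .
qed

text \<open>Radial or not, a weight charges each Carleson square, and a thin one fits into the annulus.\<close>
lemma annulus_pos:
  assumes "weight \<nu>" shows "0 < weighted_area \<nu> (annulus m)"
proof -
  define r where "r = 1 - (1/2::real) ^ Suc m"
  have r: "1 / 2 \<le> r" "r < 1"
    using power_decreasing[of 1 "Suc m" "1/2::real"] by (auto simp: r_def)
  have n: "norm (complex_of_real r) = r" using r by simp
  have "0 < weighted_area \<nu> (carleson_square (of_real r))"
    using assms r by (auto simp: weight_def)
  also have "carleson_square (of_real r) \<subseteq> annulus m"
  proof
    fix z assume z: "z \<in> carleson_square (of_real r)"
    then have "norm z < 1" by (simp add: carleson_square_def)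
    moreover obtain s t where st: "z = of_real s * cis t" "norm (complex_of_real r) \<le> s"
      using z by (auto simp: carleson_square_def)
    then have "r \<le> norm z" using r by (simp add: norm_mult)
    ultimately show "z \<in> annulus m" by (simp add: annulus_def r_def)
  qed
  then have "weighted_area \<nu> (carleson_square (of_real r)) \<le> weighted_area \<nu> (annulus m)"
    by (rule weighted_area_mono)
  finally show ?thesis .
qed

lemma tail_integral_nn:
  assumes \<nu>: "radial_weight \<nu>" and r: "0 \<le> r" "r < 1"
  shows "(\<lambda>s. ennreal (\<nu> (of_real s) * indicator {r..<1} s)) \<in> borel_measurable lebesgue"
    and "ennreal (tail_integral \<nu> r) = (\<integral>\<^sup>+s. ennreal (\<nu> (of_real s) * indicator {r..<1} s) \<partial>lebesgue)"
    and "0 \<le> tail_integral \<nu> r"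
proof -
  have si: "set_integrable lebesgue {0..<1} (\<lambda>s. \<nu> (of_real s))" using \<nu> by (simp add: radial_weight_def)
  have "set_integrable lebesgue {r..<1} (\<lambda>s. \<nu> (of_real s))"
    by (rule set_integrable_subset[OF si]) (use r in auto)
  then have int: "integrable lebesgue (\<lambda>s. \<nu> (of_real s) * indicator {r..<1} s)"
    by (simp add: set_integrable_def mult.commute)
  then show "(\<lambda>s. ennreal (\<nu> (of_real s) * indicator {r..<1} s)) \<in> borel_measurable lebesgue" by simp
  have nn: "0 \<le> \<nu> (of_real s) * indicator {r..<1} s" for s
    using weight_nonneg[OF radial_weight_weight[OF \<nu>], of "of_real s"] r by (auto simp: indicator_def)
  have t: "tail_integral \<nu> r = (\<integral>s. \<nu> (of_real s) * indicator {r..<1} s \<partial>lebesgue)"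
    by (simp add: tail_integral_def set_lebesgue_integral_def mult.commute)
  show "ennreal (tail_integral \<nu> r) = (\<integral>\<^sup>+s. ennreal (\<nu> (of_real s) * indicator {r..<1} s) \<partial>lebesgue)"
    unfolding t by (rule nn_integral_eq_integral[symmetric, OF int]) (use nn in auto)
  show "0 \<le> tail_integral \<nu> r" unfolding t by (rule integral_nonneg_AE) (use nn in simp)
qed

text \<open>The density of the radial variable is \<open>2s\<close>, which lies between \<open>1\<close> and \<open>2\<close> on the annulus.\<close>
lemma annulus_tail_integral:
  assumes \<nu>: "radial_weight \<nu>"
  defines "r \<equiv> \<lambda>m. 1 - (1/2::real) ^ Suc m"
  shows "weighted_area \<nu> (annulus m) \<le> ennreal (2 * tail_integral \<nu> (r m))"
    and "ennreal (tail_integral \<nu> (r m)) \<le> weighted_area \<nu> (annulus m)"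
proof -
  have r: "1 / 2 \<le> r m" "r m < 1"
    using power_decreasing[of 1 "Suc m" "1/2::real"] by (auto simp: r_def)
  let ?\<phi> = "\<lambda>s. ennreal (\<nu> (of_real s) * indicator {r m..<1} s)"
  have meas: "?\<phi> \<in> borel_measurable lebesgue" using tail_integral_nn[OF \<nu>, of "r m"] r by simp
  have tail: "ennreal (tail_integral \<nu> (r m)) = (\<integral>\<^sup>+s. ?\<phi> s \<partial>lebesgue)"
    using tail_integral_nn[OF \<nu>, of "r m"] r by simp
  have "weighted_area \<nu> (annulus m) = (\<integral>\<^sup>+z. ?\<phi> (norm z) \<partial>area_measure)"
    unfolding weighted_area_def
  proof (intro nn_integral_cong)
    fix z assume "z \<in> space area_measure"
    then have "norm z < 1" "\<nu> z = \<nu> (of_real (norm z))" using radial_weight_norm[OF \<nu>, of z] by simp_all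
    then show "ennreal (\<nu> z) * indicator (annulus m) z = ?\<phi> (norm z)"
      by (simp add: indicator_def annulus_def r_def)
  qed
  also have "\<dots> = (\<integral>\<^sup>+s. ?\<phi> s * ennreal (2 * s) * indicator {0..<1} s \<partial>lebesgue)"
    by (rule nn_integral_area_radial[OF meas])
  finally have eq: "weighted_area \<nu> (annulus m) = (\<integral>\<^sup>+s. ?\<phi> s * ennreal (2 * s) * indicator {0..<1} s \<partial>lebesgue)" .
  have "weighted_area \<nu> (annulus m) \<le> (\<integral>\<^sup>+s. ?\<phi> s * ennreal 2 \<partial>lebesgue)"
    unfolding eq
  proof (intro nn_integral_mono)
    fix s :: real
    show "?\<phi> s * ennreal (2 * s) * indicator {0..<1} s \<le> ?\<phi> s * ennreal 2"
      by (cases "s \<in> {0..<1}") (auto intro!: mult_left_mono ennreal_leI simp del: ennreal_numeral)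
  qed
  also have "\<dots> = ennreal (tail_integral \<nu> (r m)) * ennreal 2"
    unfolding tail by (rule nn_integral_multc[OF meas])
  also have "\<dots> = ennreal (2 * tail_integral \<nu> (r m))"
    using tail_integral_nn(3)[OF \<nu>, of "r m"] r by (subst ennreal_mult[symmetric]) (auto simp: mult.commute)
  finally show "weighted_area \<nu> (annulus m) \<le> ennreal (2 * tail_integral \<nu> (r m))" .
  show "ennreal (tail_integral \<nu> (r m)) \<le> weighted_area \<nu> (annulus m)"
    unfolding eq tail
  proof (intro nn_integral_mono)
    fix s :: real
    show "?\<phi> s \<le> ?\<phi> s * ennreal (2 * s) * indicator {0..<1} s"
    proof (cases "s \<in> {r m..<1}")
      case True
      then have "?\<phi> s * 1 \<le> ?\<phi> s * ennreal (2 * s)" using r by (intro mult_left_mono) auto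
      then show ?thesis using True r by simp
    qed simp
  qed
qed

lemma D_hat_doubling:
  assumes "\<nu> \<in> D_hat"
  obtains D where "1 \<le> D" "\<And>m. weighted_area \<nu> (annulus m) \<le> ennreal D * weighted_area \<nu> (annulus (Suc m))"
proof -
  from assms obtain C where \<nu>: "radial_weight \<nu>" and C: "1 < C"
    "\<And>r. 0 \<le> r \<Longrightarrow> r < 1 \<Longrightarrow> tail_integral \<nu> r \<le> C * tail_integral \<nu> ((1 + r) / 2)"
    by (auto simp: D_hat_def)
  show thesis
  proof (rule that[of "2 * C"])
    show "1 \<le> 2 * C" using C by simp
    fix m
    define r where "r = (\<lambda>m. 1 - (1/2::real) ^ Suc m)"
    have r: "1 / 2 \<le> r m" "r m < 1" 
      using power_decreasing[of 1 "Suc m" "1/2::real"] by (auto simp: r_def)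
    have rS: "(1 + r m) / 2 = r (Suc m)" by (simp add: r_def field_simps)
    have "weighted_area \<nu> (annulus m) \<le> ennreal (2 * tail_integral \<nu> (r m))"
      unfolding r_def by (rule annulus_tail_integral(1)[OF \<nu>])
    also have "\<dots> \<le> ennreal (2 * C * tail_integral \<nu> (r (Suc m)))"
      using C(2)[of "r m"] r by (intro ennreal_leI) (simp add: rS)
    also have "\<dots> = ennreal (2 * C) * ennreal (tail_integral \<nu> (r (Suc m)))"
      using C(1) tail_integral_nn(3)[OF \<nu>, of "r (Suc m)"] r rS by (intro ennreal_mult) auto
    also have "\<dots> \<le> ennreal (2 * C) * weighted_area \<nu> (annulus (Suc m))"
      unfolding r_def by (intro mult_left_mono annulus_tail_integral(2)[OF \<nu>]) simp
    finally show "weighted_area \<nu> (annulus m) \<le> ennreal (2 * C) * weighted_area \<nu> (annulus (Suc m))" .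
  qed
qed

section \<open>The weight condition on dyadic blocks\<close>
lemma mem_carleson_square_of_close:
  assumes a: "a = of_real r * cis (2 * pi * s)" "0 < r" "r < 1"
    and z: "norm z < 1" "r \<le> norm z" and close: "2 * pi * \<bar>s - angle z - of_int k\<bar> \<le> (1 - r) / 2"
  shows "z \<in> carleson_square a"
proof -
  let ?x = "2 * pi * (s - angle z - of_int k)"
  have na: "norm a = r" using a by (simp add: norm_mult)
  have "\<bar>?x\<bar> \<le> 1 / 2" using close a(2) by (simp add: abs_mult)
  then have x: "- pi < ?x" "?x \<le> pi" using pi_gt3 by linarith+
  have "2 * pi * s + - (2 * pi * angle z) = ?x + 2 * pi * of_int k" by (simp add: algebra_simps)
  then have "cis (2 * pi * s) * cis (- (2 * pi * angle z)) = cis ?x * cis (2 * pi * of_int k)"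
    by (simp only: cis_mult)
  moreover have "cis (2 * pi * of_int k) = 1" by (rule cis_multiple_2pi) simp
  ultimately have "a * cis (- (2 * pi * angle z)) = of_real r * cis ?x"
    by (simp only: a(1) mult.assoc mult_1_right)
  then have "sgn (a * cis (- (2 * pi * angle z))) = cis ?x"
    using a(2) by (simp add: sgn_mult sgn_of_real)
  then have "Arg (a * cis (- (2 * pi * angle z))) = ?x" by (rule cis_Arg_unique[OF _ x])
  then have "cis (2 * pi * angle z) \<in> carleson_arc a"
    unfolding carleson_arc_def na using close by (intro CollectI exI[of _ "2 * pi * angle z"]) (simp add: abs_mult)
  then have "z \<in> {of_real r * cis t | r t. norm a \<le> r \<and> cis t \<in> carleson_arc a}"
    using angle_polar[of z] z(2) na by blast
  with z(1) show ?thesis by (simp add: carleson_square_def)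
qed

lemma carleson_square_close:
  assumes z: "z \<in> carleson_square a" and a: "a \<noteq> 0"
  obtains k :: int where "norm a \<le> norm z" "norm z < 1" "2 * pi * \<bar>angle a - angle z - of_int k\<bar> \<le> (1 - norm a) / 2"
proof -
  have nz: "norm z < 1" using z by (simp add: carleson_square_def)
  obtain r t where rt: "z = of_real r * cis t" "norm a \<le> r" "cis t \<in> carleson_arc a"
    using z by (auto simp: carleson_square_def)
  then obtain u where u: "cis t = cis u" "\<bar>Arg (a * cis (- u))\<bar> \<le> (1 - norm a) / 2"
    by (auto simp: carleson_arc_def)
  have r: "0 < r" using rt(2) a by (metis less_le_trans zero_less_norm_iff)
  have nr: "norm z = r" using rt(1) r by (simp add: norm_mult)
  have "of_real r * cis (2 * pi * angle z) = of_real r * cis u"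
    using angle_polar[of z] nr rt(1) u(1) by metis
  then have cz: "cis (2 * pi * angle z) = cis u" using r by simp
  let ?\<phi> = "Arg (a * cis (- u))"
  have "of_real (norm a) * cis (2 * pi * angle a) * cis (- u) = of_real (norm a) * cis ?\<phi>"
    using angle_polar[of a] by (metis mult.right_neutral norm_cis norm_mult rcis_cmod_Arg rcis_def)
  then have "cis (2 * pi * angle a) * cis (- u) = cis ?\<phi>"
    using a by (simp add: mult.assoc)
  then have "cis (2 * pi * angle a) * cis (- (2 * pi * angle z)) = cis ?\<phi>"
    using cz by (simp add: cis_cnj[symmetric])
  then have "cis (2 * pi * angle a - 2 * pi * angle z) = cis ?\<phi>" by (simp add: cis_mult)
  then obtain n :: int where "2 * pi * angle a - 2 * pi * angle z = ?\<phi> + 2 * pi * of_int n"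
    using sin_cos_eq_iff[of "2 * pi * angle a - 2 * pi * angle z" ?\<phi>] by (auto simp: complex_eq_iff)
  then have "2 * pi * (angle a - angle z - of_int n) = ?\<phi>" by (simp add: algebra_simps)
  then have "2 * pi * \<bar>angle a - angle z - of_int n\<bar> = \<bar>?\<phi>\<bar>" by (metis abs_mult abs_of_nonneg pi_ge_zero mult_nonneg_nonneg zero_le_numeral)
  then show thesis using that[of n] nz nr rt(2) u(2) by simp
qed

text \<open>A Carleson square of height \<open>h\<close> has angular half-width \<open>h/2\<close>, whereas a block of generation \<open>m\<close> has
half-width up to \<open>4\<pi> 2\<^bsup>-m\<^esup> \<le> 16 \<cdot> 2\<^bsup>-m\<^esup>\<close> as seen from the edge of its cell. So \<open>h = 32 \<cdot> 2\<^bsup>-m\<^esup>\<close> is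
enough, which is the height of the squares of generation \<open>m - 6\<close>, and \<open>h < 1\<close> needs \<open>m \<ge> 6\<close>.\<close>
lemma dyadic_block_carleson_square:
  assumes m: "6 \<le> m" and i: "0 \<le> i" "i < 2 ^ m"
  obtains a j where "a \<in> unit_disc - {0}" "dyadic_block m i \<subseteq> carleson_square a"
    "carleson_square a \<subseteq> (\<Union>l\<in>{l\<in>{0..<2 ^ (m - 6)}. adjacent (m - 6) l j}. dyadic_square (m - 6) l)"
proof -
  define r where "r = 1 - (1/2::real) ^ (m - 5)"
  define a where "a = of_real r * cis (2 * pi * (of_int i / 2 ^ m))"
  obtain n where n: "m = n + 6" using m by (metis le_Suc_ex add.commute)
  have pw: "(1/2::real) ^ (m - 5) = 32 / 2 ^ m" "(1/2::real) ^ Suc (m - 6) = (1/2) ^ (m - 5)"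
    by (simp_all add: n power_add power_one_over)
  have "(1/2::real) ^ (m - 5) \<le> (1/2) ^ 1" using m by (intro power_decreasing) auto
  then have r: "1 / 2 \<le> r" "r < 1" by (auto simp: r_def)
  have na: "norm a = r" using r by (simp add: a_def norm_mult)
  have aa: "angle a = of_int i / 2 ^ m"
  proof (rule angle_unique[of _ r])
    have "real_of_int i < real_of_int (2 ^ m)" using i(2) by (rule of_int_less_iff[THEN iffD2])
    then show "of_int i / 2 ^ m < (1::real)" by simp
  qed (use r i in \<open>auto simp: a_def\<close>)
  show thesis
  proof
    show "a \<in> unit_disc - {0}" using na r by auto
    show "dyadic_block m i \<subseteq> carleson_square a"
    proof
      fix z assume z: "z \<in> dyadic_block m i"
      then have z': "norm z < 1" "1 - norm z \<le> (1 / 2) ^ m" "adjacent m i (cell m z)"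
        by (auto simp: dyadic_block_def)
      then obtain k where k: "\<bar>i - cell m z - k * 2 ^ m\<bar> \<le> 1" by (auto simp: adjacent_def)
      have "\<bar>real_of_int (i - cell m z - k * 2 ^ m)\<bar> \<le> 1" using k by linarith
      then have k': "\<bar>of_int i - of_int (cell m z) - of_int k * 2 ^ m\<bar> \<le> (1::real)" by simp
      have c: "of_int (cell m z) \<le> 2 ^ m * angle z" "2 ^ m * angle z < of_int (cell m z) + 1"
        by (auto simp: cell_def)
      have "\<bar>of_int i - 2 ^ m * angle z - of_int k * 2 ^ m\<bar> \<le> 2" using k' c by linarith
      moreover have "of_int i - 2 ^ m * angle z - of_int k * 2 ^ m = 2 ^ m * (of_int i / 2 ^ m - angle z - of_int k)"
        by (simp add: field_simps)
      ultimately have "2 ^ m * \<bar>of_int i / 2 ^ m - angle z - of_int k\<bar> \<le> 2" by (simp add: abs_mult)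
      then have "\<bar>of_int i / 2 ^ m - angle z - of_int k\<bar> \<le> 2 / 2 ^ m" by (simp add: pos_le_divide_eq mult.commute)
      then have "2 * pi * \<bar>of_int i / 2 ^ m - angle z - of_int k\<bar> \<le> 2 * 4 * (2 / 2 ^ m)"
        using pi_less_4 by (intro mult_mono) auto
      also have "\<dots> = (1 - r) / 2" by (simp add: r_def pw)
      finally have close: "2 * pi * \<bar>of_int i / 2 ^ m - angle z - of_int k\<bar> \<le> (1 - r) / 2" .
      have "(1/2::real) ^ m \<le> (1/2) ^ (m - 5)" by (intro power_decreasing) auto
      then have "r \<le> norm z" using z'(2) unfolding r_def by linarith
      then show "z \<in> carleson_square a"
        using r z'(1) close by (intro mem_carleson_square_of_close[OF a_def]) auto
    qed
    show "carleson_square a \<subseteq> (\<Union>l\<in>{l\<in>{0..<2 ^ (m - 6)}. adjacent (m - 6) l (cell (m - 6) a)}. dyadic_square (m - 6) l)"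
    proof
      fix z assume z: "z \<in> carleson_square a"
      have "a \<noteq> 0" using na r by auto
      with z obtain k :: int where k: "norm a \<le> norm z" "norm z < 1"
          "2 * pi * \<bar>angle a - angle z - of_int k\<bar> \<le> (1 - norm a) / 2"
        by (rule carleson_square_close)
      have ann: "z \<in> annulus (m - 6)"
      proof -
        have "1 - norm z \<le> (1/2) ^ Suc (m - 6)" using k(1) unfolding pw(2) na r_def by linarith
        then show ?thesis using k(2) by (simp add: annulus_def del: power_Suc)
      qed
      have "1 * \<bar>angle a - angle z - of_int k\<bar> \<le> 2 * pi * \<bar>angle a - angle z - of_int k\<bar>"
        using pi_gt3 by (intro mult_right_mono) auto
      also have "\<dots> \<le> (1/2) ^ (m - 5) / 2" using k(3) by (simp add: na r_def)
      also have "\<dots> < (1/2) ^ (m - 6)" by (simp add: n power_add)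
      finally have "\<bar>angle z - angle a - of_int (- k)\<bar> < (1/2) ^ (m - 6)" by simp
      then have "adjacent (m - 6) (cell (m - 6) z) (cell (m - 6) a)" by (rule adjacent_of_close)
      then show "z \<in> (\<Union>l\<in>{l\<in>{0..<2 ^ (m - 6)}. adjacent (m - 6) l (cell (m - 6) a)}. dyadic_square (m - 6) l)"
        using ann cell_range[of "m - 6" z] by (auto simp: dyadic_square_def)
    qed
  qed
qed

text \<open>For \<open>|a| = 1/2\<close> the angular half-width is \<open>1/4\<close>, and \<open>32\<close> cells have angular width \<open>2\<pi>/32 < 1/4\<close>.\<close>
lemma annulus_cover:
  obtains a where "\<And>l::int. a l \<in> unit_disc - {0}"
    "\<And>z. z \<in> annulus 0 \<Longrightarrow> z \<in> carleson_square (a (cell 5 z))"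
proof (rule that[of "\<lambda>l. of_real (1/2) * cis (2 * pi * (of_int l / 32))"])
  show "of_real (1/2) * cis (2 * pi * (of_int l / 32)) \<in> unit_disc - {0}" for l :: int
    by (auto simp: norm_mult)
  fix z assume z: "z \<in> annulus 0"
  have c: "of_int (cell 5 z) \<le> 2 ^ 5 * angle z" "2 ^ 5 * angle z < of_int (cell 5 z) + 1"
    by (auto simp: cell_def)
  then have "\<bar>of_int (cell 5 z) / 32 - angle z - of_int 0\<bar> \<le> 1 / 32" by simp
  then have "2 * pi * \<bar>of_int (cell 5 z) / 32 - angle z - of_int 0\<bar> \<le> 2 * 4 * (1 / 32)"
    using pi_less_4 by (intro mult_mono) auto
  then show "z \<in> carleson_square (of_real (1/2) * cis (2 * pi * (of_int (cell 5 z) / 32)))"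
    using z annulus_norm[OF z] by (intro mem_carleson_square_of_close[OF refl, of "1/2" z _ 0]) (auto simp: annulus_def)
qed

lemma ennreal_rpow_mono: "x \<le> y \<Longrightarrow> 0 < s \<Longrightarrow> ennreal_rpow x s \<le> ennreal_rpow y s"
  unfolding ennreal_rpow_def
  by (auto simp: top_unique less_top intro!: ennreal_leI powr_mono2 enn2real_mono)

lemma ennreal_rpow_ennreal: "0 \<le> x \<Longrightarrow> ennreal_rpow (ennreal x) s = ennreal (x powr s)"
  by (simp add: ennreal_rpow_def)

text \<open>The integrand takes the value \<open>\<infinity>\<close> where \<open>\<omega> = 0 < \<nu>\<close>; on \<open>|z| \<ge> 1/2\<close> this will turn out to be a null
set, and the real function \<open>dual_weight\<close> takes over.\<close>
definition dual_mass :: "real \<Rightarrow> (complex \<Rightarrow> real) \<Rightarrow> (complex \<Rightarrow> real) \<Rightarrow> complex set \<Rightarrow> ennreal" where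
  "dual_mass q \<nu> \<omega> E = (\<integral>\<^sup>+z. dual_integrand q \<nu> \<omega> z * indicator E z \<partial>area_measure)"

lemma dual_mass_mono: "E \<subseteq> F \<Longrightarrow> dual_mass q \<nu> \<omega> E \<le> dual_mass q \<nu> \<omega> F"
  unfolding dual_mass_def by (intro nn_integral_mono mult_left_mono) (auto simp: indicator_def)

lemma measurable_dual_integrand:
  assumes [measurable]: "\<nu> \<in> borel_measurable area_measure" "\<omega> \<in> borel_measurable area_measure"
  shows "dual_integrand q \<nu> \<omega> \<in> borel_measurable area_measure"
  unfolding dual_integrand_def by measurable

text \<open>The number \<open>D\<close> is a doubling constant of \<open>\<nu>\<close> for annuli, as provided by \<open>D_hat_doubling\<close>.\<close>
locale bekolle_weight =
  fixes q :: real and \<nu> \<omega> :: "complex \<Rightarrow> real" and D :: real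
  assumes q: "1 < q" and \<nu>: "radial_weight \<nu>" and \<omega>: "weight \<omega>" and B: "quotient_in_B q \<nu> \<omega>"
    and D: "1 \<le> D" "\<And>m. weighted_area \<nu> (annulus m) \<le> ennreal D * weighted_area \<nu> (annulus (Suc m))"
begin

lemma \<nu>w: "weight \<nu>" by (rule radial_weight_weight[OF \<nu>])

lemma measurable_weights [measurable]:
  "\<nu> \<in> borel_measurable area_measure" "\<omega> \<in> borel_measurable area_measure"
  using weight_measurable \<nu>w \<omega> by auto

text \<open>The \<open>\<omega>\<close>-mass of a Carleson square is positive, so an infinite dual mass would violate the \<open>B\<^sub>q\<close>
condition.\<close>
lemma dual_mass_carleson_finite:
  assumes "a \<in> unit_disc - {0}" shows "dual_mass q \<nu> \<omega> (carleson_square a) < \<infinity>"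
proof (rule ccontr)
  assume "\<not> ?thesis"
  then have inf: "dual_mass q \<nu> \<omega> (carleson_square a) = \<infinity>"
    by (metis infinity_ennreal_def top.not_eq_extremum)
  obtain C where C: "ennreal_rpow (weighted_area \<omega> (carleson_square a)) (1 / q) *
        ennreal_rpow (dual_mass q \<nu> \<omega> (carleson_square a)) ((q - 1) / q)
        \<le> ennreal C * weighted_area \<nu> (carleson_square a)"
    using B assms unfolding quotient_in_B_def dual_mass_def by blast
  have fin: "weighted_area \<nu> (carleson_square a) < \<infinity>" "weighted_area \<omega> (carleson_square a) < \<infinity>"
    using weighted_area_finite \<nu>w \<omega> by auto
  have "0 < weighted_area \<omega> (carleson_square a)" using \<omega> assms by (simp add: weight_def)
  with fin(2) obtain x where x: "weighted_area \<omega> (carleson_square a) = ennreal x" "0 < x"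
    by (cases "weighted_area \<omega> (carleson_square a)") auto
  then have "ennreal_rpow (weighted_area \<omega> (carleson_square a)) (1 / q) = ennreal (x powr (1 / q))"
    by (simp add: ennreal_rpow_ennreal)
  then have "ennreal (x powr (1 / q)) * \<infinity> \<le> ennreal C * weighted_area \<nu> (carleson_square a)"
    using C inf by (simp add: ennreal_rpow_def)
  moreover have "ennreal (x powr (1 / q)) * \<infinity> = \<infinity>" using x(2) by (simp add: ennreal_mult_top)
  moreover have "ennreal C * weighted_area \<nu> (carleson_square a) < \<infinity>"
    using fin(1) by (simp add: ennreal_mult_less_top)
  ultimately show False by (simp add: top_unique)
qed

text \<open>Finitely many Carleson squares cover the annulus. They are cut into disjoint measurable cells first,
which spares the measurability of Carleson squares.\<close>
lemma dual_mass_annulus_finite: "dual_mass q \<nu> \<omega> (annulus 0) < \<infinity>"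
proof -
  obtain a where a: "\<And>l::int. a l \<in> unit_disc - {0}"
    "\<And>z. z \<in> annulus 0 \<Longrightarrow> z \<in> carleson_square (a (cell 5 z))" by (rule annulus_cover) blast
  have [measurable]: "dual_integrand q \<nu> \<omega> \<in> borel_measurable area_measure"
    by (intro measurable_dual_integrand measurable_weights)
  let ?A = "\<lambda>l. {z \<in> annulus 0. cell 5 z = l}"
  have A [measurable]: "?A l \<in> sets area_measure" for l
  proof -
    have "?A l = annulus 0 \<inter> {z. cell 5 z = l}" by auto
    moreover have "annulus 0 \<inter> {z. cell 5 z = l} \<in> sets borel"
      by (intro sets.Int measurable_cell annulus_measurable)
    moreover have "?A l \<subseteq> unit_disc" using annulus_subset[of 0] by blast
    ultimately show ?thesis by (intro sets_area_measureI) simp_all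
  qed
  have "dual_mass q \<nu> \<omega> (annulus 0)
      = (\<integral>\<^sup>+z. (\<Sum>l\<in>{0..<2^5}. dual_integrand q \<nu> \<omega> z * indicator (?A l) z) \<partial>area_measure)"
    unfolding dual_mass_def
  proof (intro nn_integral_cong)
    fix z
    have "(\<Sum>l\<in>{0..<2^5}. dual_integrand q \<nu> \<omega> z * indicator (?A l) z)
        = (\<Sum>l\<in>{0..<2^5}. if l = cell 5 z then dual_integrand q \<nu> \<omega> z * indicator (annulus 0) z else 0)"
      by (intro sum.cong refl) (auto simp: indicator_def)
    also have "\<dots> = dual_integrand q \<nu> \<omega> z * indicator (annulus 0) z"
      using cell_range[of 5 z] by (subst sum.delta) auto
    finally show "dual_integrand q \<nu> \<omega> z * indicator (annulus 0) z
       = (\<Sum>l\<in>{0..<2^5}. dual_integrand q \<nu> \<omega> z * indicator (?A l) z)" by simp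
  qed
  also have "\<dots> = (\<Sum>l\<in>{0..<2^5}. dual_mass q \<nu> \<omega> (?A l))"
    unfolding dual_mass_def by (intro nn_integral_sum) measurable
  also have "\<dots> \<le> (\<Sum>l\<in>{0..<2^5}. dual_mass q \<nu> \<omega> (carleson_square (a l)))"
    using a(2) by (intro sum_mono dual_mass_mono) auto
  also have "\<dots> < \<infinity>"
    using dual_mass_carleson_finite[OF a(1)] by (simp add: ennreal_sum_less_top)
  finally show ?thesis .
qed

lemma dual_integrand_annulus:
  "AE z in area_measure. z \<in> annulus 0 \<longrightarrow> \<omega> z = 0 \<longrightarrow> \<nu> z = 0"
  "E \<subseteq> annulus 0 \<Longrightarrow> (\<integral>\<^sup>+z. ennreal (dual_weight q \<nu> \<omega> z) * indicator E z \<partial>area_measure) = dual_mass q \<nu> \<omega> E"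
proof -
  have [measurable]: "dual_integrand q \<nu> \<omega> \<in> borel_measurable area_measure"
    by (intro measurable_dual_integrand measurable_weights)
  have "AE z in area_measure. dual_integrand q \<nu> \<omega> z * indicator (annulus 0) z \<noteq> \<infinity>"
    using dual_mass_annulus_finite by (intro nn_integral_PInf_AE) (auto simp: dual_mass_def less_top)
  then show ae: "AE z in area_measure. z \<in> annulus 0 \<longrightarrow> \<omega> z = 0 \<longrightarrow> \<nu> z = 0"
    by eventually_elim (auto simp: dual_integrand_def split: if_splits)
  show "(\<integral>\<^sup>+z. ennreal (dual_weight q \<nu> \<omega> z) * indicator E z \<partial>area_measure) = dual_mass q \<nu> \<omega> E" if "E \<subseteq> annulus 0"
    unfolding dual_mass_def
  proof (rule nn_integral_cong_AE)
    show "AE z in area_measure. ennreal (dual_weight q \<nu> \<omega> z) * indicator E z = dual_integrand q \<nu> \<omega> z * indicator E z"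
      using ae by eventually_elim (use that in \<open>auto simp: dual_integrand_def dual_weight_def indicator_def\<close>)
  qed
qed

lemma annulus_doubling_iter:
  "weighted_area \<nu> (annulus m) \<le> ennreal (D ^ k) * weighted_area \<nu> (annulus (m + k))"
proof (induction k)
  case (Suc k)
  have "weighted_area \<nu> (annulus m) \<le> ennreal (D ^ k) * weighted_area \<nu> (annulus (m + k))" by (rule Suc)
  also have "\<dots> \<le> ennreal (D ^ k) * (ennreal D * weighted_area \<nu> (annulus (Suc (m + k))))"
    by (intro mult_left_mono D(2)) simp
  also have "\<dots> = ennreal (D ^ Suc k) * weighted_area \<nu> (annulus (m + Suc k))"
    using D(1) by (simp add: mult.assoc[symmetric] ennreal_mult[symmetric] mult.commute)
  finally show ?case .
qed simp

text \<open>Masses as real numbers: \<open>V\<close>, \<open>W\<close>, \<open>S\<close> are the masses of dyadic squares under \<open>\<nu>\<close>, \<open>\<omega>\<close> and the dual weight,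
\<open>Wb\<close> is the \<open>\<omega>\<close>-mass of a dyadic block.\<close>
definition V :: "nat \<Rightarrow> int \<Rightarrow> real" where "V m i = enn2real (weighted_area \<nu> (dyadic_square m i))"
definition W :: "nat \<Rightarrow> int \<Rightarrow> real" where "W m i = enn2real (weighted_area \<omega> (dyadic_square m i))"
definition Wb :: "nat \<Rightarrow> int \<Rightarrow> real" where "Wb m i = enn2real (weighted_area \<omega> (dyadic_block m i))"
definition S :: "nat \<Rightarrow> int \<Rightarrow> real" where "S m i = enn2real (dual_mass q \<nu> \<omega> (dyadic_square m i))"

lemma V: "ennreal (V m i) = weighted_area \<nu> (dyadic_square m i)"
  and W: "ennreal (W m i) = weighted_area \<omega> (dyadic_square m i)"
  and Wb: "ennreal (Wb m i) = weighted_area \<omega> (dyadic_block m i)"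
  unfolding V_def W_def Wb_def
  using weighted_area_finite[OF \<nu>w, of "dyadic_square m i"] weighted_area_finite[OF \<omega>, of "dyadic_square m i"]
    weighted_area_finite[OF \<omega>, of "dyadic_block m i"]
  by auto

lemma square_annulus: "dyadic_square m i \<subseteq> annulus 0"
  using dyadic_square_subset annulus_antimono[of 0 m] by blast

lemma S: "ennreal (S m i) = dual_mass q \<nu> \<omega> (dyadic_square m i)"
proof -
  have "dual_mass q \<nu> \<omega> (dyadic_square m i) < \<infinity>"
    using dual_mass_mono[OF square_annulus] dual_mass_annulus_finite by (rule le_less_trans)
  then show ?thesis by (auto simp: S_def)
qed

lemma V_nonneg: "0 \<le> V m i" and W_nonneg: "0 \<le> W m i" and Wb_nonneg: "0 \<le> Wb m i" and S_nonneg: "0 \<le> S m i"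
  by (auto simp: V_def W_def Wb_def S_def)

lemma V_annulus:
  assumes "0 \<le> i" "i < 2 ^ m"
  shows "weighted_area \<nu> (annulus m) = ennreal (2 ^ m * V m i)"
  using weighted_area_dyadic_square[OF \<nu> assms] V[of m i] V_nonneg[of m i]
  by (simp add: ennreal_mult ennreal_power[symmetric])

lemma V_pos:
  assumes "0 \<le> i" "i < 2 ^ m" shows "0 < V m i"
  using annulus_pos[OF \<nu>w, of m] V_annulus[OF assms] by (simp add: zero_less_mult_iff)

text \<open>Doubling \<open>k\<close> times costs \<open>D\<^sup>k\<close>, and each step also halves the angular width.\<close>
lemma V_compare:
  assumes "0 \<le> i" "i < 2 ^ m" "0 \<le> j" "j < 2 ^ (m + k)"
  shows "V m i \<le> (2 * D) ^ k * V (m + k) j"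
proof -
  have "ennreal (2 ^ m * V m i) \<le> ennreal (D ^ k) * ennreal (2 ^ (m + k) * V (m + k) j)"
    using annulus_doubling_iter[of m k] V_annulus assms by simp
  also have "\<dots> = ennreal (D ^ k * (2 ^ (m + k) * V (m + k) j))"
    using D(1) V_nonneg by (intro ennreal_mult[symmetric]) auto
  finally have "2 ^ m * V m i \<le> D ^ k * (2 ^ (m + k) * V (m + k) j)"
    using D(1) V_nonneg by (subst (asm) ennreal_le_iff) auto
  also have "\<dots> = 2 ^ m * ((2 * D) ^ k * V (m + k) j)"
    by (simp add: power_add power_mult_distrib)
  finally show ?thesis by simp
qed

text \<open>The \<open>B\<^sub>q\<close> condition for the Carleson square around a block. Its \<open>\<nu>\<close>-mass is at most that of three squares
of generation \<open>m - 6\<close>, which is comparable with \<open>V m i\<close> by doubling.\<close>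
lemma block_bound_fine:
  obtains C where "0 < C" "\<And>m i. 6 \<le> m \<Longrightarrow> 0 \<le> i \<Longrightarrow> i < 2 ^ m \<Longrightarrow> Wb m i * S m i powr (q - 1) \<le> C * V m i powr q"
proof -
  obtain C where C: "0 < C" "\<And>a. a \<in> unit_disc - {0} \<Longrightarrow>
        ennreal_rpow (weighted_area \<omega> (carleson_square a)) (1 / q) *
        ennreal_rpow (dual_mass q \<nu> \<omega> (carleson_square a)) ((q - 1) / q)
        \<le> ennreal C * weighted_area \<nu> (carleson_square a)"
    using B unfolding quotient_in_B_def dual_mass_def by blast
  define E where "E = C * (3 * (2 * D) ^ 6)"
  have E: "0 < E" using C D by (simp add: E_def)
  show thesis
  proof (rule that[of "E powr q"])
    show "0 < E powr q" using E by simp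
    fix m :: nat and i :: int assume m: "6 \<le> m" and i: "0 \<le> i" "i < 2 ^ m"
    define n where "n = m - 6"
    have mn: "m = n + 6" using m by (simp add: n_def)
    obtain a j where a: "a \<in> unit_disc - {0}" "dyadic_block m i \<subseteq> carleson_square a"
      "carleson_square a \<subseteq> (\<Union>l\<in>{l\<in>{0..<2 ^ n}. adjacent n l j}. dyadic_square n l)"
      by (rule dyadic_block_carleson_square[OF m i]) (auto simp: n_def)
    let ?L = "{l\<in>{0..<2 ^ n}. adjacent n l j}"
    have fL: "finite ?L" by (rule finite_subset[of _ "{0..<2 ^ n}"]) auto
    have "weighted_area \<nu> (carleson_square a) \<le> (\<Sum>l\<in>?L. weighted_area \<nu> (dyadic_square n l))"
      by (rule weighted_area_Union_le[OF fL _ _ a(3)]) auto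
    also have "\<dots> = (\<Sum>l\<in>?L. ennreal (V n l))" by (simp add: V)
    also have "\<dots> = ennreal (\<Sum>l\<in>?L. V n l)" by (rule sum_ennreal) (simp add: V_nonneg)
    also have "\<dots> \<le> ennreal (3 * ((2 * D) ^ 6 * V m i))"
    proof (rule ennreal_leI)
      have "(\<Sum>l\<in>?L. V n l) \<le> (\<Sum>l\<in>?L. (2 * D) ^ 6 * V m i)"
        using i unfolding mn by (intro sum_mono V_compare) auto
      also have "\<dots> = real (card ?L) * ((2 * D) ^ 6 * V m i)" by simp
      also have "\<dots> \<le> 3 * ((2 * D) ^ 6 * V m i)"
        using card_adjacent[of n j] D(1) V_nonneg by (intro mult_right_mono mult_nonneg_nonneg) auto
      finally show "(\<Sum>l\<in>?L. V n l) \<le> 3 * ((2 * D) ^ 6 * V m i)" .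
    qed
    finally have \<nu>S: "weighted_area \<nu> (carleson_square a) \<le> ennreal (3 * ((2 * D) ^ 6 * V m i))" .
    have "ennreal (Wb m i powr (1 / q) * S m i powr ((q - 1) / q))
        = ennreal_rpow (weighted_area \<omega> (dyadic_block m i)) (1 / q) * ennreal_rpow (dual_mass q \<nu> \<omega> (dyadic_square m i)) ((q - 1) / q)"
      by (simp add: Wb[symmetric] S[symmetric] ennreal_rpow_ennreal Wb_nonneg S_nonneg ennreal_mult)
    also have "\<dots> \<le> ennreal_rpow (weighted_area \<omega> (carleson_square a)) (1 / q) * ennreal_rpow (dual_mass q \<nu> \<omega> (carleson_square a)) ((q - 1) / q)"
      using q a(2) dyadic_square_subset_block[of m i] by (intro mult_mono ennreal_rpow_mono weighted_area_mono dual_mass_mono) auto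
    also have "\<dots> \<le> ennreal C * weighted_area \<nu> (carleson_square a)" by (rule C(2)[OF a(1)])
    also have "\<dots> \<le> ennreal C * ennreal (3 * ((2 * D) ^ 6 * V m i))" by (intro mult_left_mono \<nu>S) simp
    also have "\<dots> = ennreal (E * V m i)"
      using C(1) D(1) V_nonneg by (simp add: E_def ennreal_mult[symmetric] mult_ac)
    finally have le: "Wb m i powr (1 / q) * S m i powr ((q - 1) / q) \<le> E * V m i"
      using E V_nonneg by (subst (asm) ennreal_le_iff) auto
    have "(Wb m i powr (1 / q) * S m i powr ((q - 1) / q)) powr q \<le> (E * V m i) powr q"
      using le q by (intro powr_mono2) auto
    then show "Wb m i * S m i powr (q - 1) \<le> E powr q * V m i powr q"
      using q E V_nonneg[of m i] Wb_nonneg[of m i] by (simp add: powr_mult powr_powr)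
  qed
qed

text \<open>In the finitely many coarse generations all masses on the left are bounded and \<open>V m i\<close> is bounded below.\<close>
lemma block_bound:
  obtains C where "0 < C" "\<And>m i. 0 \<le> i \<Longrightarrow> i < 2 ^ m \<Longrightarrow> Wb m i * S m i powr (q - 1) \<le> C * V m i powr q"
proof -
  obtain C where C: "0 < C" "\<And>m i. 6 \<le> m \<Longrightarrow> 0 \<le> i \<Longrightarrow> i < 2 ^ m \<Longrightarrow> Wb m i * S m i powr (q - 1) \<le> C * V m i powr q"
    by (rule block_bound_fine) blast
  define w where "w = enn2real (weighted_area \<omega> unit_disc)"
  have w: "Wb m i \<le> w" for m i
    unfolding Wb_def w_def using weighted_area_finite[OF \<omega>, of unit_disc] dyadic_block_subset
    by (intro enn2real_mono weighted_area_mono) auto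
  define s where "s = enn2real (dual_mass q \<nu> \<omega> (annulus 0))"
  have s: "S m i \<le> s" for m i
    unfolding S_def s_def using dual_mass_annulus_finite square_annulus
    by (intro enn2real_mono dual_mass_mono) auto
  define v where "v = V 6 0 / (2 * D) ^ 6"
  have v: "0 < v" using V_pos[of 0 6] D(1) by (simp add: v_def)
  have v_le: "v \<le> V m i" if "m < 6" "0 \<le> i" "i < 2 ^ m" for m i
  proof -
    have "2 ^ 6 * V 6 0 \<le> 2 ^ m * V m i"
    proof -
      have "ennreal (2 ^ 6 * V 6 0) \<le> ennreal (2 ^ m * V m i)"
        using weighted_area_mono[OF annulus_antimono[of m 6], of \<nu>] that V_annulus[of i m] V_annulus[of 0 6] by simp
      then show ?thesis using V_nonneg by (subst (asm) ennreal_le_iff) auto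
    qed
    also have "\<dots> \<le> 2 ^ 6 * V m i"
      using that V_nonneg by (intro mult_right_mono power_increasing) auto
    finally have "V 6 0 \<le> V m i" by simp
    moreover have "v \<le> V 6 0"
      using D(1) V_nonneg[of 6 0] one_le_power[of "2 * D" 6] by (simp add: v_def divide_le_eq mult_left_mono[of 1 _ "V 6 0", simplified])
    ultimately show ?thesis by linarith
  qed
  have w0: "0 \<le> w" and s0: "0 \<le> s" by (auto simp: w_def s_def)
  let ?C = "C + w * s powr (q - 1) / v powr q"
  show thesis
  proof (rule that[of ?C])
    show "0 < ?C" using C(1) w0 v by (intro add_pos_nonneg) auto
    fix m :: nat and i :: int assume i: "0 \<le> i" "i < 2 ^ m"
    show "Wb m i * S m i powr (q - 1) \<le> ?C * V m i powr q"
    proof (cases "6 \<le> m")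
      case True
      have "Wb m i * S m i powr (q - 1) \<le> C * V m i powr q" by (rule C(2)[OF True i])
      also have "\<dots> \<le> ?C * V m i powr q" using w0 v by (intro mult_right_mono) auto
      finally show ?thesis .
    next
      case False
      have "Wb m i * S m i powr (q - 1) \<le> w * s powr (q - 1)"
        using w s q S_nonneg w0 by (intro mult_mono powr_mono2) auto
      also have "\<dots> = w * s powr (q - 1) / v powr q * v powr q" using v by simp
      also have "\<dots> \<le> w * s powr (q - 1) / v powr q * V m i powr q"
        using v v_le[OF _ i] False q w0 by (intro mult_left_mono powr_mono2) auto
      also have "\<dots> \<le> ?C * V m i powr q" using C(1) by (intro mult_right_mono) auto
      finally show ?thesis .
    qed
  qed
qed

text \<open>If \<open>h\<close> can vanish only where \<open>\<nu>\<close> does, then \<open>h\<close> charges each dyadic square, because \<open>\<nu>\<close> does.\<close>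
lemma square_null:
  assumes "0 \<le> i" "i < 2 ^ m" "\<And>z. z \<in> annulus 0 \<Longrightarrow> \<omega> z = 0 \<longrightarrow> \<nu> z = 0 \<Longrightarrow> h z = 0 \<Longrightarrow> \<nu> z = 0"
    and h: "h \<in> borel_measurable area_measure" "\<And>z. norm z < 1 \<Longrightarrow> 0 \<le> h z"
  shows "(\<integral>\<^sup>+z. ennreal (h z) * indicator (dyadic_square m i) z \<partial>area_measure) \<noteq> 0"
proof
  have [measurable]: "h \<in> borel_measurable area_measure" by fact
  assume "(\<integral>\<^sup>+z. ennreal (h z) * indicator (dyadic_square m i) z \<partial>area_measure) = 0"
  then have "AE z in area_measure. ennreal (h z) * indicator (dyadic_square m i) z = 0"
    by (subst (asm) nn_integral_0_iff_AE) auto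
  then have "AE z in area_measure. ennreal (\<nu> z) * indicator (dyadic_square m i) z = 0"
    using dual_integrand_annulus(1) AE_space
  proof eventually_elim
    case (elim z)
    show ?case
    proof (cases "z \<in> dyadic_square m i")
      case True
      then have z: "z \<in> annulus 0" using square_annulus by blast
      have "h z = 0" using elim(1) True h(2)[of z] elim(3) by (simp add: ennreal_eq_0_iff)
      then show ?thesis using assms(3)[OF z] elim(2) z by simp
    qed simp
  qed
  then have "weighted_area \<nu> (dyadic_square m i) = 0"
    unfolding weighted_area_def by (subst nn_integral_0_iff_AE) auto
  then show False using V[of m i] V_pos[OF assms(1,2)] by simp
qed

lemma W_pos:
  assumes "0 \<le> i" "i < 2 ^ m" shows "0 < W m i"
proof -
  have "weighted_area \<omega> (dyadic_square m i) \<noteq> 0" unfolding weighted_area_def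
    by (rule square_null[OF assms]) (use weight_nonneg[OF \<omega>] in auto)
  then show ?thesis using W[of m i] W_nonneg[of m i] by (cases "W m i = 0") auto
qed

lemma S_pos:
  assumes "0 \<le> i" "i < 2 ^ m" shows "0 < S m i"
proof -
  have "(\<integral>\<^sup>+z. ennreal (dual_weight q \<nu> \<omega> z) * indicator (dyadic_square m i) z \<partial>area_measure) \<noteq> 0"
    by (rule square_null[OF assms]) (auto simp: dual_weight_def)
  then show ?thesis using S[of m i] S_nonneg[of m i] dual_integrand_annulus(2)[OF square_annulus]
    by (cases "S m i = 0") auto
qed

text \<open>Hoelder's inequality for \<open>\<nu> = \<omega>\<^bsup>1/q\<^esup> \<sigma>\<^bsup>1/q'\<^esup>\<close>, obtained from Young's inequality with the parameter
\<open>t = V/W\<close> that balances both terms.\<close>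
lemma square_hoelder:
  assumes i: "0 \<le> i" "i < 2 ^ m"
  shows "V m i powr q \<le> W m i * S m i powr (q - 1)"
proof -
  let ?Q = "dyadic_square m i"
  let ?\<sigma> = "dual_weight q \<nu> \<omega>"
  have affine: "ennreal (a * x + b * y) = ennreal a * ennreal x + ennreal b * ennreal y"
    if "0 \<le> a" "0 \<le> b" "0 \<le> x" "0 \<le> y" for a b x y :: real
    using that by (simp add: ennreal_plus ennreal_mult)
  have pos: "0 < V m i" "0 < W m i" "0 < S m i" using V_pos W_pos S_pos i by auto
  define t where "t = V m i / W m i"
  have t: "0 < t" using pos by (simp add: t_def)
  define p where "p = q / (q - 1)"
  have p: "1 < p" "1 / q + 1 / p = 1" "p / q = 1 / (q - 1)" using q by (auto simp: p_def field_simps)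
  have "ennreal (V m i) = (\<integral>\<^sup>+z. ennreal (\<nu> z) * indicator ?Q z \<partial>area_measure)"
    by (simp add: V weighted_area_def)
  also have "\<dots> \<le> (\<integral>\<^sup>+z. ennreal (t / q) * (ennreal (\<omega> z) * indicator ?Q z) + ennreal (t powr (- 1 / (q - 1)) / p) * (ennreal (?\<sigma> z) * indicator ?Q z) \<partial>area_measure)"
  proof (rule nn_integral_mono_AE)
    show "AE z in area_measure. ennreal (\<nu> z) * indicator ?Q z
        \<le> ennreal (t / q) * (ennreal (\<omega> z) * indicator ?Q z) + ennreal (t powr (- 1 / (q - 1)) / p) * (ennreal (?\<sigma> z) * indicator ?Q z)"
      using dual_integrand_annulus(1) AE_space
    proof eventually_elim
      case (elim z)
      show ?case
      proof (cases "z \<in> ?Q \<and> \<nu> z \<noteq> 0")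
        case True
        then have zQ: "z \<in> ?Q" and z: "z \<in> annulus 0" using square_annulus by auto
        have nn: "0 < \<nu> z" "0 < \<omega> z"
          using True z elim weight_nonneg[OF \<nu>w, of z] weight_nonneg[OF \<omega>, of z] by (auto simp: less_le)
        have "(t * \<omega> z) powr (1 / q) * (t powr (- 1 / q) * (\<nu> z * \<omega> z powr (- 1 / q)))
            \<le> ((t * \<omega> z) powr (1 / q)) powr q / q + (t powr (- 1 / q) * (\<nu> z * \<omega> z powr (- 1 / q))) powr p / p"
          by (rule Youngs_inequality) (use q p t nn in auto)
        also have "(t * \<omega> z) powr (1 / q) * (t powr (- 1 / q) * (\<nu> z * \<omega> z powr (- 1 / q))) = \<nu> z"
          using t nn by (simp add: powr_mult powr_minus field_simps)
        also have "((t * \<omega> z) powr (1 / q)) powr q / q = t / q * \<omega> z"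
          using q t nn by (simp add: powr_powr)
        also have "(t powr (- 1 / q) * (\<nu> z * \<omega> z powr (- 1 / q))) powr p / p = t powr (- 1 / (q - 1)) / p * ?\<sigma> z"
        proof -
          have "- 1 / q * p = - 1 / (q - 1)" using p(3) by simp
          then have "(t powr (- 1 / q)) powr p = t powr (- 1 / (q - 1))" by (simp only: powr_powr)
          then show ?thesis using nn by (simp add: powr_mult dual_weight_def p_def)
        qed
        finally have "ennreal (\<nu> z) \<le> ennreal (t / q * \<omega> z + t powr (- 1 / (q - 1)) / p * ?\<sigma> z)" by (rule ennreal_leI)
        also have "\<dots> = ennreal (t / q) * ennreal (\<omega> z) + ennreal (t powr (- 1 / (q - 1)) / p) * ennreal (?\<sigma> z)"
          using q p t nn by (intro affine) auto
        finally show ?thesis using zQ by simp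
      qed auto
    qed
  qed
  also have "\<dots> = ennreal (t / q) * ennreal (W m i) + ennreal (t powr (- 1 / (q - 1)) / p) * ennreal (S m i)"
    unfolding W S weighted_area_def dual_integrand_annulus(2)[OF square_annulus, symmetric]
    by (subst nn_integral_add, simp, simp) (simp add: nn_integral_cmult)
  also have "\<dots> = ennreal (t / q * W m i + t powr (- 1 / (q - 1)) / p * S m i)"
    using pos q p t by (intro affine[symmetric]) auto
  finally have "V m i \<le> t / q * W m i + t powr (- 1 / (q - 1)) / p * S m i"
    using pos q p t by (subst (asm) ennreal_le_iff) auto
  also have "t / q * W m i = V m i * (1 / q)" using pos by (simp add: t_def)
  also have "1 / q = 1 - 1 / p" using p by simp
  finally have "V m i * (1 / p) \<le> t powr (- 1 / (q - 1)) * S m i * (1 / p)"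
    by (simp add: right_diff_distrib)
  then have "V m i \<le> t powr (- 1 / (q - 1)) * S m i" using p(1) by (simp add: divide_le_cancel)
  then have "V m i powr (q - 1) \<le> (t powr (- 1 / (q - 1)) * S m i) powr (q - 1)"
    using q pos by (intro powr_mono2) auto
  also have "\<dots> = t powr (- 1) * S m i powr (q - 1)"
    using q pos t by (simp add: powr_mult powr_powr)
  also have "t powr (- 1) = W m i / V m i" using t pos by (simp add: powr_minus t_def)
  finally have "V m i * V m i powr (q - 1) \<le> V m i * (W m i / V m i * S m i powr (q - 1))"
    using pos by (intro mult_left_mono) auto
  moreover have "V m i * V m i powr (q - 1) = V m i powr q"
    using pos powr_add[of "V m i" 1 "q - 1"] by simp
  ultimately show ?thesis using pos by simp
qed

text \<open>The \<open>B\<^sub>q\<close> condition bounds \<open>Wb S\<^bsup>q-1\<^esup>\<close> by \<open>V\<^sup>q\<close>, and \<open>square_hoelder\<close> bounds \<open>V\<^sup>q\<close> by \<open>W S\<^bsup>q-1\<^esup>\<close>; the factor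
\<open>S\<^bsup>q-1\<^esup>\<close> cancels.\<close>
lemma block_doubling:
  obtains C where "0 < C" "\<And>m i. 0 \<le> i \<Longrightarrow> i < 2 ^ m \<Longrightarrow> Wb m i \<le> C * W m i"
proof -
  obtain C where C: "0 < C" "\<And>m i. 0 \<le> i \<Longrightarrow> i < 2 ^ m \<Longrightarrow> Wb m i * S m i powr (q - 1) \<le> C * V m i powr q"
    by (rule block_bound) blast
  show thesis
  proof (rule that[OF C(1)])
    fix m :: nat and i :: int assume i: "0 \<le> i" "i < 2 ^ m"
    have "Wb m i * S m i powr (q - 1) \<le> C * V m i powr q" by (rule C(2)[OF i])
    also have "\<dots> \<le> C * (W m i * S m i powr (q - 1))" using C(1) square_hoelder[OF i] by (intro mult_left_mono) auto
    finally have "Wb m i * S m i powr (q - 1) \<le> C * W m i * S m i powr (q - 1)" by (simp add: mult.assoc)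
    then show "Wb m i \<le> C * W m i" using S_pos[OF i] by simp
  qed
qed

end

section \<open>Pointwise domination by averages over dyadic squares\<close>
text \<open>Take the last generation \<open>j\<close> in which \<open>x\<close> and \<open>z\<close> lie in adjacent cells. If \<open>j < J\<close>, they are separated in
the next one, which bounds the denominator from below by \<open>2\<^bsup>-j-1\<^esup>\<close>. The sum keeps this one term and is
convenient because it does not mention the last generation.\<close>
lemma kernel_decay:
  assumes z: "norm z < 1" "1 - norm z \<le> (1/2) ^ J" and x: "norm x < 1" and N: "0 \<le> N"
  shows "((1 - norm z) / norm (1 - cnj z * x)) powr N
    \<le> 2 powr N * (\<Sum>j\<le>J. ((1/2) powr N) ^ (J - j) * of_bool (adjacent j (cell j x) (cell j z)))"
proof -
  let ?A = "{j. j \<le> J \<and> adjacent j (cell j x) (cell j z)}"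
  let ?t = "\<lambda>j. ((1/2) powr N) ^ (J - j) * of_bool (adjacent j (cell j x) (cell j z)) :: real"
  define j where "j = Max ?A"
  have A: "finite ?A" "0 \<in> ?A" by auto
  then have j: "j \<in> ?A" unfolding j_def by (intro Max_in) auto
  have lower: "1 - norm z \<le> norm (1 - cnj z * x)"
  proof -
    have "norm z * norm x \<le> norm z * 1" using x by (intro mult_left_mono) auto
    then show ?thesis using norm_triangle_ineq2[of 1 "cnj z * x"] by (simp add: norm_mult)
  qed
  then have pos: "0 < norm (1 - cnj z * x)" using z by linarith
  have ratio: "(1 - norm z) / norm (1 - cnj z * x) \<le> 2 * (1/2) ^ (J - j)"
  proof (cases "j = J")
    case True
    have "(1 - norm z) / norm (1 - cnj z * x) \<le> 1" using lower pos by simp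
    with True show ?thesis by simp
  next
    case False
    then have jJ: "Suc j \<le> J" using j by simp
    have "Suc j \<notin> ?A"
    proof
      assume "Suc j \<in> ?A"
      from Max_ge[OF A(1) this] show False unfolding j_def[symmetric] by simp
    qed
    then have "\<not> adjacent (Suc j) (cell (Suc j) x) (cell (Suc j) z)" using jJ by simp
    then have "(1/2) ^ Suc j \<le> norm (1 - cnj z * x)" using kernel_ge_of_not_adjacent z x by blast
    then have "(1 - norm z) / norm (1 - cnj z * x) \<le> (1/2) ^ J / (1/2) ^ Suc j"
      using z by (intro frac_le) auto
    also have "(1/2) ^ J = (1/2::real) ^ (J - j) * (1/2) ^ j" using j by (simp add: power_add[symmetric])
    also have "\<dots> / (1/2) ^ Suc j = 2 * (1/2) ^ (J - j)" by simp
    finally show ?thesis .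
  qed
  have "((1 - norm z) / norm (1 - cnj z * x)) powr N \<le> (2 * (1/2) ^ (J - j)) powr N"
    using ratio pos z N by (intro powr_mono2) auto
  also have "\<dots> = 2 powr N * ?t j"
    using j by (simp add: powr_mult powr_powr powr_realpow[symmetric] mult.commute)
  also have "?t j \<le> (\<Sum>j\<le>J. ?t j)"
    using j by (intro member_le_sum) auto
  finally show ?thesis by (simp add: mult_left_mono)
qed

context bekolle_weight
begin

definition neighbours :: "nat \<Rightarrow> complex \<Rightarrow> int set" where
  "neighbours j z = {i \<in> {0..<2 ^ j}. adjacent j i (cell j z)}"

lemma finite_neighbours [simp]: "finite (neighbours j z)"
  unfolding neighbours_def by (rule finite_subset[of _ "{0..<2 ^ j}"]) auto

lemma card_neighbours: "card (neighbours j z) \<le> 3"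
  unfolding neighbours_def by (rule card_adjacent)

text \<open>The estimate \<open>radial_mean_le\<close> for \<open>F(x) = f(x) ((1-|z|)/(1 - cnj z x))\<^sup>n\<close> on the annulus beyond \<open>z\<close>. By
\<open>kernel_decay\<close> the part of the right-hand side on squares of generation \<open>j\<close> carries the factor
\<open>\<beta>\<^bsup>J-j\<^esup>\<close> with \<open>\<beta> = 2\<^bsup>-n\<alpha>\<^esup>\<close>, while by \<open>V_compare\<close> their \<open>\<nu>\<close>-masses exceed the mass near \<open>z\<close> by at most
\<open>(2D)\<^bsup>J-j\<^esup>\<close> up to a constant. The choice of \<open>n\<close> makes the product at most \<open>4\<^bsup>-(J-j)\<^esup>\<close>.\<close>
lemma subharmonic_dyadic_bound:
  fixes f :: "complex \<Rightarrow> complex" and y :: "nat \<Rightarrow> int \<Rightarrow> real"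
  assumes f: "f holomorphic_on unit_disc" and \<alpha>: "0 < \<alpha>"
    and n: "8 * D \<le> 2 powr (real n * \<alpha>)"
    and y0: "\<And>j i. 0 \<le> y j i"
    and y: "\<And>j i. 0 \<le> i \<Longrightarrow> i < 2 ^ j \<Longrightarrow>
      weighted_area (\<lambda>x. norm (f x) powr \<alpha> * \<nu> x) (dyadic_square j i) \<le> ennreal (y j i * V j i)"
    and z: "norm z < 1" "(1/2) ^ Suc J < 1 - norm z" "1 - norm z \<le> (1/2) ^ J"
    and w: "w \<in> cball z ((1 - norm z) / 4)"
  shows "norm (f w) powr \<alpha> \<le> 8 * D * 6 powr (real n * \<alpha>) * (\<Sum>j\<le>J. \<Sum>i\<in>neighbours j z. (1/4) ^ (J - j) * y j i)"
proof -
  define h where "h = 1 - norm z"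
  define N where "N = real n * \<alpha>"
  define \<beta> where "\<beta> = (1/2) powr N"
  define F where "F x = f x * (of_real h / (1 - cnj z * x)) ^ n" for x
  define \<rho> where "\<rho> = 1 - h / 2"
  have N: "0 \<le> N" using \<alpha> by (simp add: N_def)
  have \<beta>: "0 < \<beta>" "2 * D * \<beta> \<le> 1 / 4"
    using n D(1) by (auto simp: \<beta>_def N_def powr_divide divide_le_eq)
  have h: "0 < h" "h \<le> 1" "h \<le> (1/2) ^ J" "(1/2) ^ Suc J < h" using z by (auto simp: h_def)
  have w': "norm (w - z) \<le> h / 4" using w by (simp add: dist_norm norm_minus_commute h_def)
  have nw: "norm w \<le> 1 - h + h / 4" using w' norm_triangle_ineq2[of w z] unfolding h_def by linarith
  have nz: "1 - cnj z * x \<noteq> 0" if "norm x < 1" for x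
  proof
    assume "1 - cnj z * x = 0"
    then have "norm (cnj z * x) = 1" by (metis eq_iff_diff_eq_0 norm_one)
    moreover have "norm z * norm x < 1" using z(1) that mult_strict_mono'[of "norm z" 1 "norm x" 1] by simp
    ultimately show False by (simp add: norm_mult)
  qed
  have hol: "F holomorphic_on unit_disc"
    unfolding F_def using nz by (intro holomorphic_intros f) auto
  have nF: "norm (F x) powr \<alpha> = norm (f x) powr \<alpha> * (h / norm (1 - cnj z * x)) powr N" if "norm x < 1" for x
  proof -
    have "norm (F x) = norm (f x) * (h / norm (1 - cnj z * x)) ^ n"
      using h by (simp add: F_def norm_mult norm_power norm_divide)
    moreover have "((h / norm (1 - cnj z * x)) ^ n) powr \<alpha> = (h / norm (1 - cnj z * x)) powr N"
      using h nz[OF that] by (simp add: powr_realpow[symmetric] powr_powr N_def)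
    ultimately show ?thesis using h by (simp add: powr_mult)
  qed
  \<comment> \<open>Since \<open>|1 - cnj z w| \<le> 3h\<close>, the auxiliary factor costs only a constant at \<open>w\<close>.\<close>
  have near: "norm (f w) powr \<alpha> * (1/3) powr N \<le> norm (F w) powr \<alpha>"
  proof -
    have w1: "norm w < 1" using nw h by linarith
    have "1 - cnj z * w = (1 - cnj z * z) - cnj z * (w - z)" by (simp add: algebra_simps)
    then have "norm (1 - cnj z * w) \<le> norm (1 - cnj z * z) + norm (cnj z * (w - z))"
      using norm_triangle_ineq4[of "1 - cnj z * z" "cnj z * (w - z)"] by (simp only:)
    moreover have "norm (1 - cnj z * z) \<le> 2 * h"
    proof -
      have "cnj z * z = of_real ((norm z)\<^sup>2)" using complex_norm_square[of z] by (metis mult.commute)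
      then have "1 - cnj z * z = of_real (1 - (norm z)\<^sup>2)" by simp
      then have "norm (1 - cnj z * z) = \<bar>1 - (norm z)\<^sup>2\<bar>" by (simp only: norm_of_real)
      moreover have "0 \<le> 1 - (norm z)\<^sup>2" using z(1) by (simp add: power_le_one)
      moreover have "2 * h - (1 - (norm z)\<^sup>2) = (1 - norm z)\<^sup>2"
        by (simp add: h_def power2_eq_square algebra_simps)
      moreover have "0 \<le> (1 - norm z)\<^sup>2" by simp
      ultimately show ?thesis by linarith
    qed
    moreover have "norm (cnj z * (w - z)) \<le> 1 * (h / 4)" 
      unfolding norm_mult using z(1) w' by (intro mult_mono) auto
    ultimately have "norm (1 - cnj z * w) \<le> 3 * h"
      using h by linarith
    then have "1 / 3 \<le> h / norm (1 - cnj z * w)"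
      using h nz[OF w1] by (simp add: field_simps)
    then have "(1/3) powr N \<le> (h / norm (1 - cnj z * w)) powr N" using N by (intro powr_mono2) auto
    then show ?thesis unfolding nF[OF w1] by (intro mult_left_mono) auto
  qed
  let ?E = "{x::complex. \<rho> \<le> norm x}"
  let ?g = "\<lambda>x. ennreal (norm (f x) powr \<alpha>) * ennreal (\<nu> x)"
  let ?T = "\<Sum>j\<le>J. \<Sum>i\<in>neighbours j z. 2 powr N * \<beta> ^ (J - j) * (y j i * V j i)"
  have [measurable]: "?g \<in> borel_measurable area_measure"
    using measurable_norm_powr_area[OF f \<alpha>] by measurable
  have y': "(\<integral>\<^sup>+x. ?g x * indicator (dyadic_square j i) x \<partial>area_measure) \<le> ennreal (y j i * V j i)"
    if "0 \<le> i" "i < 2 ^ j" for i j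
    using y[OF that] by (simp add: weighted_area_def ennreal_mult')
  have "weighted_area (\<lambda>x. norm (F x) powr \<alpha> * \<nu> x) ?E
     \<le> (\<integral>\<^sup>+x. (\<Sum>j\<le>J. \<Sum>i\<in>neighbours j z. ennreal (2 powr N * \<beta> ^ (J - j)) * (?g x * indicator (dyadic_square j i) x)) \<partial>area_measure)"
    unfolding weighted_area_def
  proof (intro nn_integral_mono)
    fix x assume "x \<in> space area_measure"
    then have x: "norm x < 1" by simp
    show "ennreal (norm (F x) powr \<alpha> * \<nu> x) * indicator ?E x
      \<le> (\<Sum>j\<le>J. \<Sum>i\<in>neighbours j z. ennreal (2 powr N * \<beta> ^ (J - j)) * (?g x * indicator (dyadic_square j i) x))"
    proof (cases "x \<in> ?E")
      case True
      define \<iota> where "\<iota> j = (of_bool (adjacent j (cell j x) (cell j z)) :: real)" for j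
      have \<iota>: "0 \<le> \<iota> j" for j by (simp add: \<iota>_def)
      have inner: "(\<Sum>i\<in>neighbours j z. indicator (dyadic_square j i) x) = ennreal (\<iota> j)"
        if "j \<le> J" for j
      proof -
        have "1 - norm x \<le> h / 2" using True by (simp add: \<rho>_def)
        also have "h / 2 \<le> (1/2) ^ Suc J" using h(3) by simp
        also have "\<dots> \<le> (1/2) ^ Suc j" using that by (intro power_decreasing) auto
        finally have xa: "x \<in> annulus j" using x by (simp add: annulus_def)
        have "(\<Sum>i\<in>neighbours j z. indicator (dyadic_square j i) x)
           = (\<Sum>i\<in>neighbours j z. if i = cell j x then 1 else 0 :: ennreal)"
          using xa by (intro sum.cong refl) (auto simp: dyadic_square_def indicator_def)
        also have "\<dots> = (if cell j x \<in> neighbours j z then 1 else 0)" by (subst sum.delta) auto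
        also have "\<dots> = ennreal (\<iota> j)"
          using cell_range[of j x] by (simp add: neighbours_def \<iota>_def)
        finally show ?thesis .
      qed
      have "norm (F x) powr \<alpha> \<le> norm (f x) powr \<alpha> * (2 powr N * (\<Sum>j\<le>J. \<beta> ^ (J - j) * \<iota> j))"
        unfolding nF[OF x] h_def \<beta>_def \<iota>_def
        by (intro mult_left_mono kernel_decay[OF z(1,3) x N]) auto
      also have "2 powr N * (\<Sum>j\<le>J. \<beta> ^ (J - j) * \<iota> j) = (\<Sum>j\<le>J. 2 powr N * \<beta> ^ (J - j) * \<iota> j)"
        by (simp add: sum_distrib_left mult.assoc)
      finally have "ennreal (norm (F x) powr \<alpha>)
          \<le> ennreal (norm (f x) powr \<alpha> * (\<Sum>j\<le>J. 2 powr N * \<beta> ^ (J - j) * \<iota> j))"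
        by (rule ennreal_leI)
      also have "\<dots> = ennreal (norm (f x) powr \<alpha>) * ennreal (\<Sum>j\<le>J. 2 powr N * \<beta> ^ (J - j) * \<iota> j)"
        using \<beta>(1) \<iota> by (intro ennreal_mult sum_nonneg) auto
      also have "ennreal (\<Sum>j\<le>J. 2 powr N * \<beta> ^ (J - j) * \<iota> j)
          = (\<Sum>j\<le>J. ennreal (2 powr N * \<beta> ^ (J - j) * \<iota> j))"
        using \<beta>(1) \<iota> by (intro sum_ennreal[symmetric]) auto
      also have "\<dots> = (\<Sum>j\<le>J. ennreal (2 powr N * \<beta> ^ (J - j)) * ennreal (\<iota> j))"
        using \<beta>(1) \<iota> by (intro sum.cong refl ennreal_mult) auto
      finally have "ennreal (norm (F x) powr \<alpha>) * ennreal (\<nu> x)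
         \<le> ennreal (norm (f x) powr \<alpha>) * (\<Sum>j\<le>J. ennreal (2 powr N * \<beta> ^ (J - j)) * ennreal (\<iota> j)) * ennreal (\<nu> x)"
        by (intro mult_right_mono) auto
      also have "\<dots> = (\<Sum>j\<le>J. ennreal (2 powr N * \<beta> ^ (J - j)) * ?g x * ennreal (\<iota> j))"
        by (simp only: sum_distrib_left sum_distrib_right mult_ac)
      also have "\<dots> = (\<Sum>j\<le>J. ennreal (2 powr N * \<beta> ^ (J - j)) * ?g x * (\<Sum>i\<in>neighbours j z. indicator (dyadic_square j i) x))"
        by (intro sum.cong refl) (simp add: inner)
      also have "\<dots> = (\<Sum>j\<le>J. \<Sum>i\<in>neighbours j z. ennreal (2 powr N * \<beta> ^ (J - j)) * (?g x * indicator (dyadic_square j i) x))"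
        by (simp add: sum_distrib_left mult.assoc)
      finally show ?thesis using True by (simp add: ennreal_mult')
    qed simp
  qed
  also have "\<dots> = (\<Sum>j\<le>J. \<Sum>i\<in>neighbours j z. ennreal (2 powr N * \<beta> ^ (J - j)) * (\<integral>\<^sup>+x. ?g x * indicator (dyadic_square j i) x \<partial>area_measure))"
    by (simp add: nn_integral_sum nn_integral_cmult)
  also have "\<dots> \<le> (\<Sum>j\<le>J. \<Sum>i\<in>neighbours j z. ennreal (2 powr N * \<beta> ^ (J - j)) * ennreal (y j i * V j i))"
    by (intro sum_mono mult_left_mono y') (auto simp: neighbours_def)
  also have "\<dots> = (\<Sum>j\<le>J. \<Sum>i\<in>neighbours j z. ennreal (2 powr N * \<beta> ^ (J - j) * (y j i * V j i)))"
    using \<beta>(1) y0 V_nonneg by (intro sum.cong refl ennreal_mult[symmetric]) auto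
  also have "\<dots> = (\<Sum>j\<le>J. ennreal (\<Sum>i\<in>neighbours j z. 2 powr N * \<beta> ^ (J - j) * (y j i * V j i)))"
    using \<beta>(1) y0 V_nonneg by (intro sum.cong refl sum_ennreal) auto
  also have "\<dots> = ennreal ?T"
    using \<beta>(1) y0 V_nonneg by (intro sum_ennreal sum_nonneg) auto
  finally have upper: "weighted_area (\<lambda>x. norm (F x) powr \<alpha> * \<nu> x) ?E \<le> ennreal ?T" .
  \<comment> \<open>The annulus of generation \<open>Suc J\<close> lies in \<open>|x| \<ge> 1 - h/2\<close>, as its height \<open>2\<^bsup>-J-2\<^esup>\<close> is less than \<open>h/2\<close>.\<close>
  have mass: "ennreal (2 ^ Suc J * V (Suc J) 0) \<le> weighted_area \<nu> ?E"
  proof -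
    have "annulus (Suc J) \<subseteq> ?E"
      using h(4) by (auto simp: annulus_def \<rho>_def)
    then have "weighted_area \<nu> (annulus (Suc J)) \<le> weighted_area \<nu> ?E" by (rule weighted_area_mono)
    then show ?thesis using V_annulus[of 0 "Suc J"] by simp
  qed
  have "ennreal ((\<rho> - norm w) * norm (F w) powr \<alpha>) * ennreal (2 ^ Suc J * V (Suc J) 0)
     \<le> ennreal ((\<rho> - norm w) * norm (F w) powr \<alpha>) * weighted_area \<nu> ?E"
    by (rule mult_left_mono[OF mass]) simp
  also have "\<dots> \<le> weighted_area (\<lambda>x. norm (F x) powr \<alpha> * \<nu> x) ?E"
    by (rule radial_mean_le[OF hol \<alpha>]) (use radial_weight_rotate[OF \<nu>] nw h in \<open>auto simp: \<rho>_def\<close>)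
  also note upper
  finally have "ennreal ((\<rho> - norm w) * norm (F w) powr \<alpha>) * ennreal (2 ^ Suc J * V (Suc J) 0) \<le> ennreal ?T" .
  moreover have T0: "0 \<le> ?T" using \<beta>(1) y0 V_nonneg by (intro sum_nonneg) auto
  moreover have \<rho>w: "h / 4 \<le> \<rho> - norm w" using nw by (simp add: \<rho>_def)
  ultimately have "(\<rho> - norm w) * norm (F w) powr \<alpha> * (2 ^ Suc J * V (Suc J) 0) \<le> ?T"
    using h V_nonneg by (subst (asm) ennreal_mult[symmetric]) auto
  moreover have "h / 4 * (norm (f w) powr \<alpha> * (1/3) powr N) * (2 ^ Suc J * V (Suc J) 0)
      \<le> (\<rho> - norm w) * norm (F w) powr \<alpha> * (2 ^ Suc J * V (Suc J) 0)"
    using \<rho>w near h V_nonneg by (intro mult_right_mono mult_mono) auto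
  ultimately have le1: "h / 4 * (norm (f w) powr \<alpha> * (1/3) powr N) * (2 ^ Suc J * V (Suc J) 0) \<le> ?T" by linarith
  have hJ: "1 \<le> h * 2 ^ Suc J"
    using h(4) by (simp add: power_one_over field_simps)
  have v: "0 < V (Suc J) 0" by (rule V_pos) auto
  have "norm (f w) powr \<alpha> * (1/3) powr N * V (Suc J) 0 * 1 \<le> norm (f w) powr \<alpha> * (1/3) powr N * V (Suc J) 0 * (h * 2 ^ Suc J)"
    using hJ v by (intro mult_left_mono) auto
  also have "\<dots> \<le> 4 * ?T" using le1 by (simp add: mult_ac)
  also have "?T \<le> 2 powr N * (2 * D) * V (Suc J) 0 * (\<Sum>j\<le>J. \<Sum>i\<in>neighbours j z. (1/4) ^ (J - j) * y j i)"
    unfolding sum_distrib_left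
  proof (intro sum_mono)
    fix j i assume "j \<in> {..J}" and i: "i \<in> neighbours j z"
    then have j: "j \<le> J" by simp
    have "V j i \<le> (2 * D) ^ (Suc J - j) * V (j + (Suc J - j)) 0"
      using i by (intro V_compare) (auto simp: neighbours_def)
    then have Vj: "V j i \<le> (2 * D) ^ (J - j) * (2 * D) * V (Suc J) 0"
      using j by (simp add: Suc_diff_le mult_ac)
    have "2 powr N * \<beta> ^ (J - j) * (y j i * V j i) \<le> 2 powr N * \<beta> ^ (J - j) * (y j i * ((2 * D) ^ (J - j) * (2 * D) * V (Suc J) 0))"
      using Vj y0 \<beta>(1) by (intro mult_left_mono) auto
    also have "\<dots> = 2 powr N * (2 * D) * V (Suc J) 0 * ((2 * D * \<beta>) ^ (J - j) * y j i)"
      by (simp add: power_mult_distrib mult_ac)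
    also have "\<dots> \<le> 2 powr N * (2 * D) * V (Suc J) 0 * ((1/4) ^ (J - j) * y j i)"
      using \<beta> D(1) v y0 by (intro mult_left_mono mult_right_mono power_mono) auto
    finally show "2 powr N * \<beta> ^ (J - j) * (y j i * V j i) \<le> 2 powr N * (2 * D) * V (Suc J) 0 * ((1/4) ^ (J - j) * y j i)" .
  qed
  finally have "norm (f w) powr \<alpha> * (1/3) powr N * V (Suc J) 0
      \<le> 8 * D * 2 powr N * (\<Sum>j\<le>J. \<Sum>i\<in>neighbours j z. (1/4) ^ (J - j) * y j i) * V (Suc J) 0"
    by (simp add: mult_ac)
  then have "norm (f w) powr \<alpha> * (1/3) powr N \<le> 8 * D * 2 powr N * (\<Sum>j\<le>J. \<Sum>i\<in>neighbours j z. (1/4) ^ (J - j) * y j i)"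
    using v by (simp only: mult_le_cancel_right_pos)
  then have le: "3 powr N * (norm (f w) powr \<alpha> * (1/3) powr N) \<le> 3 powr N * (8 * D * 2 powr N * (\<Sum>j\<le>J. \<Sum>i\<in>neighbours j z. (1/4) ^ (J - j) * y j i))"
    by (intro mult_left_mono) auto
  have e: "3 powr N * (1/3) powr N = 1" "3 powr N * 2 powr N = 6 powr N" by (simp_all add: powr_mult[symmetric])
  have "norm (f w) powr \<alpha> = norm (f w) powr \<alpha> * (3 powr N * (1/3) powr N)" by (simp only: e mult_1_right)
  also have "\<dots> = 3 powr N * (norm (f w) powr \<alpha> * (1/3) powr N)" by (simp only: mult_ac)
  also note le
  also have "3 powr N * (8 * D * 2 powr N * (\<Sum>j\<le>J. \<Sum>i\<in>neighbours j z. (1/4) ^ (J - j) * y j i))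
      = 8 * D * (3 powr N * 2 powr N) * (\<Sum>j\<le>J. \<Sum>i\<in>neighbours j z. (1/4) ^ (J - j) * y j i)"
    by (simp only: mult_ac)
  also have "3 powr N * 2 powr N = 6 powr N" by (rule e(2))
  finally show ?thesis by (simp only: N_def)
qed

end

context bekolle_weight
begin

text \<open>One factor \<open>2\<^bsup>-(J-j)\<^esup>\<close> is spent on summing (at most three neighbours per generation and a geometric series
give the constant \<open>6\<close>), the other one is kept inside the power, where it may be restored to exponent \<open>1\<close>
because it is at most \<open>1\<close>.\<close>
lemma neighbour_sum_power:
  fixes y :: "nat \<Rightarrow> int \<Rightarrow> real" and p :: real
  assumes y: "\<And>j i. 0 \<le> y j i" and p: "1 \<le> p"
  shows "(\<Sum>j\<le>J. \<Sum>i\<in>neighbours j z. (1/4) ^ (J - j) * y j i) powr p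
    \<le> 6 powr p * (\<Sum>j\<le>J. \<Sum>i\<in>neighbours j z. (1/2) ^ (J - j) * y j i powr p)"
proof -
  let ?T = "\<Sum>j\<le>J. \<Sum>i\<in>neighbours j z. (1/2) ^ (J - j) * y j i powr p"
  have T0: "0 \<le> ?T" by (intro sum_nonneg) auto
  have single: "(1/2) ^ (J - j) * y j i \<le> ?T powr (1 / p)" if "j \<le> J" "i \<in> neighbours j z" for j i
  proof -
    have "((1/2) ^ (J - j) * y j i) powr p = (1/2) ^ (J - j) * ((1/2::real) ^ (J - j)) powr (p - 1) * y j i powr p"
    proof -
      have "((1/2::real) ^ (J - j)) powr p = ((1/2::real) ^ (J - j)) powr (1 + (p - 1))" by simp
      also have "\<dots> = (1/2) ^ (J - j) * ((1/2::real) ^ (J - j)) powr (p - 1)" by (simp only: powr_add) simp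
      finally show ?thesis using y by (simp add: powr_mult)
    qed
    also have "\<dots> \<le> (1/2) ^ (J - j) * 1 * y j i powr p"
      using p by (intro mult_right_mono mult_left_mono powr_le1) (auto simp: power_le_one)
    also have "\<dots> \<le> (\<Sum>i\<in>neighbours j z. (1/2) ^ (J - j) * y j i powr p)"
      using that(2) member_le_sum[of i "neighbours j z" "\<lambda>i. (1/2) ^ (J - j) * y j i powr p"] by simp
    also have "\<dots> \<le> ?T"
      using that(1) by (intro member_le_sum[of j "{..J}" "\<lambda>j. \<Sum>i\<in>neighbours j z. (1/2) ^ (J - j) * y j i powr p"] sum_nonneg) auto
    finally have "(((1/2) ^ (J - j) * y j i) powr p) powr (1 / p) \<le> ?T powr (1 / p)"
      using p by (intro powr_mono2) auto
    then show ?thesis using p y[of j i] by (simp add: powr_powr)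
  qed
  have geo: "(\<Sum>j\<le>J. (1/2::real) ^ (J - j)) \<le> 2"
  proof -
    have "(\<Sum>j\<le>J. (1/2::real) ^ (J - j)) = (\<Sum>j\<le>J. (1/2::real) ^ j)"
      by (rule sum.reindex_bij_witness[of _ "\<lambda>j. J - j" "\<lambda>j. J - j"]) auto
    also have "\<dots> \<le> (\<Sum>j. (1/2::real) ^ j)" by (rule sum_le_suminf) (auto intro: summable_geometric)
    also have "\<dots> = 2" by (simp add: suminf_geometric)
    finally show ?thesis .
  qed
  have pull: "(\<Sum>j\<le>J. 3 * (b j * t)) = 3 * t * (\<Sum>j\<le>J. b j)" for b :: "nat \<Rightarrow> real" and t
    by (simp add: sum_distrib_left mult_ac)
  have "(\<Sum>j\<le>J. \<Sum>i\<in>neighbours j z. (1/4) ^ (J - j) * y j i)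
      \<le> (\<Sum>j\<le>J. \<Sum>i\<in>neighbours j z. (1/2) ^ (J - j) * ?T powr (1 / p))"
  proof (intro sum_mono)
    fix j i assume ji: "j \<in> {..J}" "i \<in> neighbours j z"
    have "(1/4::real) ^ (J - j) = (1/2) ^ (J - j) * (1/2) ^ (J - j)" by (simp add: power_mult_distrib[symmetric])
    then have "(1/4) ^ (J - j) * y j i = (1/2) ^ (J - j) * ((1/2) ^ (J - j) * y j i)" by simp
    also have "\<dots> \<le> (1/2) ^ (J - j) * ?T powr (1 / p)" using single ji by (intro mult_left_mono) auto
    finally show "(1/4) ^ (J - j) * y j i \<le> (1/2) ^ (J - j) * ?T powr (1 / p)" .
  qed
  also have "\<dots> = (\<Sum>j\<le>J. real (card (neighbours j z)) * ((1/2) ^ (J - j) * ?T powr (1 / p)))" by simp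
  also have "\<dots> \<le> (\<Sum>j\<le>J. 3 * ((1/2) ^ (J - j) * ?T powr (1 / p)))"
    using card_neighbours by (intro sum_mono mult_right_mono) auto
  also have "\<dots> = 3 * ?T powr (1 / p) * (\<Sum>j\<le>J. (1/2) ^ (J - j))" by (rule pull)
  also have "\<dots> \<le> 3 * ?T powr (1 / p) * 2" by (intro mult_left_mono geo) auto
  finally have "(\<Sum>j\<le>J. \<Sum>i\<in>neighbours j z. (1/4) ^ (J - j) * y j i) \<le> 6 * ?T powr (1 / p)" by simp
  then have "(\<Sum>j\<le>J. \<Sum>i\<in>neighbours j z. (1/4) ^ (J - j) * y j i) powr p \<le> (6 * ?T powr (1 / p)) powr p"
    using p y by (intro powr_mono2 sum_nonneg) auto
  also have "\<dots> = 6 powr p * ?T" using p T0 by (simp add: powr_mult powr_powr)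
  finally show ?thesis .
qed

lemma derivative_dyadic_bound:
  fixes f :: "complex \<Rightarrow> complex" and y :: "nat \<Rightarrow> int \<Rightarrow> real" and p :: real and k :: nat
  assumes p: "0 < p" and n: "8 * D \<le> 2 powr (real n * (p / q))"
  defines "C \<equiv> (fact k * 4 ^ k) powr p * ((8 * D * 6 powr (real n * (p / q))) powr q * 6 powr q)"
  assumes f: "f holomorphic_on unit_disc"
    and y0: "\<And>j i. 0 \<le> y j i"
    and y: "\<And>j i. 0 \<le> i \<Longrightarrow> i < 2 ^ j \<Longrightarrow>
      weighted_area (\<lambda>x. norm (f x) powr (p / q) * \<nu> x) (dyadic_square j i) \<le> ennreal (y j i * V j i)"
    and z: "norm z < 1" "(1/2) ^ Suc J < 1 - norm z" "1 - norm z \<le> (1/2) ^ J"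
  shows "norm ((deriv ^^ k) f z) powr p * (1 - norm z) powr (real k * p)
    \<le> C * (\<Sum>j\<le>J. \<Sum>i\<in>neighbours j z. (1/2) ^ (J - j) * y j i powr q)"
proof -
  define \<alpha> where "\<alpha> = p / q"
  have \<alpha>: "0 < \<alpha>" using p q by (simp add: \<alpha>_def)
  define h where "h = 1 - norm z"
  have h: "0 < h" using z by (simp add: h_def)
  define A where "A = 8 * D * 6 powr (real n * \<alpha>)"
  have A: "0 < A" using D by (simp add: A_def)
  let ?S = "\<Sum>j\<le>J. \<Sum>i\<in>neighbours j z. (1/4) ^ (J - j) * y j i"
  have S0: "0 \<le> ?S" using y0 by (intro sum_nonneg) auto
  define B where "B = (A * ?S) powr (1 / \<alpha>)"
  have sub: "cball z (h / 4) \<subseteq> unit_disc"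
  proof
    fix w assume "w \<in> cball z (h / 4)"
    then have "norm w \<le> norm z + h / 4" using norm_triangle_ineq2[of w z] by (simp add: dist_norm norm_minus_commute)
    moreover have "norm z = 1 - h" by (simp add: h_def)
    ultimately have "norm w \<le> 1 - 3 / 4 * h" by simp
    then have "norm w < 1" using h by simp
    then show "w \<in> unit_disc" by simp
  qed
  have bound: "norm (f w) \<le> B" if "w \<in> cball z (h / 4)" for w
  proof -
    have "norm (f w) powr \<alpha> \<le> A * ?S" unfolding A_def
      by (rule subharmonic_dyadic_bound[OF f \<alpha> _ y0 _ z]) (use n y that in \<open>auto simp: \<alpha>_def h_def\<close>)
    then have "(norm (f w) powr \<alpha>) powr (1 / \<alpha>) \<le> B" unfolding B_def using \<alpha> by (intro powr_mono2) auto
    then show ?thesis using \<alpha> by (simp add: powr_powr)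
  qed
  have "norm ((deriv ^^ k) f z) \<le> fact k * B / (h / 4) ^ k"
  proof (rule Cauchy_inequality)
    show "f holomorphic_on ball z (h / 4)"
      using sub ball_subset_cball[of z "h / 4"] by (intro holomorphic_on_subset[OF f]) blast
    show "continuous_on (cball z (h / 4)) f"
      by (rule continuous_on_subset[OF holomorphic_on_imp_continuous_on[OF f] sub])
  qed (use h bound in \<open>auto simp: dist_norm\<close>)
  then have "norm ((deriv ^^ k) f z) * h ^ k \<le> fact k * 4 ^ k * B"
    using h by (simp add: field_simps power_divide)
  then have "(norm ((deriv ^^ k) f z) * h ^ k) powr p \<le> (fact k * 4 ^ k * B) powr p"
    using p h by (intro powr_mono2) auto
  also have "(norm ((deriv ^^ k) f z) * h ^ k) powr p = norm ((deriv ^^ k) f z) powr p * h powr (real k * p)"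
    using h by (simp add: powr_mult powr_realpow[symmetric] powr_powr)
  also have "(fact k * 4 ^ k * B) powr p = (fact k * 4 ^ k) powr p * B powr p"
    by (simp add: powr_mult B_def)
  also have "B powr p = A powr q * ?S powr q"
  proof -
    have "1 / \<alpha> * p = q" using p q by (simp add: \<alpha>_def)
    then have "B powr p = (A * ?S) powr q" unfolding B_def by (simp only: powr_powr)
    then show ?thesis using A S0 by (simp add: powr_mult)
  qed
  also have "(fact k * 4 ^ k) powr p * (A powr q * ?S powr q)
      \<le> (fact k * 4 ^ k) powr p * (A powr q * (6 powr q * (\<Sum>j\<le>J. \<Sum>i\<in>neighbours j z. (1/2) ^ (J - j) * y j i powr q)))"
    using q y0 by (intro mult_left_mono neighbour_sum_power) auto
  finally show ?thesis by (simp add: C_def A_def \<alpha>_def h_def mult.assoc)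
qed

end

section \<open>Carleson coefficients and the area integral\<close>
lemma dyadic_scale:
  assumes "0 < h" "h \<le> 1"
  obtains J where "(1/2) ^ Suc J < h" "h \<le> (1/2::real) ^ J"
proof -
  obtain n where n: "(1/2) ^ n < h" using real_arch_pow_inv[OF assms(1), of "1/2"] by auto
  define m where "m = (LEAST n. (1/2) ^ n < h)"
  have m: "(1/2) ^ m < h" unfolding m_def by (rule LeastI[of "\<lambda>n. (1/2) ^ n < h", OF n])
  then obtain J where J: "m = Suc J" using assms(2) by (cases m) auto
  have "\<not> (1/2) ^ J < h" using not_less_Least[of J "\<lambda>n. (1/2) ^ n < h"] J by (simp add: m_def)
  then show thesis using that[of J] m J by simp
qed

text \<open>A geometric sum dominated by its last term, in which \<open>2\<^sup>m h \<le> 1\<close>.\<close>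
lemma dyadic_height_sum:
  fixes h :: real
  assumes h: "0 < h"
  shows "(\<Sum>m<n. if h \<le> (1/2) ^ m then 2 ^ Suc m * h else 0) \<le> 4"
proof -
  let ?F = "{m. m < n \<and> h \<le> (1/2) ^ m}"
  have eq: "(\<Sum>m<n. if h \<le> (1/2) ^ m then 2 ^ Suc m * h else 0) = (\<Sum>m\<in>?F. 2 ^ Suc m * h)"
    by (subst sum.inter_filter[symmetric]) (auto intro: sum.cong)
  show ?thesis
  proof (cases "?F = {}")
    case True then show ?thesis unfolding eq True by simp
  next
    case False
    define M where "M = Max ?F"
    have M: "M \<in> ?F" unfolding M_def using False by (intro Max_in) auto
    have geo: "(\<Sum>m\<le>M. (2::real) ^ m) \<le> 2 * 2 ^ M" by (induction M) auto
    have le: "m \<le> M" if "m \<in> ?F" for m unfolding M_def using that by (intro Max_ge) auto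
    have "(\<Sum>m\<in>?F. 2 ^ Suc m * h) \<le> (\<Sum>m\<le>M. 2 ^ Suc m * h)"
      using h le by (intro sum_mono2) auto
    also have "\<dots> = 2 * h * (\<Sum>m\<le>M. 2 ^ m)" by (simp add: sum_distrib_left mult_ac)
    also have "\<dots> \<le> 2 * h * (2 * 2 ^ M)" using h geo by (intro mult_left_mono) auto
    also have "\<dots> \<le> 4"
      using M by (simp add: power_one_over field_simps)
    finally show ?thesis unfolding eq .
  qed
qed

definition dyadic_indices :: "nat \<Rightarrow> (nat \<times> int) set" where
  "dyadic_indices n = (SIGMA m:{..<n}. {0..<2 ^ m})"

lemma finite_dyadic_indices [simp]: "finite (dyadic_indices n)"
  by (simp add: dyadic_indices_def)

context bekolle_weight
begin

lemma W_le_Wb: "W m i \<le> Wb m i"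
  using weighted_area_mono[OF dyadic_square_subset_block, of \<omega> m i] Wb_nonneg[of m i]
  unfolding W[symmetric] Wb[symmetric] by (simp add: ennreal_le_iff)

lemma bekolle_tree_dyadic:
  obtains C where "\<And>n. bekolle_tree area_measure (annulus 0) q \<nu> \<omega> (dyadic_indices n)
    (case_prod dyadic_square) (case_prod V) (case_prod W) (case_prod S) C"
proof -
  obtain C where C: "0 < C" "\<And>m i. 0 \<le> i \<Longrightarrow> i < 2 ^ m \<Longrightarrow> Wb m i * S m i powr (q - 1) \<le> C * V m i powr q"
    by (rule block_bound) blast
  show thesis
  proof (rule that[of C], unfold_locales)
    show "1 < q" by (rule q)
    show "annulus 0 \<in> sets area_measure" by simp
    show "\<nu> \<in> borel_measurable area_measure" "\<omega> \<in> borel_measurable area_measure" by measurable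
    show "z \<in> space area_measure \<Longrightarrow> 0 \<le> \<nu> z" "z \<in> space area_measure \<Longrightarrow> 0 \<le> \<omega> z" for z
      using weight_nonneg[OF \<nu>w] weight_nonneg[OF \<omega>] by auto
    show "AE z in area_measure. z \<in> annulus 0 \<longrightarrow> \<omega> z = 0 \<longrightarrow> \<nu> z = 0"
      by (rule dual_integrand_annulus(1))
    show "(\<integral>\<^sup>+z. ennreal (\<omega> z) * indicator (annulus 0) z \<partial>area_measure) < \<infinity>"
      using weighted_area_finite[OF \<omega>] by (simp add: weighted_area_def)
    show "(\<integral>\<^sup>+z. ennreal (dual_weight q \<nu> \<omega> z) * indicator (annulus 0) z \<partial>area_measure) < \<infinity>"
      using dual_mass_annulus_finite by (simp add: dual_integrand_annulus(2))
    fix n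
    show "finite (dyadic_indices n)" by simp
    show "0 < C" by (rule C(1))
    fix Q assume Q: "Q \<in> dyadic_indices n"
    then obtain m i where mi: "Q = (m, i)" "0 \<le> i" "i < 2 ^ m" by (auto simp: dyadic_indices_def)
    show "case_prod dyadic_square Q \<in> sets area_measure"
      "case_prod dyadic_square Q \<subseteq> annulus 0"
      using mi square_annulus by auto
    show "0 < case_prod V Q" "0 < case_prod W Q" "0 < case_prod S Q"
      using mi V_pos W_pos S_pos by auto
    show "ennreal (case_prod V Q) = (\<integral>\<^sup>+z. ennreal (\<nu> z) * indicator (case_prod dyadic_square Q) z \<partial>area_measure)"
      "ennreal (case_prod W Q) = (\<integral>\<^sup>+z. ennreal (\<omega> z) * indicator (case_prod dyadic_square Q) z \<partial>area_measure)"
      using mi V W by (simp_all add: weighted_area_def)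
    show "ennreal (case_prod S Q) = (\<integral>\<^sup>+z. ennreal (dual_weight q \<nu> \<omega> z) * indicator (case_prod dyadic_square Q) z \<partial>area_measure)"
      using mi S by (simp add: dual_integrand_annulus(2)[OF square_annulus])
    have "W m i * S m i powr (q - 1) \<le> Wb m i * S m i powr (q - 1)"
      by (intro mult_right_mono W_le_Wb) simp
    also have "\<dots> \<le> C * V m i powr q" using C(2) mi by simp
    finally show "case_prod W Q * case_prod S Q powr (q - 1) \<le> C * case_prod V Q powr q"
      using mi by simp
    fix R assume "R \<in> dyadic_indices n"
    obtain l j where lj: "R = (l, j)" by (cases R)
    show "case_prod dyadic_square Q \<subseteq> case_prod dyadic_square R \<or>
       case_prod dyadic_square R \<subseteq> case_prod dyadic_square Q \<or>
       case_prod dyadic_square Q \<inter> case_prod dyadic_square R = {}"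
      using dyadic_squares_laminar[of m l j i] dyadic_squares_laminar[of l m i j] mi lj nle_le[of m l] by auto
  qed
qed

text \<open>The total weight with which the square \<open>dyadic_square m i\<close> enters the area integral. For \<open>z\<close> of height
about \<open>2\<^bsup>-J\<^esup>\<close> the decay \<open>2\<^bsup>-(J-m)\<^esup>\<close> is comparable with \<open>2\<^sup>m (1-|z|)\<close>, which does not involve \<open>J\<close> and is
measurable in \<open>z\<close> at sight.\<close>
definition height_coeff :: "nat \<Rightarrow> int \<Rightarrow> real" where
  "height_coeff m i = enn2real (weighted_area (\<lambda>z. 2 ^ Suc m * (1 - norm z) * \<omega> z) (dyadic_block m i))"

lemma height_coeff_nonneg: "0 \<le> height_coeff m i"
  by (simp add: height_coeff_def)

lemma block_sets [measurable]: "dyadic_block m i \<in> sets area_measure"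
  by (intro sets_area_measureI dyadic_block_measurable dyadic_block_subset)

lemma norm_measurable_area [measurable]: "norm \<in> borel_measurable area_measure"
  by (rule borel_measurable_area_measure) simp

lemma height_coeff:
  "ennreal (height_coeff m i) = weighted_area (\<lambda>z. 2 ^ Suc m * (1 - norm z) * \<omega> z) (dyadic_block m i)"
proof -
  have "weighted_area (\<lambda>z. 2 ^ Suc m * (1 - norm z) * \<omega> z) (dyadic_block m i)
     \<le> (\<integral>\<^sup>+z. ennreal (2 ^ Suc m) * (ennreal (\<omega> z) * indicator (dyadic_block m i) z) \<partial>area_measure)"
    unfolding weighted_area_def
  proof (intro nn_integral_mono)
    fix z assume "z \<in> space area_measure"
    then have z: "norm z < 1" "0 \<le> \<omega> z" using weight_nonneg[OF \<omega>] by auto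
    have "2 ^ Suc m * (1 - norm z) * \<omega> z \<le> 2 ^ Suc m * 1 * \<omega> z" using z by (intro mult_right_mono mult_left_mono) auto
    then have "ennreal (2 ^ Suc m * (1 - norm z) * \<omega> z) \<le> ennreal (2 ^ Suc m * \<omega> z)" by (intro ennreal_leI) simp
    also have "\<dots> = ennreal (2 ^ Suc m) * ennreal (\<omega> z)" using z by (intro ennreal_mult) auto
    finally show "ennreal (2 ^ Suc m * (1 - norm z) * \<omega> z) * indicator (dyadic_block m i) z
       \<le> ennreal (2 ^ Suc m) * (ennreal (\<omega> z) * indicator (dyadic_block m i) z)"
      by (simp add: indicator_def)
  qed
  also have "\<dots> = ennreal (2 ^ Suc m) * weighted_area \<omega> (dyadic_block m i)"
    unfolding weighted_area_def by (intro nn_integral_cmult) measurable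
  also have "\<dots> < \<infinity>" 
    using weighted_area_finite[OF \<omega>, of "dyadic_block m i"]
    unfolding infinity_ennreal_def ennreal_mult_less_top by (simp only: ennreal_less_top simp_thms)
  finally show ?thesis by (auto simp: height_coeff_def)
qed

text \<open>A point in the block of a descendant lies in the block of the ancestor, because ancestors of adjacent
cells are adjacent. For a given point at most three squares of each generation count.\<close>
lemma descendants_height_sum:
  assumes z: "norm z < 1"
  shows "(\<Sum>(m, i)\<in>{Q\<in>dyadic_indices n. case_prod dyadic_square Q \<subseteq> dyadic_square l j}.
      2 ^ Suc m * (1 - norm z) * indicator (dyadic_block m i) z) \<le> 12 * indicator (dyadic_block l j) z"
    (is "sum ?t ?K \<le> _")
proof (cases "z \<in> dyadic_block l j")
  case False
  have "?t Q = 0" if "Q \<in> ?K" for Q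
  proof -
    obtain m i where mi: "Q = (m, i)" by (cases Q)
    then have Q: "Q = (m, i)" "0 \<le> i" "i < 2 ^ m" "dyadic_square m i \<subseteq> dyadic_square l j"
      using that by (auto simp: dyadic_indices_def)
    have lm: "l \<le> m" "j = i div 2 ^ (m - l)" using dyadic_square_subset_cases[OF Q(4,2,3)] by auto
    have "z \<notin> dyadic_block m i"
    proof
      assume zb: "z \<in> dyadic_block m i"
      then have "1 - norm z \<le> (1/2) ^ m" by (simp add: dyadic_block_def)
      also have "\<dots> \<le> (1/2) ^ l" using lm by (intro power_decreasing) auto
      finally have "z \<in> dyadic_block l j"
        using zb adjacent_div[of m i "cell m z" l] lm cell_div[OF lm(1), of z] by (simp add: dyadic_block_def)
      with False show False by simp
    qed
    then show ?thesis by (simp add: Q(1))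
  qed
  then show ?thesis using False by (simp add: sum.neutral)
next
  case True
  have h: "0 < 1 - norm z" using z by simp
  have "sum ?t ?K \<le> sum ?t (dyadic_indices n)"
    using h by (intro sum_mono2) auto
  also have "\<dots> = (\<Sum>m<n. \<Sum>i\<in>{0..<2 ^ m}. 2 ^ Suc m * (1 - norm z) * indicator (dyadic_block m i) z)"
    unfolding dyadic_indices_def by (subst sum.Sigma) auto
  also have "\<dots> \<le> (\<Sum>m<n. 3 * (if 1 - norm z \<le> (1/2) ^ m then 2 ^ Suc m * (1 - norm z) else 0))"
  proof (intro sum_mono)
    fix m
    show "(\<Sum>i\<in>{0..<2 ^ m}. 2 ^ Suc m * (1 - norm z) * indicator (dyadic_block m i) z)
      \<le> 3 * (if 1 - norm z \<le> (1/2) ^ m then 2 ^ Suc m * (1 - norm z) else 0)"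
    proof (cases "1 - norm z \<le> (1/2) ^ m")
      case True
      have "(\<Sum>i\<in>{0..<2 ^ m}. 2 ^ Suc m * (1 - norm z) * indicator (dyadic_block m i) z)
          = (\<Sum>i\<in>neighbours m z. 2 ^ Suc m * (1 - norm z))"
        using True z by (intro sum.mono_neutral_cong_right) (auto simp: neighbours_def dyadic_block_def indicator_def)
      also have "\<dots> = real (card (neighbours m z)) * (2 ^ Suc m * (1 - norm z))" by simp
      also have "\<dots> \<le> 3 * (2 ^ Suc m * (1 - norm z))"
        using card_neighbours[of m z] h by (intro mult_right_mono) auto
      finally show ?thesis using True by simp
    next
      case False
      then have "z \<notin> dyadic_block m i" for i by (auto simp: dyadic_block_def)
      then show ?thesis using False by simp
    qed
  qed
  also have "\<dots> \<le> 3 * 4" unfolding sum_distrib_left[symmetric] by (intro mult_left_mono dyadic_height_sum h) simp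
  finally show ?thesis using True by simp
qed

lemma height_coeff_carleson:
  "(\<Sum>Q\<in>{Q\<in>dyadic_indices n. case_prod dyadic_square Q \<subseteq> dyadic_square l j}. case_prod height_coeff Q)
    \<le> 12 * Wb l j" (is "sum ?a ?K \<le> _")
proof -
  let ?t = "\<lambda>z (m, i). 2 ^ Suc m * (1 - norm z) * indicator (dyadic_block m i) z :: real"
  have fK: "finite ?K" by simp
  have "ennreal (sum ?a ?K) = (\<Sum>Q\<in>?K. ennreal (?a Q))"
    by (intro sum_ennreal[symmetric]) (auto simp: height_coeff_nonneg)
  also have "\<dots> = (\<Sum>Q\<in>?K. \<integral>\<^sup>+z. ennreal (?t z Q * \<omega> z) \<partial>area_measure)"
  proof (intro sum.cong refl)
    fix Q :: "nat \<times> int"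
    obtain m i where Q: "Q = (m, i)" by (cases Q)
    show "ennreal (?a Q) = (\<integral>\<^sup>+z. ennreal (?t z Q * \<omega> z) \<partial>area_measure)"
      unfolding Q prod.case height_coeff weighted_area_def by (intro nn_integral_cong) (simp add: indicator_def)
  qed
  also have "\<dots> = (\<integral>\<^sup>+z. (\<Sum>Q\<in>?K. ennreal (?t z Q * \<omega> z)) \<partial>area_measure)"
  proof (intro nn_integral_sum[symmetric])
    fix Q :: "nat \<times> int"
    obtain m i where Q: "Q = (m, i)" by (cases Q)
    show "(\<lambda>z. ennreal (?t z Q * \<omega> z)) \<in> borel_measurable area_measure" unfolding Q prod.case by measurable
  qed
  also have "\<dots> \<le> (\<integral>\<^sup>+z. 12 * (ennreal (\<omega> z) * indicator (dyadic_block l j) z) \<partial>area_measure)"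
  proof (intro nn_integral_mono)
    fix z assume "z \<in> space area_measure"
    then have z: "norm z < 1" "0 \<le> \<omega> z" using weight_nonneg[OF \<omega>] by auto
    have "(\<Sum>Q\<in>?K. ennreal (?t z Q * \<omega> z)) = ennreal (\<Sum>Q\<in>?K. ?t z Q * \<omega> z)"
      using z by (intro sum_ennreal) auto
    also have "(\<Sum>Q\<in>?K. ?t z Q * \<omega> z) = (\<Sum>Q\<in>?K. ?t z Q) * \<omega> z" by (rule sum_distrib_right[symmetric])
    also have "ennreal \<dots> \<le> ennreal (12 * indicator (dyadic_block l j) z * \<omega> z)"
      using descendants_height_sum[OF z(1), of n l j] z(2) by (intro ennreal_leI mult_right_mono) auto
    also have "\<dots> = 12 * (ennreal (\<omega> z) * indicator (dyadic_block l j) z)"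
      using z(2) by (simp add: indicator_def ennreal_mult)
    finally show "(\<Sum>Q\<in>?K. ennreal (?t z Q * \<omega> z)) \<le> 12 * (ennreal (\<omega> z) * indicator (dyadic_block l j) z)" .
  qed
  also have "\<dots> = 12 * weighted_area \<omega> (dyadic_block l j)"
    unfolding weighted_area_def by (intro nn_integral_cmult) measurable
  also have "\<dots> = ennreal (12 * Wb l j)" using Wb_nonneg by (simp add: Wb[symmetric] ennreal_mult)
  finally show ?thesis using Wb_nonneg[of l j] by (simp add: ennreal_le_iff)
qed

text \<open>The numbers \<open>y m i\<close> are at most the \<open>\<nu>\<close>-averages of \<open>g\<close> over the dyadic squares.\<close>
definition mean_bounded_by :: "(nat \<Rightarrow> int \<Rightarrow> real) \<Rightarrow> (complex \<Rightarrow> real) \<Rightarrow> bool" where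
  "mean_bounded_by y g \<longleftrightarrow> g \<in> borel_measurable area_measure \<and> (\<forall>z. norm z < 1 \<longrightarrow> 0 \<le> g z) \<and> (\<forall>m i. 0 \<le> y m i) \<and>
    (\<forall>m i. 0 \<le> i \<and> i < 2 ^ m \<longrightarrow> ennreal (y m i * V m i) \<le> weighted_area (\<lambda>z. g z * \<nu> z) (dyadic_square m i))"

text \<open>The embedding theorem for the tree of the first \<open>n\<close> generations, with a constant \<open>E\<close> that depends neither
on \<open>n\<close> nor on the coefficients.\<close>
lemma dyadic_mean_embedding:
  obtains E where "0 \<le> E" "\<And>A a n g y. 0 \<le> A \<Longrightarrow> (\<And>Q. 0 \<le> a Q) \<Longrightarrow>
      (\<And>l j. 0 \<le> j \<Longrightarrow> j < 2 ^ l \<Longrightarrow>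
        (\<Sum>Q\<in>{Q\<in>dyadic_indices n. case_prod dyadic_square Q \<subseteq> dyadic_square l j}. a Q) \<le> A * W l j) \<Longrightarrow>
      mean_bounded_by y g \<Longrightarrow>
      ennreal (\<Sum>Q\<in>dyadic_indices n. a Q * case_prod y Q powr q)
        \<le> ennreal (E * A) * (\<integral>\<^sup>+z. ennreal (g z powr q * \<omega> z) \<partial>area_measure)"
proof -
  obtain C where "\<And>n. bekolle_tree area_measure (annulus 0) q \<nu> \<omega> (dyadic_indices n)
    (case_prod dyadic_square) (case_prod V) (case_prod W) (case_prod S) C"
    by (rule bekolle_tree_dyadic) blast
  then interpret T: bekolle_tree area_measure "annulus 0" q \<nu> \<omega> "dyadic_indices n"
    "case_prod dyadic_square" "case_prod V" "case_prod W" "case_prod S" C for n .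
  define s where "s = q / (q - 1)"
  have s: "1 < s" using q by (simp add: s_def field_simps)
  define E where "E = C powr s * (s / (s - 1) * 2 powr s) * (q / (q - 1)) * 2 powr q"
  show thesis
  proof (rule that[of E])
    show "0 \<le> E" using s q by (simp add: E_def)
    fix A n y and a :: "nat \<times> int \<Rightarrow> real" and g :: "complex \<Rightarrow> real"
    assume A: "0 \<le> A" and a: "\<And>Q. 0 \<le> a Q" and y: "mean_bounded_by y g"
      and car: "\<And>l j. 0 \<le> j \<Longrightarrow> j < 2 ^ l \<Longrightarrow>
        (\<Sum>Q\<in>{Q\<in>dyadic_indices n. case_prod dyadic_square Q \<subseteq> dyadic_square l j}. a Q) \<le> A * W l j"
    have "ennreal (\<Sum>Q\<in>dyadic_indices n. a Q * case_prod y Q powr q)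
        \<le> ennreal (C powr s * (A * (s / (s - 1)) * 2 powr s) * (q / (q - 1)) * 2 powr q)
          * (\<integral>\<^sup>+z. ennreal (g z powr q * \<omega> z) * indicator (annulus 0) z \<partial>area_measure)"
      unfolding s_def
    proof (rule T.weighted_carleson_embedding)
      show "0 \<le> A" by (rule A)
      show "g \<in> borel_measurable area_measure" "z \<in> space area_measure \<Longrightarrow> 0 \<le> g z" for z
        using y by (auto simp: mean_bounded_by_def)
      fix Q assume "Q \<in> dyadic_indices n"
      then obtain m i where Q: "Q = (m, i)" "0 \<le> i" "i < 2 ^ m" by (auto simp: dyadic_indices_def)
      show "0 \<le> a Q" "0 \<le> case_prod y Q" using a y by (auto simp: Q mean_bounded_by_def)
      show "ennreal (case_prod y Q * case_prod V Q)
          \<le> (\<integral>\<^sup>+z. ennreal (g z * \<nu> z) * indicator (case_prod dyadic_square Q) z \<partial>area_measure)"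
        using y Q by (simp add: mean_bounded_by_def weighted_area_def)
      show "(\<Sum>P\<in>{P\<in>dyadic_indices n. case_prod dyadic_square P \<subseteq> case_prod dyadic_square Q}. a P) \<le> A * case_prod W Q"
        using car[OF Q(2,3)] by (simp add: Q)
    qed
    also have "C powr s * (A * (s / (s - 1)) * 2 powr s) * (q / (q - 1)) * 2 powr q = E * A"
      by (simp add: E_def)
    also have "ennreal (E * A) * (\<integral>\<^sup>+z. ennreal (g z powr q * \<omega> z) * indicator (annulus 0) z \<partial>area_measure)
        \<le> ennreal (E * A) * (\<integral>\<^sup>+z. ennreal (g z powr q * \<omega> z) \<partial>area_measure)"
      by (intro mult_left_mono nn_integral_mono) (auto simp: indicator_def)
    finally show "ennreal (\<Sum>Q\<in>dyadic_indices n. a Q * case_prod y Q powr q)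
        \<le> ennreal (E * A) * (\<integral>\<^sup>+z. ennreal (g z powr q * \<omega> z) \<partial>area_measure)" .
  qed
qed

text \<open>Young's inequality: \<open>g\<nu> \<le> g\<^sup>q \<omega> + \<sigma>\<close> almost everywhere in \<open>|z| \<ge> 1/2\<close>.\<close>
lemma weighted_mean_finite:
  assumes g: "g \<in> borel_measurable area_measure" "\<And>z. norm z < 1 \<Longrightarrow> 0 \<le> g z"
    and fin: "(\<integral>\<^sup>+z. ennreal (g z powr q * \<omega> z) \<partial>area_measure) < \<infinity>"
  shows "weighted_area (\<lambda>z. g z * \<nu> z) (dyadic_square m i) < \<infinity>"
proof -
  have [measurable]: "g \<in> borel_measurable area_measure" by (rule g(1))
  define p where "p = q / (q - 1)"
  have p: "1 < p" "1 / q + 1 / p = 1" using q by (auto simp: p_def field_simps)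
  let ?\<sigma> = "dual_weight q \<nu> \<omega>"
  have "weighted_area (\<lambda>z. g z * \<nu> z) (dyadic_square m i)
     \<le> (\<integral>\<^sup>+z. ennreal (g z powr q * \<omega> z) + ennreal (?\<sigma> z) * indicator (dyadic_square m i) z \<partial>area_measure)"
    unfolding weighted_area_def
  proof (rule nn_integral_mono_AE)
    show "AE z in area_measure. ennreal (g z * \<nu> z) * indicator (dyadic_square m i) z
       \<le> ennreal (g z powr q * \<omega> z) + ennreal (?\<sigma> z) * indicator (dyadic_square m i) z"
      using dual_integrand_annulus(1) AE_space
    proof eventually_elim
      case (elim z)
      show ?case
      proof (cases "z \<in> dyadic_square m i \<and> \<nu> z \<noteq> 0")
        case True
        then have zQ: "z \<in> dyadic_square m i" and z: "z \<in> annulus 0" using square_annulus by auto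
        have nn: "0 < \<nu> z" "0 < \<omega> z" "0 \<le> g z"
          using True z elim weight_nonneg[OF \<nu>w, of z] weight_nonneg[OF \<omega>, of z] g(2) by (auto simp: less_le)
        have "(g z * \<omega> z powr (1 / q)) * (\<nu> z * \<omega> z powr (- 1 / q))
            \<le> (g z * \<omega> z powr (1 / q)) powr q / q + (\<nu> z * \<omega> z powr (- 1 / q)) powr p / p"
          by (rule Youngs_inequality) (use q p nn in auto)
        also have "(g z * \<omega> z powr (1 / q)) * (\<nu> z * \<omega> z powr (- 1 / q)) = g z * \<nu> z"
          using nn by (simp add: powr_minus field_simps)
        also have "(g z * \<omega> z powr (1 / q)) powr q / q \<le> g z powr q * \<omega> z"
          using q nn by (simp add: powr_mult powr_powr divide_le_eq mult_left_mono[of 1 q, simplified])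
        also have "(\<nu> z * \<omega> z powr (- 1 / q)) powr p / p \<le> ?\<sigma> z"
        proof -
          have "?\<sigma> z * 1 \<le> ?\<sigma> z * p" using p by (intro mult_left_mono) auto
          then show ?thesis using p by (simp add: dual_weight_def p_def[symmetric] divide_le_eq)
        qed
        finally have "ennreal (g z * \<nu> z) \<le> ennreal (g z powr q * \<omega> z + ?\<sigma> z)" by (simp add: ennreal_leI)
        also have "\<dots> = ennreal (g z powr q * \<omega> z) + ennreal (?\<sigma> z)" using nn by (intro ennreal_plus) auto
        finally show ?thesis using zQ by simp
      qed auto
    qed
  qed
  also have "\<dots> = (\<integral>\<^sup>+z. ennreal (g z powr q * \<omega> z) \<partial>area_measure) + ennreal (S m i)"
    unfolding S dual_integrand_annulus(2)[OF square_annulus, symmetric] by (rule nn_integral_add) measurable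
  also have "\<dots> < \<infinity>" using fin by simp
  finally show ?thesis .
qed

end

context bekolle_weight
begin

section \<open>The Littlewood-Paley estimate\<close>
lemma derivative_area_bound:
  fixes y :: "nat \<Rightarrow> int \<Rightarrow> real"
  assumes C: "0 \<le> C" and y: "\<And>m i. 0 \<le> y m i"
    and bound: "\<And>z J. norm z < 1 \<Longrightarrow> (1/2) ^ Suc J < 1 - norm z \<Longrightarrow> 1 - norm z \<le> (1/2) ^ J \<Longrightarrow>
        u z \<le> C * (\<Sum>j\<le>J. \<Sum>i\<in>neighbours j z. (1/2) ^ (J - j) * y j i powr q)"
  shows "(\<integral>\<^sup>+z. ennreal (u z * \<omega> z) \<partial>area_measure)
    \<le> ennreal C * (\<Sum>j. ennreal (\<Sum>i\<in>{0..<2 ^ j}. height_coeff j i * y j i powr q))"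
proof -
  let ?t = "\<lambda>j i z. ennreal (2 ^ Suc j * (1 - norm z) * \<omega> z) * indicator (dyadic_block j i) z"
  have "(\<integral>\<^sup>+z. ennreal (u z * \<omega> z) \<partial>area_measure)
    \<le> (\<integral>\<^sup>+z. ennreal C * (\<Sum>j. \<Sum>i\<in>{0..<2 ^ j}. ennreal (y j i powr q) * ?t j i z) \<partial>area_measure)"
  proof (intro nn_integral_mono)
    fix z assume "z \<in> space area_measure"
    then have z: "norm z < 1" "0 \<le> \<omega> z" using weight_nonneg[OF \<omega>] by auto
    obtain J where J: "(1/2) ^ Suc J < 1 - norm z" "1 - norm z \<le> (1/2) ^ J"
      by (rule dyadic_scale[of "1 - norm z"]) (use z in auto)
    have "u z * \<omega> z \<le> C * (\<Sum>j\<le>J. \<Sum>i\<in>neighbours j z. (1/2) ^ (J - j) * y j i powr q) * \<omega> z"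
      by (intro mult_right_mono bound z J)
    also have "\<dots> = C * (\<Sum>j\<le>J. \<Sum>i\<in>neighbours j z. (1/2) ^ (J - j) * y j i powr q * \<omega> z)"
      by (simp add: sum_distrib_right mult.assoc)
    finally have "ennreal (u z * \<omega> z) \<le> ennreal (C * (\<Sum>j\<le>J. \<Sum>i\<in>neighbours j z. (1/2) ^ (J - j) * y j i powr q * \<omega> z))"
      by (rule ennreal_leI)
    also have "\<dots> = ennreal C * ennreal (\<Sum>j\<le>J. \<Sum>i\<in>neighbours j z. (1/2) ^ (J - j) * y j i powr q * \<omega> z)"
      using C z by (intro ennreal_mult sum_nonneg) auto
    also have "ennreal (\<Sum>j\<le>J. \<Sum>i\<in>neighbours j z. (1/2) ^ (J - j) * y j i powr q * \<omega> z)
        = (\<Sum>j\<le>J. ennreal (\<Sum>i\<in>neighbours j z. (1/2) ^ (J - j) * y j i powr q * \<omega> z))"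
      using z by (intro sum_ennreal[symmetric] sum_nonneg) auto
    also have "\<dots> = (\<Sum>j\<le>J. \<Sum>i\<in>neighbours j z. ennreal ((1/2) ^ (J - j) * y j i powr q * \<omega> z))"
      using z by (intro sum.cong refl sum_ennreal[symmetric]) auto
    also have "\<dots> \<le> (\<Sum>j\<le>J. \<Sum>i\<in>{0..<2 ^ j}. ennreal (y j i powr q) * ?t j i z)"
    proof (rule sum_mono)
      fix j assume "j \<in> {..J}"
      then have j: "j \<le> J" by simp
      have "(\<Sum>i\<in>neighbours j z. ennreal ((1/2) ^ (J - j) * y j i powr q * \<omega> z))
          \<le> (\<Sum>i\<in>neighbours j z. ennreal (y j i powr q) * ?t j i z)"
      proof (rule sum_mono)
        fix i assume i: "i \<in> neighbours j z"
        have "(1/2::real) ^ J \<le> (1/2) ^ j" using j by (intro power_decreasing) auto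
        then have zb: "z \<in> dyadic_block j i"
          using i order_trans[OF J(2)] z(1) by (simp add: neighbours_def dyadic_block_def)
        have "(1/2::real) ^ J = (1/2) ^ (J - j) * (1/2) ^ j" using j by (simp add: power_add[symmetric])
        then have "(1/2::real) ^ (J - j) = 2 ^ j * (1/2) ^ J" by (simp add: power_one_over)
        also have "\<dots> \<le> 2 ^ j * (2 * (1 - norm z))" using J(1) by (intro mult_left_mono) auto
        finally have "(1/2) ^ (J - j) \<le> 2 ^ Suc j * (1 - norm z)" by (simp only: power_Suc mult_ac)
        then have "(1/2) ^ (J - j) * (y j i powr q * \<omega> z) \<le> 2 ^ Suc j * (1 - norm z) * (y j i powr q * \<omega> z)"
          by (rule mult_right_mono) (use z in auto)
        then have "ennreal ((1/2) ^ (J - j) * y j i powr q * \<omega> z) \<le> ennreal (y j i powr q * (2 ^ Suc j * (1 - norm z) * \<omega> z))"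
          by (intro ennreal_leI) (simp add: mult_ac)
        also have "\<dots> = ennreal (y j i powr q) * ennreal (2 ^ Suc j * (1 - norm z) * \<omega> z)"
          using z by (intro ennreal_mult) auto
        also have "\<dots> = ennreal (y j i powr q) * ?t j i z" using zb by simp
        finally show "ennreal ((1/2) ^ (J - j) * y j i powr q * \<omega> z) \<le> ennreal (y j i powr q) * ?t j i z" .
      qed
      also have "\<dots> \<le> (\<Sum>i\<in>{0..<2 ^ j}. ennreal (y j i powr q) * ?t j i z)"
        by (intro sum_mono2) (auto simp: neighbours_def)
      finally show "(\<Sum>i\<in>neighbours j z. ennreal ((1/2) ^ (J - j) * y j i powr q * \<omega> z))
          \<le> (\<Sum>i\<in>{0..<2 ^ j}. ennreal (y j i powr q) * ?t j i z)" .
    qed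
    also have "\<dots> \<le> (\<Sum>j. \<Sum>i\<in>{0..<2 ^ j}. ennreal (y j i powr q) * ?t j i z)"
      by (rule sum_le_suminf) auto
    finally show "ennreal (u z * \<omega> z) \<le> ennreal C * (\<Sum>j. \<Sum>i\<in>{0..<2 ^ j}. ennreal (y j i powr q) * ?t j i z)"
      by (simp add: mult_left_mono)
  qed
  also have "\<dots> = ennreal C * (\<integral>\<^sup>+z. (\<Sum>j. \<Sum>i\<in>{0..<2 ^ j}. ennreal (y j i powr q) * ?t j i z) \<partial>area_measure)"
    by (intro nn_integral_cmult) measurable
  also have "(\<integral>\<^sup>+z. (\<Sum>j. \<Sum>i\<in>{0..<2 ^ j}. ennreal (y j i powr q) * ?t j i z) \<partial>area_measure)
      = (\<Sum>j. \<integral>\<^sup>+z. (\<Sum>i\<in>{0..<2 ^ j}. ennreal (y j i powr q) * ?t j i z) \<partial>area_measure)"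
    by (intro nn_integral_suminf) measurable
  also have "\<dots> = (\<Sum>j. ennreal (\<Sum>i\<in>{0..<2 ^ j}. height_coeff j i * y j i powr q))"
  proof (rule arg_cong[where f=suminf], rule ext)
    fix j
    have "(\<integral>\<^sup>+z. (\<Sum>i\<in>{0..<2 ^ j}. ennreal (y j i powr q) * ?t j i z) \<partial>area_measure)
        = (\<Sum>i\<in>{0..<2 ^ j}. \<integral>\<^sup>+z. ennreal (y j i powr q) * ?t j i z \<partial>area_measure)"
      by (intro nn_integral_sum) measurable
    also have "\<dots> = (\<Sum>i\<in>{0..<2 ^ j}. ennreal (y j i powr q) * (\<integral>\<^sup>+z. ?t j i z \<partial>area_measure))"
      by (intro sum.cong refl nn_integral_cmult) measurable
    also have "\<dots> = (\<Sum>i\<in>{0..<2 ^ j}. ennreal (height_coeff j i * y j i powr q))"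
    proof (intro sum.cong refl)
      fix i
      have "ennreal (height_coeff j i * y j i powr q) = ennreal (height_coeff j i) * ennreal (y j i powr q)"
        by (intro ennreal_mult height_coeff_nonneg) simp
      also have "\<dots> = ennreal (y j i powr q) * ennreal (height_coeff j i)" by (rule mult.commute)
      finally show "ennreal (y j i powr q) * (\<integral>\<^sup>+z. ?t j i z \<partial>area_measure) = ennreal (height_coeff j i * y j i powr q)"
        unfolding height_coeff weighted_area_def by (rule sym)
    qed
    also have "\<dots> = ennreal (\<Sum>i\<in>{0..<2 ^ j}. height_coeff j i * y j i powr q)"
      by (intro sum_ennreal) (auto simp: height_coeff_nonneg)
    finally show "(\<integral>\<^sup>+z. (\<Sum>i\<in>{0..<2 ^ j}. ennreal (y j i powr q) * ?t j i z) \<partial>area_measure)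
      = ennreal (\<Sum>i\<in>{0..<2 ^ j}. height_coeff j i * y j i powr q)" .
  qed
  finally show ?thesis .
qed

text \<open>For \<open>f\<close> of infinite norm there is nothing to show. Otherwise the averages \<open>y\<close> of \<open>|f|\<^bsup>\<alpha>\<^esup>\<close> are finite. The
area integral is bounded by the embedding theorem with the coefficients \<open>height_coeff\<close>, the derivatives at
the origin by the same theorem with a single coefficient at the root of the tree: the scale of the origin
is \<open>J = 0\<close>, so only \<open>y 0 0\<close> enters its pointwise bound.\<close>
theorem littlewood_paley_bound:
  assumes p: "0 < p"
  shows "\<exists>C>0. \<forall>f. f holomorphic_on unit_disc \<longrightarrow>
    (\<integral>\<^sup>+z. ennreal (norm ((deriv ^^ k) f z) powr p * (1 - norm z) powr (real k * p) * \<omega> z)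
        \<partial>area_measure)
      + ennreal (\<Sum>j<k. norm ((deriv ^^ j) f 0) powr p)
    \<le> ennreal C * bergman_norm_p p \<omega> f"
proof -
  define \<alpha> where "\<alpha> = p / q"
  have \<alpha>: "0 < \<alpha>" "\<alpha> * q = p" using p q by (auto simp: \<alpha>_def)
  obtain n :: nat where n: "log 2 (8 * D) / \<alpha> \<le> real n" using real_arch_simple by blast
  \<comment> \<open>The power \<open>n\<close> of the auxiliary factor depends on the doubling constant of \<open>\<nu>\<close>.\<close>
  have n8: "8 * D \<le> 2 powr (real n * (p / q))"
  proof -
    have "log 2 (8 * D) \<le> real n * \<alpha>" using n \<alpha> by (simp add: field_simps)
    then show ?thesis using D(1) by (simp add: \<alpha>_def log_le_iff)
  qed
  define c where "c k = (fact k * 4 ^ k) powr p * ((8 * D * 6 powr (real n * (p / q))) powr q * 6 powr q)" for k :: nat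
  have c0: "0 \<le> c k" for k by (simp add: c_def)
  obtain E where E: "0 \<le> E" "\<And>A a n g y. 0 \<le> A \<Longrightarrow> (\<And>Q. 0 \<le> a Q) \<Longrightarrow>
      (\<And>l j. 0 \<le> j \<Longrightarrow> j < 2 ^ l \<Longrightarrow>
        (\<Sum>Q\<in>{Q\<in>dyadic_indices n. case_prod dyadic_square Q \<subseteq> dyadic_square l j}. a Q) \<le> A * W l j) \<Longrightarrow>
      mean_bounded_by y g \<Longrightarrow>
      ennreal (\<Sum>Q\<in>dyadic_indices n. a Q * case_prod y Q powr q)
        \<le> ennreal (E * A) * (\<integral>\<^sup>+z. ennreal (g z powr q * \<omega> z) \<partial>area_measure)"
    by (rule dyadic_mean_embedding) blast
  obtain B where B: "0 < B" "\<And>m i. 0 \<le> i \<Longrightarrow> i < 2 ^ m \<Longrightarrow> Wb m i \<le> B * W m i"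
    by (rule block_doubling) blast
  have W00: "0 < W 0 0" by (rule W_pos) auto
  define E1 where "E1 = E * (12 * B)"
  define E0 where "E0 = E * (1 / W 0 0)"
  have E01: "0 \<le> E1" "0 \<le> E0" using E(1) B(1) W00 by (auto simp: E1_def E0_def)
  define C where "C = c k * E1 + (\<Sum>j<k. c j) * E0 + 1"
  have C: "0 < C" unfolding C_def
    using c0 E01 by (intro add_nonneg_pos add_nonneg_nonneg mult_nonneg_nonneg sum_nonneg) auto
  show ?thesis
  proof (rule exI[of _ C], intro conjI allI impI)
    show "0 < C" by (rule C)
    fix f assume f: "f holomorphic_on unit_disc"
    let ?N = "bergman_norm_p p \<omega> f"
    show "(\<integral>\<^sup>+z. ennreal (norm ((deriv ^^ k) f z) powr p * (1 - norm z) powr (real k * p) * \<omega> z) \<partial>area_measure)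
      + ennreal (\<Sum>j<k. norm ((deriv ^^ j) f 0) powr p) \<le> ennreal C * ?N"
    proof (cases "?N = \<infinity>")
      case True
      then have "ennreal C * ?N = \<infinity>" using C by (simp add: ennreal_mult_top)
      then show ?thesis by simp
    next
      case False
      define g where "g z = norm (f z) powr \<alpha>" for z
      have g: "g \<in> borel_measurable area_measure" "\<And>z. norm z < 1 \<Longrightarrow> 0 \<le> g z"
        using measurable_norm_powr_area[OF f \<alpha>(1)] by (auto simp: g_def[abs_def])
      have gN: "(\<integral>\<^sup>+z. ennreal (g z powr q * \<omega> z) \<partial>area_measure) = ?N"
        using \<alpha>(2) by (simp add: bergman_norm_p_def g_def powr_powr)
      have fin: "(\<integral>\<^sup>+z. ennreal (g z powr q * \<omega> z) \<partial>area_measure) < \<infinity>"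
        using False unfolding gN by (simp add: less_top)
      let ?I = "\<lambda>m i. weighted_area (\<lambda>z. g z * \<nu> z) (dyadic_square m i)"
      define y where "y m i = enn2real (?I m i) / V m i" for m i
      have y0: "0 \<le> y m i" for m i using V_nonneg by (simp add: y_def)
      have yV: "ennreal (y m i * V m i) = ?I m i" if "0 \<le> i" "i < 2 ^ m" for m i
        using V_pos[OF that] weighted_mean_finite[OF g fin, of m i] by (simp add: y_def)
      have mb: "mean_bounded_by y g" using g y0 yV by (auto simp: mean_bounded_by_def)
      have bound: "norm ((deriv ^^ k) f z) powr p * (1 - norm z) powr (real k * p)
          \<le> c k * (\<Sum>j\<le>J. \<Sum>i\<in>neighbours j z. (1/2) ^ (J - j) * y j i powr q)"
        if "norm z < 1" "(1/2) ^ Suc J < 1 - norm z" "1 - norm z \<le> (1/2) ^ J" for z J k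
        unfolding c_def by (rule derivative_dyadic_bound[OF p n8 f y0 _ that]) (use yV in \<open>simp add: g_def \<alpha>_def\<close>)
      have "(\<integral>\<^sup>+z. ennreal (norm ((deriv ^^ k) f z) powr p * (1 - norm z) powr (real k * p) * \<omega> z) \<partial>area_measure)
          \<le> ennreal (c k) * (\<Sum>j. ennreal (\<Sum>i\<in>{0..<2 ^ j}. height_coeff j i * y j i powr q))"
        by (rule derivative_area_bound[OF c0 y0 bound])
      also have "\<dots> \<le> ennreal (c k) * (ennreal E1 * ?N)"
      proof (intro mult_left_mono suminf_le_const summableI)
        fix n
        have "(\<Sum>j<n. ennreal (\<Sum>i\<in>{0..<2 ^ j}. height_coeff j i * y j i powr q))
            = ennreal (\<Sum>j<n. \<Sum>i\<in>{0..<2 ^ j}. height_coeff j i * y j i powr q)"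
          by (intro sum_ennreal sum_nonneg) (auto simp: height_coeff_nonneg)
        also have "\<dots> \<le> ennreal E1 * ?N"
        proof -
          have "(\<Sum>j<n. \<Sum>i\<in>{0..<2 ^ j}. height_coeff j i * y j i powr q)
              = (\<Sum>Q\<in>dyadic_indices n. case_prod height_coeff Q * case_prod y Q powr q)"
            unfolding dyadic_indices_def by (subst sum.Sigma) (auto intro: sum.cong)
          also have "ennreal \<dots> \<le> ennreal E1 * ?N"
            unfolding E1_def gN[symmetric]
          proof (rule E(2)[OF _ _ _ mb])
            show "0 \<le> 12 * B" using B(1) by simp
            show "0 \<le> case_prod height_coeff Q" for Q by (cases Q) (simp add: height_coeff_nonneg)
            fix l :: nat and j :: int assume "0 \<le> j" "j < 2 ^ l"
            then have "12 * Wb l j \<le> 12 * B * W l j" using B(2) by simp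
            then show "(\<Sum>Q\<in>{Q\<in>dyadic_indices n. case_prod dyadic_square Q \<subseteq> dyadic_square l j}. case_prod height_coeff Q) \<le> 12 * B * W l j"
              using height_coeff_carleson[of n l j] by simp
          qed
          finally show ?thesis .
        qed
        finally show "(\<Sum>j<n. ennreal (\<Sum>i\<in>{0..<2 ^ j}. height_coeff j i * y j i powr q)) \<le> ennreal E1 * ?N" .
      qed simp
      also have "\<dots> = ennreal (c k * E1) * ?N" using c0 E01 by (simp add: ennreal_mult mult.assoc)
      finally have first: "(\<integral>\<^sup>+z. ennreal (norm ((deriv ^^ k) f z) powr p * (1 - norm z) powr (real k * p) * \<omega> z) \<partial>area_measure)
          \<le> ennreal (c k * E1) * ?N" .
      have at0: "norm ((deriv ^^ j) f 0) powr p \<le> c j * y 0 0 powr q" for j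
      proof -
        have "neighbours 0 0 = {0}" by (auto simp: neighbours_def)
        then show ?thesis using bound[of 0 0 j] by simp
      qed
      have origin: "ennreal (y 0 0 powr q) \<le> ennreal E0 * ?N"
      proof -
        have K1: "dyadic_indices 1 = {(0, 0)}" by (auto simp: dyadic_indices_def)
        have "ennreal (\<Sum>Q\<in>dyadic_indices 1. (if Q = (0, 0) then 1 else 0) * case_prod y Q powr q) \<le> ennreal E0 * ?N"
          unfolding E0_def gN[symmetric]
        proof (rule E(2)[OF _ _ _ mb])
          fix l :: nat and j :: int assume lj: "0 \<le> j" "j < 2 ^ l"
          show "(\<Sum>Q\<in>{Q\<in>dyadic_indices 1. case_prod dyadic_square Q \<subseteq> dyadic_square l j}. if Q = (0, 0) then 1 else 0)
              \<le> 1 / W 0 0 * W l j"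
          proof (cases "dyadic_square 0 0 \<subseteq> dyadic_square l j")
            case True
            then have "l = 0" "j = 0" using dyadic_square_subset_cases[OF True] lj by auto
            moreover have "(\<Sum>Q\<in>{Q\<in>dyadic_indices 1. case_prod dyadic_square Q \<subseteq> dyadic_square l j}. if Q = (0, 0) then 1 else 0 :: real) \<le> 1"
              by (subst sum.delta) (auto simp: K1)
            ultimately show ?thesis using W00 by simp
          next
            case False
            then have empty: "{Q\<in>dyadic_indices 1. case_prod dyadic_square Q \<subseteq> dyadic_square l j} = {}" unfolding K1 by auto
            show ?thesis unfolding empty using W00 W_nonneg by simp
          qed
        qed (use W00 in auto)
        then show ?thesis unfolding K1 by simp
      qed
      have "ennreal (\<Sum>j<k. norm ((deriv ^^ j) f 0) powr p) \<le> ennreal ((\<Sum>j<k. c j) * y 0 0 powr q)"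
        unfolding sum_distrib_right by (intro ennreal_leI sum_mono at0)
      also have "\<dots> = ennreal (\<Sum>j<k. c j) * ennreal (y 0 0 powr q)" using c0 by (intro ennreal_mult sum_nonneg) auto
      also have "\<dots> \<le> ennreal (\<Sum>j<k. c j) * (ennreal E0 * ?N)"
        by (intro mult_left_mono origin) simp
      also have "\<dots> = ennreal ((\<Sum>j<k. c j) * E0) * ?N"
        using c0 E01 by (simp add: ennreal_mult sum_nonneg mult.assoc)
      finally have second: "ennreal (\<Sum>j<k. norm ((deriv ^^ j) f 0) powr p) \<le> ennreal ((\<Sum>j<k. c j) * E0) * ?N" .
      have "(\<integral>\<^sup>+z. ennreal (norm ((deriv ^^ k) f z) powr p * (1 - norm z) powr (real k * p) * \<omega> z) \<partial>area_measure)
          + ennreal (\<Sum>j<k. norm ((deriv ^^ j) f 0) powr p) \<le> ennreal (c k * E1) * ?N + ennreal ((\<Sum>j<k. c j) * E0) * ?N"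
        by (rule add_mono[OF first second])
      also have "\<dots> = ennreal (c k * E1 + (\<Sum>j<k. c j) * E0) * ?N"
        using c0 E01 by (subst ennreal_plus) (auto simp: sum_nonneg distrib_right)
      also have "\<dots> \<le> ennreal C * ?N" unfolding C_def by (intro mult_right_mono ennreal_leI) auto
      finally show ?thesis .
    qed
  qed
qed

end

theorem theorem2:
  fixes p :: real and k :: nat and \<omega> :: "complex \<Rightarrow> real"
  assumes "0 < p" and "1 \<le> k" and "\<omega> \<in> B_infinity_D_hat"
  shows "\<exists>C>0. \<forall>f. f holomorphic_on unit_disc \<longrightarrow>
    (\<integral>\<^sup>+z. ennreal (norm ((deriv ^^ k) f z) powr p * (1 - norm z) powr (real k * p) * \<omega> z)
        \<partial>area_measure)
      + ennreal (\<Sum>j<k. norm ((deriv ^^ j) f 0) powr p)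
    \<le> ennreal C * bergman_norm_p p \<omega> f"
proof -
  obtain \<nu> q where \<nu>: "\<nu> \<in> D_hat" and q: "1 < q" "weight \<omega>" "quotient_in_B q \<nu> \<omega>"
    using assms(3) by (auto simp: B_infinity_D_hat_def B_infinity_def)
  obtain D where D: "1 \<le> D" "\<And>m. weighted_area \<nu> (annulus m) \<le> ennreal D * weighted_area \<nu> (annulus (Suc m))"
    using D_hat_doubling[OF \<nu>] by blast
  have "radial_weight \<nu>" using \<nu> by (simp add: D_hat_def)
  then interpret bekolle_weight q \<nu> \<omega> D by unfold_locales (use q D in auto)
  show ?thesis by (rule littlewood_paley_bound[OF assms(1)])
qed

end
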